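(* Let $c_1(x),c_2(x),f_1(x),f_2(x)\in\mathbb{Q}[x]$ be non-zero polynomials, and for a positive integer $n$ define $u_n(x)=c_1(x)f_1(x)^n+c_2(x)f_2(x)^n$. Assume that there do NOT exist $a,b\in\mathbb{Z}$ with $b\neq0$ and $\delta,\varepsilon\in\{1,-1\}$ such that $c_2(x)/c_1(x)=\delta x^a$ and $f_2(x)/f_1(x)=\varepsilon x^b$ in $\mathbb{Q}(x)$. Set $$D:=\max\{\deg c_1,\deg c_2,\deg f_1,\deg f_2\},\qquad X:=\max\{3,\mathrm{h}(c_1,c_2),\mathrm{h}(f_1,f_2)\}.$$ Let $m$ be a positive integer and $\zeta$ a primitive $m$th root of unity such that for some positive integer $n$ the polynomial $u_n(x)$ is not identically zero but $u_n(\zeta)=0$. Then $$m\le e^{100D(X+D)}.$$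
   Context: Heights: for a primitive vector $\mathbf{a}=(a_1,\ldots,a_k)\in\mathbb{Z}^k$ (i.e. $\gcd(a_1,\ldots,a_k)=1$) put $\mathrm{h}(\mathbf{a}):=\log\max\{|a_1|,\ldots,|a_k|\}$. For a non-zero vector $\mathbf{a}$ with rational entries, there is $\lambda\in\mathbb{Q}^\times$, unique up to sign, such that $\lambda\mathbf{a}$ is a primitive integer vector, and $\mathrm{h}(\mathbf{a}):=\mathrm{h}(\lambda\mathbf{a})$. For a non-zero vector $(g_1,\ldots,g_k)$ of polynomials in $\mathbb{Q}[x]$, $\mathrm{h}(g_1,\ldots,g_k)$ is the height of the vector formed of the coefficients of all the polynomials $g_1,\ldots,g_k$. *)

theory Defs
  imports Complex_Main "HOL-Computational_Algebra.Computational_Algebra"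
begin

definition primitive_vec :: "int list \<Rightarrow> bool" where
  "primitive_vec a \<longleftrightarrow> Gcd (set a) = 1"

definition primitive_height :: "int list \<Rightarrow> real" where
  "primitive_height a = ln (real_of_int (Max (abs ` set a)))"

(* Meaningful only for a non-zero vector: see vec_height_eq and ex_primitive_multiple. *)
definition vec_height :: "rat list \<Rightarrow> real" where
  "vec_height a = (THE h. \<exists>c b. c \<noteq> 0 \<and> primitive_vec b \<and>
     map of_int b = map (\<lambda>x. c * x) a \<and> h = primitive_height b)"

(* The polynomials contribute their coefficients up to their own degree; padding with
   zero coefficients would not change the height. *)
definition poly_height :: "rat poly list \<Rightarrow> real" where
  "poly_height gs = vec_height (concat (map coeffs gs))"

definition primitive_root_of_unity :: "nat \<Rightarrow> complex \<Rightarrow> bool" where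
  "primitive_root_of_unity m z \<longleftrightarrow> 0 < m \<and> z ^ m = 1 \<and> (\<forall>k. 0 < k \<and> k < m \<longrightarrow> z ^ k \<noteq> 1)"

lemma ex_primitive_multiple:
  assumes "\<exists>x \<in> set a. x \<noteq> 0"
  shows "\<exists>c b. c \<noteq> 0 \<and> primitive_vec b \<and> map of_int b = map (\<lambda>x. c * x) (a :: rat list)"
proof -
  have "\<exists>N::int. N > 0 \<and> (\<forall>x\<in>set a. of_int N * x \<in> \<int>)"
  proof (induction a)
    case Nil
    show ?case by (intro exI[of _ 1]) auto
  next
    case (Cons x xs)
    then obtain N :: int where N: "N > 0" "\<forall>y\<in>set xs. of_int N * y \<in> \<int>" by blast
    obtain p q where x: "x = of_int p / of_int q" "q > 0"
      by (metis Fract_of_int_quotient Rat_cases)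
    have "of_int (N * q) * x = of_int (N * p)" using x by simp
    then have "of_int (N * q) * x \<in> \<int>" by (metis Ints_of_int)
    moreover have "of_int (N * q) * y \<in> \<int>" if "y \<in> set xs" for y
    proof -
      have "of_int (N * q) * y = of_int q * (of_int N * y)" by simp
      then show ?thesis using N(2) that by (metis Ints_mult Ints_of_int)
    qed
    ultimately show ?case using N(1) x(2) by (intro exI[of _ "N * q"]) auto
  qed
  then obtain N :: int where N: "N > 0" "\<forall>x\<in>set a. of_int N * x \<in> \<int>" by blast
  define v where "v = map (\<lambda>x. \<lfloor>of_int N * x\<rfloor>) a"
  have v: "map of_int v = map (\<lambda>x. of_int N * x) a"
    using N(2) by (auto simp: v_def)
  define d where "d = Gcd (set v)"
  obtain x where x: "x \<in> set a" "x \<noteq> 0" using assms by blast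
  have "of_int \<lfloor>of_int N * x\<rfloor> = of_int N * x" using N(2) x(1) by simp
  then have "\<lfloor>of_int N * x\<rfloor> \<noteq> 0" using x(2) N(1) by auto
  then have "d \<noteq> 0" using x(1) by (auto simp: d_def v_def)
  define b where "b = map (\<lambda>y. y div d) v"
  have db: "map ((*) d) b = v"
    by (auto simp: b_def d_def intro!: map_idI)
  have "d = Gcd ((*) d ` set b)" by (metis db d_def list.set_map)
  also have "\<dots> = normalize (d * Gcd (set b))" by (simp add: Gcd_mult)
  finally have "normalize d = normalize d * Gcd (set b)"
    by (simp add: d_def normalize_mult)
  then have "primitive_vec b" using \<open>d \<noteq> 0\<close> by (simp add: primitive_vec_def)
  moreover have "map of_int b = map (\<lambda>x. (of_int N / of_int d) * x) a"
  proof -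
    have "rat_of_int (y div d) = of_int y / of_int d" if "y \<in> set v" for y
      using that \<open>d \<noteq> 0\<close> by (simp add: d_def of_int_div)
    then have "map rat_of_int b = map (\<lambda>y. y / of_int d) (map of_int v)"
      by (simp add: b_def)
    then show ?thesis by (simp add: v)
  qed
  moreover have "rat_of_int N / of_int d \<noteq> 0" using N(1) \<open>d \<noteq> 0\<close> by simp
  ultimately show ?thesis by blast
qed

lemma primitive_multiple_abs_eq:
  assumes "primitive_vec b" "primitive_vec b'"
    and "c \<noteq> 0" "map rat_of_int b' = map (\<lambda>x. c * x) (map of_int b)"
  shows "map abs b' = map abs b"
proof -
  obtain p q where c: "c = of_int p / of_int q" "q > 0"
    by (metis Fract_of_int_quotient Rat_cases)
  have "map rat_of_int (map ((*) q) b') = map of_int (map ((*) p) b)"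
    using assms(4) c by (auto simp: list_eq_iff_nth_eq field_simps)
  then have eq: "map ((*) q) b' = map ((*) p) b"
    by (metis (no_types, lifting) of_int_eq_iff injI inj_map_eq_map)
  have "Gcd ((*) q ` set b') = Gcd ((*) p ` set b)"
    by (metis eq list.set_map)
  then have "\<bar>q\<bar> = \<bar>p\<bar>"
    using assms(1,2) by (simp add: Gcd_mult primitive_vec_def)
  then have "\<bar>c\<bar> = 1" using c by (simp add: abs_divide flip: of_int_abs)
  then have "c = 1 \<or> c = -1" by linarith
  then have "\<bar>rat_of_int (b' ! i)\<bar> = \<bar>rat_of_int (b ! i)\<bar>" if "i < length b" for i
    using assms(4) that by (auto simp: list_eq_iff_nth_eq)
  moreover have "length b' = length b" using assms(4) by (metis length_map)
  ultimately show ?thesis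
    by (auto simp: list_eq_iff_nth_eq simp flip: of_int_abs)
qed

lemma vec_height_eq:
  assumes "primitive_vec b" "c \<noteq> 0" "map of_int b = map (\<lambda>x. c * x) a"
  shows "vec_height a = primitive_height b"
  unfolding vec_height_def
proof (rule the_equality)
  fix h
  assume "\<exists>c b. c \<noteq> 0 \<and> primitive_vec b \<and>
     map of_int b = map (\<lambda>x. c * x) a \<and> h = primitive_height b"
  then obtain c' b' where b': "c' \<noteq> 0" "primitive_vec b'"
    "map of_int b' = map (\<lambda>x. c' * x) a" "h = primitive_height b'" by blast
  have "map rat_of_int b' = map (\<lambda>x. (c' / c) * x) (map of_int b)"
    unfolding assms(3) b'(3) using assms(2) by simp
  then have "map abs b' = map abs b"
    using primitive_multiple_abs_eq[OF assms(1) b'(2), of "c' / c"] assms(2) b'(1) by simp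
  then have "abs ` set b' = abs ` set b" by (metis list.set_map)
  then show "h = primitive_height b" by (simp add: b'(4) primitive_height_def)
qed (use assms in blast)

end

theory Submission
  imports Defs "HOL-Number_Theory.Totient" "HOL-Library.FuncSet"
    "HOL-Computational_Algebra.Field_as_Ring"
begin

text \<open>
  Clear denominators so that \<open>C1 F1^n + C2 F2^n\<close> vanishes at \<open>\<zeta>\<close> with integer polynomials bounded by
  \<open>H = (D + 1) e^X\<close> on the unit circle; comparing degrees gives \<open>\<phi>(m) \<le> D (n + 1)\<close>. Put
  \<open>\<beta> = F1(\<zeta>)/F2(\<zeta>)\<close>, so that \<open>C1(\<zeta>) \<beta>^n = - C2(\<zeta>)\<close>, and likewise at all conjugates.

  If \<open>|\<beta>| \<noteq> 1\<close>, then \<open>|F1|^2 - |F2|^2\<close> has norm at least 1, so its absolute value is at least 1 on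
  average over the conjugates, while \<open>n |ln |\<beta>||\<close> is on average at most \<open>4 ln H\<close>. This bounds \<open>n\<close>.

  If all conjugates of \<open>\<beta>\<close> have absolute value 1 and \<open>\<beta>\<close> lies in \<open>\<int>[\<zeta>]\<close>, then \<open>\<beta>\<close> is a root of unity
  (Kronecker), and by the box principle \<open>\<zeta>^s \<beta>^t = 1\<close> for some \<open>s, t\<close> of size about \<open>sqrt m\<close>. For large
  \<open>m\<close> this is an identity between polynomials, which forces \<open>f2/f1\<close>, and in the same way \<open>c2/c1\<close>, to be
  \<open>\<plusminus> x^b\<close>.

  If finally \<open>\<beta>\<close> is not in \<open>\<int>[\<zeta>]\<close>, some prime \<open>p\<close> divides its denominator. Write \<open>m = p^r m'\<close> with
  \<open>m'\<close> prime to \<open>p\<close>. Then \<open>C1(\<zeta>)\<close> is divisible by the \<open>n\<close>-th power of a prime ideal over \<open>p\<close>, whose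
  residue field contains the \<open>m'\<close>-th roots of unity; hence \<open>m'^n \<le> H^(2 \<phi>(m))\<close>, and since
  \<open>\<phi>(m) \<le> 2 D n\<close> this gives \<open>m' \<le> H^(4 D)\<close>. If the ramification index \<open>\<phi>(p^r)\<close> exceeds \<open>D\<close>, such a
  divisibility is impossible for \<open>n > D\<close>, because \<open>C1\<close> modulo \<open>p\<close> has no zero of multiplicity above \<open>D\<close>.
\<close>

section \<open>Integer polynomials at complex points\<close>

definition ipoly :: "int poly \<Rightarrow> complex \<Rightarrow> complex" where
  "ipoly P z = poly (map_poly of_int P) z"

lemma ipoly_0 [simp]: "ipoly 0 z = 0"
  by (simp add: ipoly_def)

lemma ipoly_pCons [simp]: "ipoly (pCons a P) z = of_int a + z * ipoly P z"
  by (simp add: ipoly_def map_poly_pCons)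

lemma ipoly_1 [simp]: "ipoly 1 z = 1"
  by (simp add: ipoly_def)

lemma ipoly_add [simp]: "ipoly (P + Q) z = ipoly P z + ipoly Q z"
  by (induction P Q rule: poly_induct2) (auto simp: algebra_simps)

lemma ipoly_uminus [simp]: "ipoly (- P) z = - ipoly P z"
  by (induction P) auto

lemma ipoly_diff [simp]: "ipoly (P - Q) z = ipoly P z - ipoly Q z"
  using ipoly_add[of P "- Q" z] by simp

lemma ipoly_smult [simp]: "ipoly (smult c P) z = of_int c * ipoly P z"
  by (induction P) (auto simp: algebra_simps)

lemma ipoly_mult [simp]: "ipoly (P * Q) z = ipoly P z * ipoly Q z"
  by (induction P) (auto simp: algebra_simps)

lemma ipoly_power [simp]: "ipoly (P ^ n) z = ipoly P z ^ n"
  by (induction n) auto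

lemma ipoly_sum [simp]: "ipoly (sum f A) z = (\<Sum>i\<in>A. ipoly (f i) z)"
  by (induction A rule: infinite_finite_induct) auto

lemma ipoly_prod [simp]: "ipoly (prod f A) z = (\<Prod>i\<in>A. ipoly (f i) z)"
  by (induction A rule: infinite_finite_induct) auto

lemma ipoly_monom [simp]: "ipoly (monom c n) z = of_int c * z ^ n"
  by (simp add: ipoly_def map_poly_monom poly_monom)

lemma ipoly_of_nat [simp]: "ipoly (of_nat c) z = of_nat c"
  by (simp add: of_nat_poly)

lemma ipoly_pcompose [simp]: "ipoly (pcompose P Q) z = ipoly P (ipoly Q z)"
  by (induction P) (auto simp: pcompose_pCons)

lemma ipoly_cnj: "ipoly P (cnj z) = cnj (ipoly P z)"
  by (induction P) auto

text \<open>One integer polynomial \<open>S\<close> serves all \<open>z\<close>. With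
  \<open>A = x^q\<close> and \<open>B = x\<close> it makes \<open>P(\<zeta>^q) - P(\<zeta>)\<close>
  a multiple of \<open>\<zeta>^q - \<zeta>\<close> inside \<int>[\<zeta>].\<close>

lemma ipoly_diff_dvd: "\<exists>S. \<forall>z. ipoly P (ipoly A z) - ipoly P (ipoly B z)
    = (ipoly A z - ipoly B z) * ipoly S z"
proof (induction P)
  case 0
  show ?case by (intro exI[of _ 0]) simp
next
  case (pCons a P)
  then obtain S where S: "\<And>z. ipoly P (ipoly A z) - ipoly P (ipoly B z)
    = (ipoly A z - ipoly B z) * ipoly S z" by blast
  have "ipoly (pCons a P) (ipoly A z) - ipoly (pCons a P) (ipoly B z)
      = (ipoly A z - ipoly B z) * ipoly (pcompose P A + B * S) z" for z
  proof -
    have "ipoly (pCons a P) (ipoly A z) - ipoly (pCons a P) (ipoly B z)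
      = (ipoly A z - ipoly B z) * ipoly P (ipoly A z)
        + ipoly B z * (ipoly P (ipoly A z) - ipoly P (ipoly B z))"
      by (simp add: algebra_simps)
    then show ?thesis unfolding S by (simp add: algebra_simps)
  qed
  then show ?case by blast
qed

lemma card_complex_roots_le:
  assumes "finite A" "\<And>z. z \<in> A \<Longrightarrow> poly p z = 0" "p \<noteq> (0 :: complex poly)"
  shows "card A \<le> degree p"
proof -
  have "card A \<le> card {z. poly p z = 0}"
    using assms poly_roots_finite by (intro card_mono) auto
  also have "\<dots> \<le> degree p" using assms(3) by (rule card_poly_roots_bound)
  finally show ?thesis .
qed

lemma degree_of_int_poly [simp]:
  "degree (map_poly of_int (P :: int poly) :: complex poly) = degree P"
  by (intro degree_map_poly) auto

lemma of_int_poly_eq_0_iff [simp]: "(map_poly of_int (P :: int poly) :: complex poly) = 0 \<longleftrightarrow> P = 0"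
  by (intro map_poly_eq_0_iff) auto

lemma card_ipoly_roots_le:
  assumes "finite A" "\<And>z. z \<in> A \<Longrightarrow> ipoly P z = 0" "P \<noteq> 0"
  shows "card A \<le> degree P"
  using card_complex_roots_le[of A "map_poly of_int P"] assms by (simp add: ipoly_def)

text \<open>Pseudo-division multiplies the dividend by a power of the leading coefficient, here 1,
  so it is genuine division without denominators.\<close>

lemma monic_division:
  fixes f g :: "int poly"
  assumes "lead_coeff g = 1"
  obtains q r where "f = g * q + r" "r = 0 \<or> degree r < degree g"
proof -
  have g: "g \<noteq> 0" using assms by auto
  obtain q r where "pseudo_divmod f g = (q, r)" by force
  from pseudo_divmod[OF g this] assms show thesis by (intro that[of q r]) auto
qed

section \<open>Frobenius congruences modulo a prime\<close>

lemma frobenius_add: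
  fixes x y :: "'a :: comm_ring_1"
  assumes "prime p"
  shows "of_nat p dvd (x + y) ^ p - (x ^ p + y ^ p)"
proof -
  have p: "p > 0" using assms prime_gt_0_nat by blast
  have "(x + y) ^ p = (\<Sum>k\<le>p. of_nat (p choose k) * x ^ k * y ^ (p - k))"
    by (rule binomial_ring)
  also have "\<dots> = (\<Sum>k\<in>{0,p}. of_nat (p choose k) * x ^ k * y ^ (p - k))
      + (\<Sum>k\<in>{..p} - {0,p}. of_nat (p choose k) * x ^ k * y ^ (p - k))"
    by (subst sum.subset_diff[of "{0,p}"]) (auto simp: add.commute)
  also have "(\<Sum>k\<in>{0,p}. of_nat (p choose k) * x ^ k * y ^ (p - k)) = x ^ p + y ^ p"
    using p by (simp add: add.commute)
  finally have eq: "(x + y) ^ p - (x ^ p + y ^ p)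
    = (\<Sum>k\<in>{..p} - {0,p}. of_nat (p choose k) * x ^ k * y ^ (p - k))" by simp
  have "of_nat p dvd (of_nat (p choose k) * x ^ k * y ^ (p - k) :: 'a)"
    if "k \<in> {..p} - {0,p}" for k
  proof -
    have "p dvd (p choose k)" using that assms by (intro dvd_choose_prime) auto
    then have "(of_nat p :: 'a) dvd of_nat (p choose k)" by (auto elim: dvdE)
    then show ?thesis by (simp add: mult.assoc)
  qed
  then show ?thesis unfolding eq by (rule dvd_sum)
qed

lemma dvd_diff_trans:
  fixes a b c d :: "'a :: comm_ring_1"
  assumes "d dvd a - b" "d dvd b - c"
  shows "d dvd a - c"
  using dvd_add[OF assms] by simp

lemma dvd_power_diff:
  fixes a b d :: "'a :: comm_ring_1"
  assumes "d dvd a - b"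
  shows "d dvd a ^ n - b ^ n"
proof (induction n)
  case (Suc n)
  have "a ^ Suc n - b ^ Suc n = a * (a ^ n - b ^ n) + (a - b) * b ^ n"
    by (simp add: algebra_simps)
  then show ?case using Suc assms by (metis dvd_add dvd_mult dvd_mult2)
qed simp

lemma fermat_int:
  assumes "prime p"
  shows "int p dvd a ^ p - a"
proof -
  have p: "p > 0" using assms prime_gt_0_nat by blast
  have nat: "int p dvd int n ^ p - int n" for n
  proof (induction n)
    case (Suc n)
    have "int p dvd (int n + 1) ^ p - (int n ^ p + 1 ^ p)"
      using frobenius_add[OF assms, of "int n" 1] by simp
    with Suc have "int p dvd (int n ^ p - int n) + ((int n + 1) ^ p - (int n ^ p + 1 ^ p))"
      by (rule dvd_add)
    then show ?case by (simp add: algebra_simps)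
  qed (use p in \<open>simp add: power_0_left\<close>)
  define n where "n = nat (a mod int p)"
  have "int n = a mod int p" using p by (simp add: n_def)
  then have d: "int p dvd a - int n" by (simp add: dvd_minus_mod)
  then have "int p dvd a ^ p - int n ^ p" by (rule dvd_power_diff)
  with nat[of n] have "int p dvd (a ^ p - int n ^ p) + (int n ^ p - int n)"
    by (rule dvd_add[rotated])
  with d have "int p dvd (a ^ p - int n ^ p) + (int n ^ p - int n) - (a - int n)"
    by (rule dvd_diff[rotated])
  then show ?thesis by simp
qed

lemma pcompose_monom: "pcompose (monom 1 n) Q = (Q :: 'a :: comm_semiring_1 poly) ^ n"
  by (induction n) (simp_all add: monom_Suc pcompose_pCons pcompose_1)

text \<open>Induction over the coefficients: \<open>a^p\<close> agrees with \<open>a\<close> modulo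
  \<open>p\<close> by Fermat, and the cross terms drop out by \<open>frobenius_add\<close>.\<close>

lemma frobenius_poly_1:
  fixes P :: "int poly"
  assumes "prime p"
  shows "of_nat p dvd P ^ p - pcompose P (monom 1 p)"
proof (induction P)
  case 0
  show ?case using prime_gt_0_nat[OF assms] by (simp add: power_0_left)
next
  case (pCons a P)
  let ?X = "[:0, 1:] :: int poly" and ?p = "of_nat p :: int poly"
  have "pCons a P = [:a:] + ?X * P" by simp
  then have "?p dvd pCons a P ^ p - ([:a:] ^ p + (?X * P) ^ p)"
    using frobenius_add[OF assms] by metis
  moreover have "?p dvd ([:a:] ^ p + (?X * P) ^ p) - ([:a:] + ?X ^ p * pcompose P (monom 1 p))"
  proof -
    have gen: "u - v + w * (x - y) = (u + w * x) - (v + w * y)" for u v w x y :: "int poly"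
      by (simp add: algebra_simps)
    have "int p dvd a ^ p - a" using assms by (rule fermat_int)
    then have "?p dvd [:a ^ p - a:]"
      by (simp add: of_nat_poly)
    moreover have "?p dvd ?X ^ p * (P ^ p - pcompose P (monom 1 p))"
      using pCons.IH by (rule dvd_mult)
    ultimately have "?p dvd [:a ^ p - a:] + ?X ^ p * (P ^ p - pcompose P (monom 1 p))"
      by (rule dvd_add)
    also have "[:a ^ p - a:] = [:a:] ^ p - [:a:]" by (simp add: poly_const_pow)
    also have "[:a:] ^ p - [:a:] + ?X ^ p * (P ^ p - pcompose P (monom 1 p))
        = ([:a:] ^ p + (?X * P) ^ p) - ([:a:] + ?X ^ p * pcompose P (monom 1 p))"
      unfolding power_mult_distrib by (rule gen)
    finally show ?thesis .
  qed
  ultimately have "?p dvd pCons a P ^ p - ([:a:] + ?X ^ p * pcompose P (monom 1 p))"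
    by (rule dvd_diff_trans)
  then show ?case by (simp add: pcompose_pCons monom_altdef)
qed

lemma frobenius_poly:
  fixes P :: "int poly"
  assumes "prime p"
  shows "of_nat p dvd P ^ (p ^ s) - pcompose P (monom 1 (p ^ s))"
proof (induction s)
  case 0
  show ?case by (simp add: monom_altdef)
next
  case (Suc s)
  let ?p = "of_nat p :: int poly" and ?Q = "pcompose P (monom 1 (p ^ s))"
  have "?p dvd (P ^ (p ^ s)) ^ p - ?Q ^ p" using Suc by (rule dvd_power_diff)
  moreover have "?p dvd ?Q ^ p - pcompose ?Q (monom 1 p)" by (rule frobenius_poly_1[OF assms])
  ultimately have "?p dvd (P ^ (p ^ s)) ^ p - pcompose ?Q (monom 1 p)"
    by (rule dvd_diff_trans)
  moreover have "pcompose (monom 1 (p ^ s)) (monom 1 p) = (monom 1 (p ^ Suc s) :: int poly)"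
    by (simp add: pcompose_monom monom_power mult.commute)
  ultimately show ?case by (simp flip: pcompose_assoc power_mult add: mult.commute)
qed

text \<open>The error polynomial \<open>A\<close> is the same for all \<open>z\<close>, so at points
  of \<int>[\<zeta>] the two sides differ by \<open>p\<close> times an element of that ring.\<close>

lemma frobenius_ipoly:
  assumes "prime p"
  shows "\<exists>A. \<forall>z. ipoly P z ^ (p ^ s) = ipoly P (z ^ (p ^ s)) + of_nat p * ipoly A z"
proof -
  from frobenius_poly[OF assms, of P s] obtain A
    where "P ^ (p ^ s) - pcompose P (monom 1 (p ^ s)) = of_nat p * A" by (rule dvdE)
  then have "ipoly (P ^ (p ^ s)) z - ipoly (pcompose P (monom 1 (p ^ s))) z
     = of_nat p * ipoly A z" for z
    by (metis ipoly_diff ipoly_mult ipoly_of_nat)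
  then show ?thesis by (intro exI[of _ A]) (simp add: algebra_simps)
qed

section \<open>Arithmetic of a cyclotomic ring\<close>

locale primitive_root =
  fixes m :: nat and \<zeta> :: complex
  assumes prim: "primitive_root_of_unity m \<zeta>"
begin

lemma m_pos: "m > 0"
  using prim by (simp add: primitive_root_of_unity_def)

lemma zeta_power_m [simp]: "\<zeta> ^ m = 1"
  using prim by (simp add: primitive_root_of_unity_def)

lemma zeta_nonzero [simp]: "\<zeta> \<noteq> 0"
  using zeta_power_m m_pos by (metis power_0_left not_gr_zero zero_neq_one)

lemma zeta_power_mod: "\<zeta> ^ (k mod m) = \<zeta> ^ k"
proof -
  have "\<zeta> ^ k = \<zeta> ^ (m * (k div m) + k mod m)" by simp
  also have "\<dots> = \<zeta> ^ (k mod m)" by (simp only: power_add power_mult) simp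
  finally show ?thesis by simp
qed

lemma zeta_power_eq_1_iff: "\<zeta> ^ k = 1 \<longleftrightarrow> m dvd k"
proof
  assume "\<zeta> ^ k = 1"
  then have "\<zeta> ^ (k mod m) = 1" by (simp add: zeta_power_mod)
  moreover have "k mod m < m" using m_pos by simp
  ultimately have "k mod m = 0" using prim by (auto simp: primitive_root_of_unity_def)
  then show "m dvd k" by auto
qed (auto elim!: dvdE simp: power_mult)

lemma zeta_power_eq_iff: "\<zeta> ^ i = \<zeta> ^ j \<longleftrightarrow> i mod m = j mod m"
proof (induction i j rule: linorder_wlog)
  case (le i j)
  have "\<zeta> ^ j = \<zeta> ^ i * \<zeta> ^ (j - i)" using le by (simp flip: power_add)
  then have "\<zeta> ^ i = \<zeta> ^ j \<longleftrightarrow> m dvd j - i"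
    using zeta_power_eq_1_iff[of "j - i"] by (auto simp: mult_cancel_left1)
  then show ?case using le by (metis mod_eq_dvd_iff_nat)
qed auto

lemma norm_zeta [simp]: "norm \<zeta> = 1"
proof -
  have "norm \<zeta> ^ m = 1 ^ m" by (simp flip: norm_power)
  then show ?thesis using m_pos by (intro power_eq_imp_eq_base[of "norm \<zeta>" m 1]) auto
qed

text \<open>Complex conjugation thereby acts on \<int>[\<zeta>] as the substitution of
  \<open>x^(m-1)\<close> for \<open>x\<close>, so squared absolute values are again values of
  integer polynomials.\<close>

lemma cnj_zeta: "cnj \<zeta> = \<zeta> ^ (m - 1)"
proof -
  have "\<zeta> * \<zeta> ^ (m - 1) = 1"
    using m_pos zeta_power_m by (metis power_minus_mult mult.commute)
  moreover have "\<zeta> * cnj \<zeta> = 1" by (simp add: complex_norm_square[symmetric])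
  ultimately show ?thesis by (metis mult_cancel_left zeta_nonzero)
qed

lemma primitive_root_power:
  assumes "coprime k m"
  shows "primitive_root m (\<zeta> ^ k)"
proof
  have "m dvd j" if "(\<zeta> ^ k) ^ j = 1" for j
    using that assms by (simp add: zeta_power_eq_1_iff coprime_dvd_mult_right_iff coprime_commute flip: power_mult)
  then have "(\<zeta> ^ k) ^ j \<noteq> 1" if "0 < j" "j < m" for j
    using that by (meson nat_dvd_not_less)
  moreover have "(\<zeta> ^ k) ^ m = 1"
    by (metis mult.commute power_mult power_one zeta_power_m)
  ultimately show "primitive_root_of_unity m (\<zeta> ^ k)"
    using m_pos by (auto simp: primitive_root_of_unity_def)
qed

section \<open>The minimal polynomial of a root of unity\<close>

text \<open>Take the primitive part \<open>g\<close> of a nonzero integer polynomial of least degree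
  vanishing at \<open>\<zeta>\<close>. Pseudo-division and Gauss's lemma show that \<open>g\<close>
  divides all the others; as it divides \<open>x^m - 1\<close>, it is monic up to sign.\<close>

lemma ex_minimal_poly:
  "\<exists>g. lead_coeff g = 1 \<and> ipoly g \<zeta> = 0 \<and> (\<forall>P. ipoly P \<zeta> = 0 \<longrightarrow> g dvd P)"
proof -
  define W :: "int poly" where "W = monom 1 m - 1"
  have "coeff W m = 1" using m_pos by (simp add: W_def)
  moreover have "degree W \<le> m" by (auto simp: W_def intro!: degree_diff_le degree_monom_le)
  ultimately have "degree W = m" using le_degree[of W m] by simp
  with \<open>coeff W m = 1\<close> have W: "lead_coeff W = 1" by simp
  have W0: "ipoly W \<zeta> = 0" by (simp add: W_def)
  define S where "S = (\<lambda>P. P \<noteq> 0 \<and> ipoly P \<zeta> = 0)"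
  have "S W" using W W0 by (auto simp: S_def)
  then obtain g0 where g0: "S g0" and min: "\<And>P. S P \<Longrightarrow> degree g0 \<le> degree P"
    using ex_has_least_nat[of S W degree] by blast
  define g where "g = primitive_part g0"
  have g0_eq: "g0 = smult (content g0) g" by (simp add: g_def)
  have nz: "g0 \<noteq> 0" "content g0 \<noteq> 0" using g0 by (auto simp: S_def)
  then have "g \<noteq> 0" using g0_eq by auto
  have deg: "degree g = degree g0" by (simp add: g_def)
  have "of_int (content g0) * ipoly g \<zeta> = 0"
    using g0 g0_eq ipoly_smult by (metis S_def)
  then have root: "ipoly g \<zeta> = 0" using nz by simp
  have content: "content g = 1" using nz by (simp add: g_def)
  have dvd: "g dvd P" if P: "ipoly P \<zeta> = 0" for P
  proof -
    obtain a q where aq: "a \<noteq> 0" "smult a P = g * q + pseudo_mod P g"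
      using pseudo_mod(1)[OF \<open>g \<noteq> 0\<close>] by blast
    have "ipoly (smult a P) \<zeta> = ipoly (g * q + pseudo_mod P g) \<zeta>" using aq(2) by simp
    then have "ipoly (pseudo_mod P g) \<zeta> = 0" using root P by simp
    with min[of "pseudo_mod P g"] pseudo_mod(2)[OF \<open>g \<noteq> 0\<close>, of P]
    have "pseudo_mod P g = 0" unfolding S_def deg by fastforce
    then have eq: "smult a P = g * q" using aq by simp
    \<comment> \<open>Gauss's lemma: since \<open>g\<close> has content 1, \<open>a\<close> divides
      the content of \<open>q\<close> and cancels.\<close>
    have "content (smult a P) = content q" unfolding eq by (simp add: content_mult content)
    then have "a dvd content q" by (metis content_smult dvd_triv_left normalize_dvd_iff dvd_mult2 dvd_refl)
    then have "[:a:] dvd q" by (simp add: const_poly_dvd_iff_dvd_content)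
    then obtain q' where "q = [:a:] * q'" by (rule dvdE)
    then have "smult a P = smult a (g * q')" using eq by simp
    then have "P = g * q'" using aq(1) by (metis smult_cancel)
    then show ?thesis by simp
  qed
  obtain h where "W = g * h" using dvd[OF W0] by (rule dvdE)
  then have "lead_coeff g * lead_coeff h = 1" using W by (simp add: lead_coeff_mult)
  then have "lead_coeff g = 1 \<or> lead_coeff g = -1" by (simp add: zmult_eq_1_iff) blast
  then show ?thesis
  proof
    assume "lead_coeff g = -1"
    then show ?thesis using root dvd by (intro exI[of _ "- g"]) auto
  qed (use root dvd in blast)
qed

definition minp :: "int poly" where
  "minp = (SOME g. lead_coeff g = 1 \<and> ipoly g \<zeta> = 0 \<and> (\<forall>P. ipoly P \<zeta> = 0 \<longrightarrow> g dvd P))"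

lemma minp_monic: "lead_coeff minp = 1"
  and minp_root [simp]: "ipoly minp \<zeta> = 0"
  and minp_dvd: "ipoly P \<zeta> = 0 \<Longrightarrow> minp dvd P"
  using someI_ex[OF ex_minimal_poly] unfolding minp_def by auto

lemma minp_dvd_iff: "minp dvd P \<longleftrightarrow> ipoly P \<zeta> = 0"
  using minp_dvd by (auto elim!: dvdE)

lemma minp_nonzero [simp]: "minp \<noteq> 0"
  using minp_monic by auto

lemma degree_minp_pos: "degree minp > 0"
proof (rule ccontr)
  assume "\<not> degree minp > 0"
  then obtain c where "minp = [:c:]" by (auto elim: degree_eq_zeroE)
  then show False using minp_root minp_nonzero by (auto simp del: minp_root minp_nonzero)
qed

lemma minp_cofactor:
  obtains h where "monom 1 m - 1 = minp * h"
  using minp_dvd[of "monom 1 m - 1"] by (auto elim: dvdE)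

text \<open>Once \<open>B\<close> is reduced modulo \<open>minp\<close>, the relation is an identity
  of polynomials of degree below that of \<open>minp\<close>, and its constant coefficients give the
  divisibility.\<close>

lemma ipoly_multiple_eq_of_int:
  assumes "of_int c = of_int d * ipoly B \<zeta>"
  shows "d dvd c"
proof -
  obtain s r where B: "B = minp * s + r" and r: "r = 0 \<or> degree r < degree minp"
    using monic_division[OF minp_monic] .
  have "ipoly B \<zeta> = ipoly r \<zeta>" unfolding B by simp
  then have "ipoly (smult d r - [:c:]) \<zeta> = 0" using assms by simp
  then have dvd: "minp dvd smult d r - [:c:]" by (rule minp_dvd)
  have "degree (smult d r - [:c:]) < degree minp"
    using r degree_minp_pos by (intro degree_diff_less) auto
  then have "smult d r - [:c:] = 0"
    using dvd by (meson dvd_imp_degree_le leD)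
  then have "coeff (smult d r) 0 = coeff [:c:] 0" by simp
  then show ?thesis by auto
qed

text \<open>Dedekind's argument. If \<open>z = \<zeta>^q\<close> is not a root of
  \<open>minp\<close>, it is a root of the cofactor \<open>h\<close> in \<open>x^m - 1\<close>, and
  differentiation gives \<open>m = minp(z) h'(z) z\<close>. By Frobenius \<open>minp(z)\<close> is a
  multiple of \<open>q\<close>, so \<open>q\<close> would divide \<open>m\<close>.\<close>

lemma conjugate_prime:
  assumes "prime q" "\<not> q dvd m" "ipoly P \<zeta> = 0"
  shows "ipoly P (\<zeta> ^ q) = 0"
proof -
  obtain h where h: "monom 1 m - 1 = minp * h" by (rule minp_cofactor)
  define z where "z = \<zeta> ^ q"
  have zm: "z ^ m = 1" unfolding z_def by (metis mult.commute power_mult power_one zeta_power_m)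
  have "ipoly minp z = 0"
  proof (rule ccontr)
    assume nz: "ipoly minp z \<noteq> 0"
    have "ipoly (monom 1 m - 1) z = ipoly minp z * ipoly h z" unfolding h by simp
    then have hz: "ipoly h z = 0" using nz zm by simp
    have "pderiv (monom 1 m - 1) = minp * pderiv h + h * pderiv minp"
      unfolding h by (rule pderiv_mult)
    then have "ipoly (pderiv (monom 1 m - 1)) z = ipoly minp z * ipoly (pderiv h) z"
      using hz by simp
    then have "of_nat m * z ^ (m - 1) = ipoly minp z * ipoly (pderiv h) z"
      by (simp add: pderiv_diff pderiv_monom)
    then have "of_nat m * (z ^ (m - 1) * z) = ipoly minp z * ipoly (pderiv h) z * z"
      by (simp add: mult.assoc)
    then have *: "of_nat m = ipoly minp z * ipoly (pderiv h) z * z"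
      using zm m_pos by (metis mult.right_neutral power_minus_mult)
    obtain A where A: "\<And>z. ipoly minp z ^ (q ^ 1) = ipoly minp (z ^ (q ^ 1)) + of_nat q * ipoly A z"
      using frobenius_ipoly[OF assms(1), of minp 1] by blast
    from A[of \<zeta>] have "ipoly minp z = - of_nat q * ipoly A \<zeta>"
      using prime_gt_0_nat[OF assms(1)] by (simp add: z_def power_0_left eq_neg_iff_add_eq_0)
    with * have "of_int (int m) = of_int (int q) * ipoly (- A * pcompose (pderiv h) (monom 1 q) * monom 1 q) \<zeta>"
      by (simp add: z_def)
    then have "int q dvd int m" by (rule ipoly_multiple_eq_of_int)
    then show False using assms(2) by simp
  qed
  moreover obtain s where "P = minp * s" using minp_dvd[OF assms(3)] by (rule dvdE)
  ultimately show ?thesis by (simp add: z_def)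
qed

end

text \<open>A positive exponent coprime to \<open>m\<close> is a product of primes not dividing
  \<open>m\<close>, to which \<open>conjugate_prime\<close> applies in turn. The induction
  quantifies over all primitive roots because each step replaces the root by a power. The exponent 0
  occurs only for \<open>m = 1\<close>.\<close>

lemma (in primitive_root) conjugate_root:
  assumes "coprime k m" "ipoly P \<zeta> = 0"
  shows "ipoly P (\<zeta> ^ k) = 0"
proof -
  have "\<forall>z. primitive_root m z \<longrightarrow> ipoly P z = 0 \<longrightarrow> ipoly P (z ^ k) = 0"
    using assms(1)
  proof (induction k rule: prime_divisors_induct)
    case zero
    show ?case
    proof (intro allI impI)
      fix z assume z: "primitive_root m z" "ipoly P z = 0"
      have "m = 1" using zero by simp
      then have "z = 1" using primitive_root.zeta_power_m[OF z(1)] by simp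
      then show "ipoly P (z ^ 0) = 0" using z by simp
    qed
  next
    case (unit k)
    then show ?case by simp
  next
    case (factor q k)
    show ?case
    proof (intro allI impI)
      fix z assume z: "primitive_root m z" "ipoly P z = 0"
      have cop: "coprime q m" "coprime k m" using factor.prems by auto
      have "\<not> q dvd m" using cop(1) factor.hyps(1) by (metis coprime_absorb_left not_prime_unit)
      then have "ipoly P (z ^ q) = 0"
        using z factor.hyps(1) primitive_root.conjugate_prime by blast
      then have "ipoly P ((z ^ q) ^ k) = 0"
        using factor.IH cop primitive_root.primitive_root_power[OF z(1) cop(1)] by blast
      then show "ipoly P (z ^ (q * k)) = 0" by (simp add: power_mult)
    qed
  qed
  moreover have "primitive_root m \<zeta>" ..
  ultimately show ?thesis using assms(2) by blast
qed

context primitive_root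
begin

text \<open>The converse raises \<open>\<zeta>^k\<close> to an inverse of \<open>k\<close> modulo
  \<open>m\<close>.\<close>

lemma conjugate_root_iff:
  assumes "coprime k m"
  shows "ipoly P (\<zeta> ^ k) = 0 \<longleftrightarrow> ipoly P \<zeta> = 0"
proof
  assume a: "ipoly P (\<zeta> ^ k) = 0"
  interpret k: primitive_root m "\<zeta> ^ k" using assms by (rule primitive_root_power)
  obtain j where j: "[k * j = 1] (mod m)" using cong_solve_coprime_nat[OF assms] by auto
  then have "coprime j m" by (metis cong_imp_coprime cong_sym coprime_1_left coprime_mult_left_iff)
  then have "ipoly P ((\<zeta> ^ k) ^ j) = 0" using a by (rule k.conjugate_root)
  moreover have "(\<zeta> ^ k) ^ j = \<zeta> ^ 1"
    using j zeta_power_eq_iff unfolding cong_def by (metis power_mult)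
  ultimately show "ipoly P \<zeta> = 0" by simp
qed (rule conjugate_root[OF assms])

lemma inj_on_totatives: "inj_on (\<lambda>k. \<zeta> ^ k) (totatives m)"
proof (rule inj_onI)
  fix i j assume ij: "i \<in> totatives m" "j \<in> totatives m" "\<zeta> ^ i = \<zeta> ^ j"
  then have "i mod m = j mod m" by (simp add: zeta_power_eq_iff)
  moreover have "0 < i" "i \<le> m" "0 < j" "j \<le> m" using ij by (auto simp: in_totatives_iff)
  ultimately show "i = j" by (metis le_neq_implies_less mod_less mod_self not_gr_zero)
qed

lemma card_conjugates: "card ((\<lambda>k. \<zeta> ^ k) ` totatives m) = totient m"
  using card_image[OF inj_on_totatives] by (simp add: totient_def)

lemma totient_le_degree:
  assumes "P \<noteq> 0" "ipoly P \<zeta> = 0"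
  shows "totient m \<le> degree P"
proof -
  have "card ((\<lambda>k. \<zeta> ^ k) ` totatives m) \<le> degree P"
    using assms conjugate_root by (intro card_ipoly_roots_le) (auto simp: in_totatives_iff)
  then show ?thesis by (simp add: card_conjugates)
qed

text \<open>Let \<open>e\<close> be the order of \<open>z\<close>. The minimal polynomial of
  \<open>z\<close> divides \<open>minp\<close>, and by degrees \<open>\<zeta>\<close> cannot be a
  root of the cofactor, so the two minimal polynomials divide each other. Hence
  \<open>e = m\<close>, and \<open>z\<close> is a power of \<open>\<zeta>\<close> with exponent
  coprime to \<open>m\<close>.\<close>

lemma minp_roots:
  assumes "ipoly minp z = 0"
  shows "z \<in> (\<lambda>k. \<zeta> ^ k) ` totatives m"
proof -
  obtain h where h: "monom 1 m - 1 = minp * h" by (rule minp_cofactor)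
  have "ipoly (monom 1 m - 1) z = 0" unfolding h using assms by simp
  then have zm: "z ^ m = 1" by simp
  define e where "e = (LEAST e. 0 < e \<and> z ^ e = 1)"
  have e: "0 < e" "z ^ e = 1" and least: "\<And>j. 0 < j \<Longrightarrow> z ^ j = 1 \<Longrightarrow> e \<le> j"
    using LeastI[of "\<lambda>e. 0 < e \<and> z ^ e = 1" m] Least_le[of "\<lambda>e. 0 < e \<and> z ^ e = 1"] zm m_pos
    unfolding e_def by auto
  interpret z: primitive_root e z
    by standard (use e least in \<open>auto simp: primitive_root_of_unity_def not_less dest: leD\<close>)
  have "z.minp dvd minp" using assms by (rule z.minp_dvd)
  then obtain s where s: "minp = z.minp * s" by (rule dvdE)
  have "ipoly z.minp \<zeta> = 0"
  proof (rule ccontr)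
    assume "ipoly z.minp \<zeta> \<noteq> 0"
    then have "ipoly s \<zeta> = 0" using minp_root unfolding s by (simp del: minp_root)
    then have "minp dvd s" by (rule minp_dvd)
    moreover have "s \<noteq> 0" using s by auto
    ultimately have "degree minp \<le> degree s" by (intro dvd_imp_degree_le)
    moreover have "degree minp = degree z.minp + degree s"
      using s \<open>s \<noteq> 0\<close> by (simp add: degree_mult_eq)
    ultimately show False using z.degree_minp_pos by simp
  qed
  then have "minp dvd z.minp" by (rule minp_dvd)
  moreover have "z.minp dvd monom 1 e - 1" by (rule z.minp_dvd) simp
  ultimately have "minp dvd monom 1 e - 1" by (rule dvd_trans)
  then have "\<zeta> ^ e = 1" by (simp add: minp_dvd_iff)
  then have "m dvd e" by (simp add: zeta_power_eq_1_iff)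
  moreover have "e dvd m" using zm by (simp add: z.zeta_power_eq_1_iff)
  ultimately have "e = m" by auto
  obtain k where k: "k < m" "z = \<zeta> ^ k"
  proof -
    have "inj_on (\<lambda>k. \<zeta> ^ k) {..<m}" by (auto simp: inj_on_def zeta_power_eq_iff)
    then have "card ((\<lambda>k. \<zeta> ^ k) ` {..<m}) = card {w::complex. w ^ m = 1}"
      using card_roots_unity_eq[OF m_pos] by (simp add: card_image)
    moreover have "(\<lambda>k. \<zeta> ^ k) ` {..<m} \<subseteq> {w::complex. w ^ m = 1}"
      by (auto simp: power_mult[symmetric] mult.commute[of _ m] simp del: mult.commute)
        (simp add: power_mult)
    ultimately have "(\<lambda>k. \<zeta> ^ k) ` {..<m} = {w::complex. w ^ m = 1}"
      using m_pos by (intro card_subset_eq) (auto intro: finite_roots_unity)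
    then show thesis using zm that by blast
  qed
  have "coprime k m"
  proof -
    have "z ^ (m div gcd k m) = 1"
      unfolding k(2) power_mult[symmetric] zeta_power_eq_1_iff
      by (metis dvd_div_mult_self dvd_triv_left gcd_dvd1 gcd_dvd2 div_mult_swap mult.commute dvd_mult_div_cancel dvd_div_mult)
    then have "m dvd m div gcd k m" using z.zeta_power_eq_1_iff \<open>e = m\<close> by simp
    moreover have "m div gcd k m > 0" using m_pos by (metis dvd_div_eq_0_iff gcd_dvd2 gr0I not_gr_zero)
    ultimately have "m \<le> m div gcd k m" by (rule dvd_imp_le)
    then have "\<not> gcd k m > 1" using m_pos div_less_dividend[of "gcd k m" m] by linarith
    moreover have "gcd k m \<noteq> 0" using m_pos by simp
    ultimately have "gcd k m = 1" by linarith
    then show ?thesis by (simp add: coprime_iff_gcd_eq_1)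
  qed
  show ?thesis
  \<comment> \<open>The exponent 0 occurs only for \<open>m = 1\<close>, where it represents the
    totative 1.\<close>
  proof (cases "k = 0")
    case True
    then have "m = 1" using \<open>coprime k m\<close> by simp
    moreover from this have "\<zeta> = 1" by (metis power_one_right zeta_power_m)
    ultimately show ?thesis using k True by auto
  next
    case False
    then have "k \<in> totatives m" using k \<open>coprime k m\<close> by (simp add: in_totatives_iff)
    then show ?thesis using k by blast
  qed
qed

text \<open>Of the \<open>m\<close> distinct roots of \<open>x^m - 1\<close> the cofactor takes at
  most its degree; the others are roots of \<open>minp\<close>, hence among the
  \<open>totient m\<close> conjugates of \<open>\<zeta>\<close>.\<close>

lemma degree_minp: "degree minp = totient m"
proof (rule antisym)
  obtain h where h: "monom 1 m - 1 = minp * h" by (rule minp_cofactor)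
  define R where "R = (\<lambda>p. {z::complex. ipoly p z = 0})"
  have deg: "degree (monom 1 m - 1 :: int poly) = m"
  proof (rule antisym)
    show "degree (monom 1 m - 1 :: int poly) \<le> m"
      by (auto intro!: degree_diff_le degree_monom_le)
    show "m \<le> degree (monom 1 m - 1 :: int poly)" using m_pos by (intro le_degree) simp
  qed
  then have nz: "monom 1 m - 1 \<noteq> (0::int poly)" using m_pos by auto
  then have "h \<noteq> 0" using h by auto
  then have degs: "m = degree minp + degree h"
    using deg h by (simp add: degree_mult_eq)
  have fin: "finite (R p)" if "p \<noteq> 0" for p
    using that poly_roots_finite[of "map_poly complex_of_int p"] by (simp add: R_def ipoly_def)
  have "R (monom 1 m - 1) \<subseteq> R minp \<union> R h" unfolding h R_def by auto
  moreover have "R (monom 1 m - 1) = {z. z ^ m = 1}" by (simp add: R_def)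
  ultimately have "m \<le> card (R minp \<union> R h)"
    using card_roots_unity_eq[OF m_pos] fin[OF minp_nonzero] fin[OF \<open>h \<noteq> 0\<close>]
    by (metis card_mono finite_UnI)
  also have "\<dots> \<le> card (R minp) + card (R h)" by (rule card_Un_le)
  also have "card (R h) \<le> degree h"
    using fin \<open>h \<noteq> 0\<close> by (intro card_ipoly_roots_le) (auto simp: R_def)
  finally have "degree minp \<le> card (R minp)" using degs by simp
  also have "\<dots> \<le> card ((\<lambda>k. \<zeta> ^ k) ` totatives m)"
    using minp_roots by (intro card_mono) (auto simp: R_def)
  finally show "degree minp \<le> totient m" by (simp add: card_conjugates)
qed (intro totient_le_degree minp_nonzero minp_root)

text \<open>The product \<open>Q(x) = \<Prod>\<^sub>k P(x^k)\<close> takes the same value at all conjugates of \<open>\<zeta>\<close>, so its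
  remainder modulo the minimal polynomial, having smaller degree, is constant.\<close>

lemma norm_integer:
  obtains N :: int where "(\<Prod>k\<in>totatives m. ipoly P (\<zeta> ^ k)) = of_int N"
proof -
  define Q where "Q = (\<Prod>k\<in>totatives m. pcompose P (monom 1 k))"
  define c where "c = (\<Prod>k\<in>totatives m. ipoly P (\<zeta> ^ k))"
  have Q: "ipoly Q (\<zeta> ^ a) = c" if a: "a \<in> totatives m" for a
  proof -
    \<comment> \<open>Multiplication by \<open>a\<close> permutes the residues prime to
      \<open>m\<close>. For \<open>m = 1\<close> the totative is 1 while \<open>mod\<close> yields
      0, so that case is treated apart.\<close>
    have bij: "bij_betw (\<lambda>k. a * k mod m) (totatives m) (totatives m)" if "m > 1"
    proof -
      have cop: "coprime a m" using a by (simp add: in_totatives_iff)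
      have inj: "inj_on (\<lambda>k. a * k mod m) (totatives m)"
      proof (rule inj_onI)
        fix i j assume ij: "i \<in> totatives m" "j \<in> totatives m" "a * i mod m = a * j mod m"
        then have "[i = j] (mod m)" using cop by (simp add: cong_mult_lcancel_nat flip: cong_def)
        moreover have "i < m" "j < m" using ij \<open>m > 1\<close> by (auto intro: totatives_less)
        ultimately show "i = j" by (simp add: cong_def)
      qed
      moreover have "(\<lambda>k. a * k mod m) ` totatives m \<subseteq> totatives m"
      proof safe
        fix k assume "k \<in> totatives m"
        then have "coprime (a * k) m" using cop by (simp add: in_totatives_iff)
        then have c: "coprime (a * k mod m) m" by (metis coprime_mod_left_iff m_pos nat_neq_iff)
        then have "a * k mod m \<noteq> 0" using \<open>m > 1\<close> by (metis coprime_0_left_iff nat_neq_iff is_unit_gcd nat_dvd_1_iff_1)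
        with c show "a * k mod m \<in> totatives m" using m_pos by (simp add: in_totatives_iff less_imp_le)
      qed
      ultimately show ?thesis
        by (simp add: bij_betw_def endo_inj_surj)
    qed
    show ?thesis
    proof (cases "m = 1")
      case True
      then show ?thesis using a by (simp add: Q_def c_def)
    next
      case False
      then have "m > 1" using m_pos by simp
      have "ipoly Q (\<zeta> ^ a) = (\<Prod>k\<in>totatives m. ipoly P (\<zeta> ^ (a * k mod m)))"
        by (simp add: Q_def zeta_power_mod power_mult)
      also have "\<dots> = c" unfolding c_def by (rule prod.reindex_bij_betw[OF bij[OF \<open>m > 1\<close>]])
      finally show ?thesis .
    qed
  qed
  obtain s r where qr: "Q = minp * s + r" "r = 0 \<or> degree r < degree minp"
    using monic_division[OF minp_monic] .
  have r: "ipoly r (\<zeta> ^ a) = c" if "a \<in> totatives m" for a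
  proof -
    have "ipoly minp (\<zeta> ^ a) = 0" using that by (intro conjugate_root) (auto simp: in_totatives_iff)
    then show ?thesis using Q[OF that] qr(1) by simp
  qed
  define p where "p = map_poly of_int r - [:c:]"
  have "p = 0"
  proof (rule ccontr)
    assume "p \<noteq> 0"
    then have "card ((\<lambda>k. \<zeta> ^ k) ` totatives m) \<le> degree p"
      using r by (intro card_complex_roots_le) (auto simp: p_def ipoly_def)
    moreover have "degree p < totient m"
      unfolding p_def using qr(2) degree_minp_pos by (intro degree_diff_less) (auto simp: degree_minp)
    ultimately show False by (simp add: card_conjugates)
  qed
  then have "coeff p 0 = 0" by simp
  then have "c = of_int (coeff r 0)" by (simp add: p_def coeff_map_poly)
  then show thesis using that unfolding c_def by blast
qed

text \<open>All conjugates of a nonzero element are nonzero, so its norm is a nonzero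
  integer.\<close>

lemma norm_ge_1:
  assumes "ipoly P \<zeta> \<noteq> 0"
  shows "(\<Prod>k\<in>totatives m. norm (ipoly P (\<zeta> ^ k))) \<ge> 1"
proof -
  obtain N :: int where N: "(\<Prod>k\<in>totatives m. ipoly P (\<zeta> ^ k)) = of_int N" by (rule norm_integer)
  have "(\<Prod>k\<in>totatives m. ipoly P (\<zeta> ^ k)) \<noteq> 0"
    using assms by (auto simp: in_totatives_iff conjugate_root_iff)
  then have "N \<noteq> 0" using N by auto
  have "(\<Prod>k\<in>totatives m. norm (ipoly P (\<zeta> ^ k))) = norm (of_int N :: complex)"
    unfolding N[symmetric] by (simp add: prod_norm)
  also have "\<dots> \<ge> 1" using \<open>N \<noteq> 0\<close> by simp
  finally show ?thesis .
qed

end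

section \<open>Lower bounds for the totient function\<close>

text \<open>Among primes, \<open>p^2 <= (p - 1)^3\<close> fails only for 2 and 3, which the factors
  4 and 2 repair. Each further power of \<open>p\<close> multiplies the left side by
  \<open>p^2\<close> and the right side by \<open>p^3\<close>.\<close>

lemma prime_power_totient_bound:
  assumes "prime (p::nat)" "k > 0"
  shows "(p ^ k)\<^sup>2 \<le> (p ^ (k - 1) * (p - 1)) ^ 3 * (if p = 2 then 4 else if p = 3 then 2 else 1)"
    (is "_ \<le> _ * ?w")
proof -
  have p: "p \<ge> 2" using assms(1) prime_ge_2_nat by blast
  have base: "p\<^sup>2 \<le> (p - 1) ^ 3 * ?w"
  proof (cases "p \<le> 4")
    case True
    then have "p = 2 \<or> p = 3 \<or> p = 4" using p by auto
    then show ?thesis by auto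
  next
    case False
    then obtain q where q: "p = q + 5" using nat_le_iff_add[of 5 p] by (auto simp: add.commute)
    have "p\<^sup>2 \<le> (p - 1) ^ 3" unfolding q by (simp add: power2_eq_square power3_eq_cube algebra_simps)
    then show ?thesis using False by simp
  qed
  obtain j where k: "k = Suc j" using assms(2) gr0_conv_Suc by blast
  have "(p ^ k)\<^sup>2 = p ^ (2 * j) * p\<^sup>2"
    unfolding k by (simp add: power_mult_distrib power_mult[symmetric] mult.commute)
  also have "\<dots> \<le> p ^ (3 * j) * ((p - 1) ^ 3 * ?w)"
    using p base by (intro mult_mono power_increasing) auto
  also have "\<dots> = (p ^ (k - 1) * (p - 1)) ^ 3 * ?w"
    unfolding k by (simp add: power_mult_distrib power_mult[symmetric] mult.commute)
  finally show ?thesis .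
qed

text \<open>The prime power bounds multiply, and the correction factors of 2 and 3 contribute at
  most \<open>4 * 2 = 8\<close>.\<close>

lemma totient_lower_bound:
  assumes "n > 0"
  shows "n\<^sup>2 \<le> 8 * totient n ^ 3"
proof -
  define w :: "nat \<Rightarrow> nat" where "w p = (if p = 2 then 4 else if p = 3 then 2 else 1)" for p
  have "n\<^sup>2 = (\<Prod>p\<in>prime_factors n. (p ^ multiplicity p n)\<^sup>2)"
    using prime_factorization_nat[OF assms] by (metis prod_power_distrib)
  also have "\<dots> \<le> (\<Prod>p\<in>prime_factors n. (p ^ (multiplicity p n - 1) * (p - 1)) ^ 3 * w p)"
    unfolding w_def using prime_power_totient_bound
    by (intro prod_mono) (auto simp: prime_factors_multiplicity)
  also have "\<dots> = totient n ^ 3 * prod w (prime_factors n)"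
    by (subst prod.distrib) (simp only: totient_formula1[OF assms] prod_power_distrib)
  also have "prod w (prime_factors n) \<le> 8"
  proof (rule dvd_imp_le)
    have "prod w (prime_factors n \<union> {2, 3}) = prod w {2, 3}"
      by (intro prod.mono_neutral_right) (auto simp: w_def)
    then have "prod w (prime_factors n \<union> {2, 3}) = 8" by (simp add: w_def)
    then show "prod w (prime_factors n) dvd 8"
      using prod_dvd_prod_subset[of "prime_factors n \<union> {2, 3}" "prime_factors n" w] by fastforce
  qed simp
  finally show ?thesis by (simp add: mult.commute)
qed

lemma le_totient_square:
  assumes "n > 0"
  shows "n \<le> 3 * (totient n)\<^sup>2"
proof -
  have t: "totient n \<ge> 1" using assms by (simp add: Suc_le_eq)
  have "totient n ^ 3 \<le> totient n ^ 4" using t by (intro power_increasing) auto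
  with totient_lower_bound[OF assms] have "n\<^sup>2 \<le> 9 * totient n ^ 4" by linarith
  also have "\<dots> = (3 * (totient n)\<^sup>2)\<^sup>2" by (simp add: power_mult_distrib flip: power_mult)
  finally show ?thesis using power2_nat_le_eq_le by blast
qed

section \<open>Counting and measuring elements through their conjugates\<close>

context primitive_root
begin

lemma norm_zeta_power [simp]: "norm (\<zeta> ^ k) = 1"
  by (simp add: norm_power)

text \<open>Distinct elements of \<open>\<int>[\<zeta>]\<close> cannot be close to each other at all conjugates simultaneously.\<close>

lemma card_bounded_family:
  assumes "finite I" and inj: "inj_on (\<lambda>i. ipoly (P i) \<zeta>) I"
    and bound: "\<And>i k. i \<in> I \<Longrightarrow> k \<in> totatives m \<Longrightarrow> norm (ipoly (P i) (\<zeta> ^ k)) \<le> T"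
    and T: "T \<ge> 0"
  shows "real (card I) \<le> (4 * T + 2) ^ (2 * totient m)"
proof -
  define B where "B = {\<lfloor>-2 * T\<rfloor>..\<lfloor>2 * T\<rfloor>}"
  \<comment> \<open>The cells are squares of side 1/2. Two points of one cell have distance below 1,
    so elements sharing their cells at all conjugates have a difference of norm below 1, which must
    vanish.\<close>
  define cell where "cell w = (\<lfloor>2 * Re w\<rfloor>, \<lfloor>2 * Im w\<rfloor>)" for w
  define f where "f i = (\<lambda>k\<in>totatives m. cell (ipoly (P i) (\<zeta> ^ k)))" for i
  have "inj_on f I"
  proof (rule inj_onI)
    fix i j assume ij: "i \<in> I" "j \<in> I" "f i = f j"
    show "i = j"
    proof (rule ccontr)
      assume "i \<noteq> j"
      define Q where "Q = P i - P j"
      have "ipoly Q \<zeta> \<noteq> 0" using ij \<open>i \<noteq> j\<close> inj by (auto simp: Q_def inj_on_def)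
      then have n1: "1 \<le> (\<Prod>k\<in>totatives m. norm (ipoly Q (\<zeta> ^ k)))" by (rule norm_ge_1)
      have small: "norm (ipoly Q (\<zeta> ^ k)) < 1" if k: "k \<in> totatives m" for k
      proof -
        define w v where "w = ipoly (P i) (\<zeta> ^ k)" and "v = ipoly (P j) (\<zeta> ^ k)"
        have "cell w = cell v" using fun_cong[OF ij(3), of k] k by (simp add: f_def w_def v_def)
        then have "\<bar>2 * Re w - 2 * Re v\<bar> < 1" "\<bar>2 * Im w - 2 * Im v\<bar> < 1"
          unfolding cell_def by (auto simp: abs_if) linarith+
        then have "norm (w - v) < 1" using cmod_le[of "w - v"] by simp
        then show ?thesis by (simp add: Q_def w_def v_def)
      qed
      have "(\<Prod>k\<in>totatives m. norm (ipoly Q (\<zeta> ^ k))) < (\<Prod>k\<in>totatives m. 1)"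
        using m_pos small small[of 1] by (intro prod_mono_strict[of 1]) (auto intro: less_imp_le)
      with n1 show False by simp
    qed
  qed
  moreover have "f ` I \<subseteq> PiE (totatives m) (\<lambda>_. B \<times> B)"
  proof (rule image_subsetI)
    fix i assume i: "i \<in> I"
    have cell: "cell (ipoly (P i) (\<zeta> ^ k)) \<in> B \<times> B" if "k \<in> totatives m" for k
    proof -
      have "norm (ipoly (P i) (\<zeta> ^ k)) \<le> T" using that bound i by blast
      then have "\<bar>Re (ipoly (P i) (\<zeta> ^ k))\<bar> \<le> T" "\<bar>Im (ipoly (P i) (\<zeta> ^ k))\<bar> \<le> T"
        using abs_Re_le_cmod abs_Im_le_cmod order_trans by blast+
      then show ?thesis by (auto simp: cell_def B_def intro!: floor_mono)
    qed
    show "f i \<in> PiE (totatives m) (\<lambda>_. B \<times> B)"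
      by (rule PiE_I) (simp_all add: f_def cell del: mem_Sigma_iff)
  qed
  ultimately have "card I \<le> card (PiE (totatives m) (\<lambda>_. B \<times> B))"
    by (intro card_inj_on_le[of f]) (auto intro!: finite_PiE simp: B_def)
  also have "\<dots> = (card B ^ 2) ^ totient m"
    by (simp add: card_PiE card_cartesian_product totient_def power2_eq_square)
  finally have I: "real (card I) \<le> real (card B) ^ (2 * totient m)"
    by (metis of_nat_le_iff of_nat_power power_mult)
  have "real (card B) \<le> 4 * T + 2"
  proof -
    have "real (card B) = real_of_int (\<lfloor>2 * T\<rfloor> - \<lfloor>-2 * T\<rfloor> + 1)"
      using T unfolding B_def by (simp add: floor_mono of_nat_nat)
    then show ?thesis by linarith
  qed
  then have "real (card B) ^ (2 * totient m) \<le> (4 * T + 2) ^ (2 * totient m)"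
    by (intro power_mono) auto
  with I show ?thesis by (rule order_trans)
qed

text \<open>As \<open>\<zeta>^(m-1)\<close> is the complex conjugate of \<open>\<zeta>\<close>, this
  integer polynomial takes the value \<open>|F|^2\<close> at every power of
  \<open>\<zeta>\<close>.\<close>

definition abs_square_poly :: "int poly \<Rightarrow> int poly" where
  "abs_square_poly F = F * pcompose F (monom 1 (m - 1))"

lemma ipoly_abs_square_poly:
  "ipoly (abs_square_poly F) (\<zeta> ^ k) = of_real ((norm (ipoly F (\<zeta> ^ k)))\<^sup>2)"
proof -
  have "(\<zeta> ^ k) ^ (m - 1) = cnj (\<zeta> ^ k)"
    by (simp add: cnj_zeta power_mult[symmetric] mult.commute)
  then have "ipoly (abs_square_poly F) (\<zeta> ^ k) = ipoly F (\<zeta> ^ k) * cnj (ipoly F (\<zeta> ^ k))"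
    by (simp add: abs_square_poly_def ipoly_cnj del: complex_cnj_power)
  then show ?thesis by (simp only: complex_norm_square)
qed

text \<open>Equality of the absolute values is the vanishing of an integer polynomial at
  \<open>\<zeta>\<close>, which passes to the conjugates.\<close>

lemma norm_eq_conjugate:
  assumes "norm (ipoly F \<zeta>) = norm (ipoly G \<zeta>)" "coprime k m"
  shows "norm (ipoly F (\<zeta> ^ k)) = norm (ipoly G (\<zeta> ^ k))"
proof -
  define Q where "Q = abs_square_poly F - abs_square_poly G"
  have Q: "ipoly Q (\<zeta> ^ j) = of_real ((norm (ipoly F (\<zeta> ^ j)))\<^sup>2 - (norm (ipoly G (\<zeta> ^ j)))\<^sup>2)" for j
    by (simp add: Q_def ipoly_abs_square_poly)
  have "ipoly Q \<zeta> = 0" using Q[of 1] assms(1) by simp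
  then have "ipoly Q (\<zeta> ^ k) = 0" using assms(2) by (intro conjugate_root)
  then have "(norm (ipoly F (\<zeta> ^ k)))\<^sup>2 - (norm (ipoly G (\<zeta> ^ k)))\<^sup>2 = 0"
    unfolding Q of_real_eq_0_iff .
  then show ?thesis by simp
qed

text \<open>The logarithms have nonnegative sum, since the norm is at least 1, and each is at most
  \<open>ln H\<close>. Hence the negative ones cannot outweigh the positive ones.\<close>

lemma sum_abs_ln_le:
  assumes "ipoly P \<zeta> \<noteq> 0" "H \<ge> 1"
    and "\<And>k. k \<in> totatives m \<Longrightarrow> norm (ipoly P (\<zeta> ^ k)) \<le> H"
  shows "(\<Sum>k\<in>totatives m. \<bar>ln (norm (ipoly P (\<zeta> ^ k)))\<bar>) \<le> 2 * totient m * ln H"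
proof -
  define y where "y k = norm (ipoly P (\<zeta> ^ k))" for k
  have pos: "y k > 0" if "k \<in> totatives m" for k
    using that assms(1) by (simp add: y_def in_totatives_iff conjugate_root_iff)
  have "1 \<le> (\<Prod>k\<in>totatives m. y k)" unfolding y_def using assms(1) by (rule norm_ge_1)
  then have "0 \<le> ln (\<Prod>k\<in>totatives m. y k)" by simp
  also have "\<dots> = (\<Sum>k\<in>totatives m. ln (y k))" by (intro ln_prod) (use pos in force)+
  finally have sum: "0 \<le> (\<Sum>k\<in>totatives m. ln (y k))" .
  have "(\<Sum>k\<in>totatives m. \<bar>ln (y k)\<bar>) \<le> (\<Sum>k\<in>totatives m. 2 * ln H - ln (y k))"
  proof (rule sum_mono)
    fix k assume k: "k \<in> totatives m"
    have "y k \<le> H" using assms(3)[OF k] by (simp add: y_def)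
    then have "ln (y k) \<le> ln H" using pos[OF k] ln_le_cancel_iff[of "y k" H] by linarith
    moreover have "0 \<le> ln H" using assms(2) by simp
    ultimately show "\<bar>ln (y k)\<bar> \<le> 2 * ln H - ln (y k)" by linarith
  qed
  also have "\<dots> = 2 * totient m * ln H - (\<Sum>k\<in>totatives m. ln (y k))"
    by (simp add: sum_subtractf totient_def)
  finally show ?thesis using sum by (simp add: y_def)
qed

end

text \<open>For \<open>a <= b\<close> apply \<open>1 - t <= - ln t\<close> to
  \<open>t = (a / b)^2\<close>.\<close>

lemma abs_ln_diff_ge:
  fixes a b H :: real
  assumes "0 < a" "0 < b" "a \<le> H" "b \<le> H"
  shows "\<bar>a\<^sup>2 - b\<^sup>2\<bar> \<le> 2 * H\<^sup>2 * \<bar>ln a - ln b\<bar>"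
  using assms
proof (induction a b rule: linorder_wlog)
  case (le a b)
  have "1 - a\<^sup>2 / b\<^sup>2 \<le> - ln (a\<^sup>2 / b\<^sup>2)"
    using le ln_le_minus_one[of "a\<^sup>2 / b\<^sup>2"] by simp
  also have "\<dots> = 2 * (ln b - ln a)"
    using le by (simp add: ln_div ln_realpow)
  finally have "b\<^sup>2 * (1 - a\<^sup>2 / b\<^sup>2) \<le> H\<^sup>2 * (2 * (ln b - ln a))"
    using le by (intro mult_mono power_mono) (auto simp: power_mono)
  moreover have "b\<^sup>2 * (1 - a\<^sup>2 / b\<^sup>2) = b\<^sup>2 - a\<^sup>2" using le by (simp add: field_simps)
  moreover have "a\<^sup>2 \<le> b\<^sup>2" using le by (intro power_mono) auto
  moreover have "\<bar>a\<^sup>2 - b\<^sup>2\<bar> = b\<^sup>2 - a\<^sup>2" "\<bar>ln a - ln b\<bar> = ln b - ln a"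
    using le \<open>a\<^sup>2 \<le> b\<^sup>2\<close> by auto
  ultimately show ?case by (simp add: algebra_simps)
next
  case (sym a b)
  then show ?case by (simp add: abs_minus_commute)
qed

context primitive_root
begin

text \<open>The numbers \<open>|a^2 - b^2|\<close> have product at least 1, hence average at least
  1. Each is at most \<open>2 H^2 |ln a - ln b|\<close>, and \<open>n |ln a - ln b|\<close> is at
  most \<open>|ln c1| + |ln c2|\<close>, whose average is at most \<open>4 ln H\<close>.\<close>

lemma exponent_bound:
  assumes nz: "ipoly C1 \<zeta> \<noteq> 0" "ipoly C2 \<zeta> \<noteq> 0" "ipoly F1 \<zeta> \<noteq> 0" "ipoly F2 \<zeta> \<noteq> 0"
    and H: "H \<ge> 1"
    and bound: "\<And>P k. P \<in> {C1, C2, F1, F2} \<Longrightarrow> norm (ipoly P (\<zeta> ^ k)) \<le> H"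
    and eq: "ipoly C1 \<zeta> * ipoly F1 \<zeta> ^ n + ipoly C2 \<zeta> * ipoly F2 \<zeta> ^ n = 0"
    and ne: "norm (ipoly F1 \<zeta>) \<noteq> norm (ipoly F2 \<zeta>)"
  shows "real n \<le> 8 * H\<^sup>2 * ln H"
proof -
  define c1 c2 a b where "c1 k = norm (ipoly C1 (\<zeta> ^ k))" and "c2 k = norm (ipoly C2 (\<zeta> ^ k))"
    and "a k = norm (ipoly F1 (\<zeta> ^ k))" and "b k = norm (ipoly F2 (\<zeta> ^ k))" for k
  define Q where "Q = abs_square_poly F1 - abs_square_poly F2"
  have Q: "norm (ipoly Q (\<zeta> ^ k)) = \<bar>(a k)\<^sup>2 - (b k)\<^sup>2\<bar>" for k
  proof -
    have "ipoly Q (\<zeta> ^ k) = of_real ((a k)\<^sup>2 - (b k)\<^sup>2)"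
      by (simp add: Q_def ipoly_abs_square_poly a_def b_def)
    then show ?thesis by (simp only: norm_of_real)
  qed
  have "\<bar>(a 1)\<^sup>2 - (b 1)\<^sup>2\<bar> \<noteq> 0" using ne by (auto simp: a_def b_def)
  then have Q0: "ipoly Q \<zeta> \<noteq> 0" using Q[of 1] by auto
  have pos: "c1 k > 0" "c2 k > 0" "a k > 0" "b k > 0" if "k \<in> totatives m" for k
    using that nz by (simp_all add: c1_def c2_def a_def b_def in_totatives_iff conjugate_root_iff)
  have le: "a k \<le> H" "b k \<le> H" for k using bound by (auto simp: a_def b_def)
  have lower: "real (totient m) \<le> (\<Sum>k\<in>totatives m. \<bar>(a k)\<^sup>2 - (b k)\<^sup>2\<bar>)"
  proof -
    have nz: "\<bar>(a k)\<^sup>2 - (b k)\<^sup>2\<bar> > 0" if "k \<in> totatives m" for k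
    proof -
      have "ipoly Q (\<zeta> ^ k) \<noteq> 0" using Q0 that by (simp add: in_totatives_iff conjugate_root_iff)
      then show ?thesis unfolding Q[symmetric] by simp
    qed
    have "1 \<le> (\<Prod>k\<in>totatives m. \<bar>(a k)\<^sup>2 - (b k)\<^sup>2\<bar>)" using norm_ge_1[OF Q0] unfolding Q .
    then have "0 \<le> ln (\<Prod>k\<in>totatives m. \<bar>(a k)\<^sup>2 - (b k)\<^sup>2\<bar>)" by simp
    also have "\<dots> = (\<Sum>k\<in>totatives m. ln \<bar>(a k)\<^sup>2 - (b k)\<^sup>2\<bar>)" by (intro ln_prod) (use nz in force)+
    also have "\<dots> \<le> (\<Sum>k\<in>totatives m. \<bar>(a k)\<^sup>2 - (b k)\<^sup>2\<bar> - 1)"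
      using nz ln_le_minus_one by (intro sum_mono) auto
    finally show ?thesis by (simp add: sum_subtractf totient_def)
  qed
  have n_ln: "real n * \<bar>ln (a k) - ln (b k)\<bar> \<le> \<bar>ln (c1 k)\<bar> + \<bar>ln (c2 k)\<bar>" if k: "k \<in> totatives m" for k
  proof -
    have "ipoly (C1 * F1 ^ n + C2 * F2 ^ n) (\<zeta> ^ k) = 0"
      using k eq by (intro conjugate_root) (auto simp: in_totatives_iff)
    then have "ipoly C1 (\<zeta> ^ k) * ipoly F1 (\<zeta> ^ k) ^ n = - (ipoly C2 (\<zeta> ^ k) * ipoly F2 (\<zeta> ^ k) ^ n)"
      by (simp add: eq_neg_iff_add_eq_0)
    then have "c1 k * a k ^ n = c2 k * b k ^ n"
      unfolding c1_def c2_def a_def b_def by (metis norm_minus_cancel norm_mult norm_power)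
    then have "ln (c1 k * a k ^ n) = ln (c2 k * b k ^ n)" by simp
    then have "ln (c1 k) + n * ln (a k) = ln (c2 k) + n * ln (b k)"
      using pos[OF k] by (simp add: ln_mult ln_realpow)
    then have "real n * (ln (a k) - ln (b k)) = ln (c2 k) - ln (c1 k)" by (simp add: algebra_simps)
    then have "\<bar>real n * (ln (a k) - ln (b k))\<bar> = \<bar>ln (c2 k) - ln (c1 k)\<bar>" by simp
    then show ?thesis by (simp add: abs_mult)
  qed
  have "real n * real (totient m) \<le> real n * (\<Sum>k\<in>totatives m. \<bar>(a k)\<^sup>2 - (b k)\<^sup>2\<bar>)"
    using lower by (intro mult_left_mono) auto
  also have "\<dots> \<le> real n * (\<Sum>k\<in>totatives m. 2 * H\<^sup>2 * \<bar>ln (a k) - ln (b k)\<bar>)"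
    using pos le by (intro mult_left_mono sum_mono abs_ln_diff_ge) auto
  also have "\<dots> = 2 * H\<^sup>2 * (\<Sum>k\<in>totatives m. real n * \<bar>ln (a k) - ln (b k)\<bar>)"
    by (simp add: sum_distrib_left mult_ac)
  also have "\<dots> \<le> 2 * H\<^sup>2 * (\<Sum>k\<in>totatives m. \<bar>ln (c1 k)\<bar> + \<bar>ln (c2 k)\<bar>)"
    using n_ln by (intro mult_left_mono sum_mono) auto
  also have "\<dots> \<le> 2 * H\<^sup>2 * (2 * totient m * ln H + 2 * totient m * ln H)"
    unfolding sum.distrib c1_def c2_def using nz H bound
    by (intro mult_left_mono add_mono sum_abs_ln_le) auto
  also have "\<dots> = (8 * H\<^sup>2 * ln H) * real (totient m)" by simp
  finally show ?thesis using m_pos by (simp add: mult_le_cancel_right)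
qed

end

lemma ex_power_cong_1:
  fixes a n :: nat
  assumes "coprime a n" "n > 0"
  obtains s where "s > 0" "[a ^ s = 1] (mod n)"
proof -
  have "\<not> inj_on (\<lambda>i. a ^ i mod n) UNIV"
  proof
    assume "inj_on (\<lambda>i. a ^ i mod n) UNIV"
    moreover have "(\<lambda>i. a ^ i mod n) ` UNIV \<subseteq> {..<n}" using assms(2) by auto
    ultimately have "finite (UNIV :: nat set)" by (meson finite_lessThan inj_on_finite)
    then show False by simp
  qed
  then obtain i j where "a ^ i mod n = a ^ j mod n" "i \<noteq> j" by (auto simp: inj_on_def)
  then obtain i j where ij: "[a ^ i = a ^ j] (mod n)" "i < j"
    by (metis cong_def linorder_neqE_nat)
  have "[a ^ i * a ^ (j - i) = a ^ i * 1] (mod n)"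
    using ij by (simp add: cong_sym flip: power_add)
  moreover have "coprime (a ^ i) n" using assms(1) by simp
  ultimately have "[a ^ (j - i) = 1] (mod n)" using cong_mult_lcancel_nat by blast
  then show thesis using ij(2) by (intro that[of "j - i"]) auto
qed

section \<open>Divisibility in \<int>[\<zeta>]\<close>

context primitive_root
begin

definition zring :: "complex set" where
  "zring = range (\<lambda>P. ipoly P \<zeta>)"

lemma zringE:
  assumes "x \<in> zring"
  obtains P where "x = ipoly P \<zeta>"
  using assms by (auto simp: zring_def)

lemma ipoly_in_zring [simp]: "ipoly P \<zeta> \<in> zring"
  by (auto simp: zring_def)

lemma zring_of_int [simp]: "of_int c \<in> zring"
  using ipoly_in_zring[of "[:c:]"] by simp

lemma zring_of_nat [simp]: "of_nat c \<in> zring"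
  using zring_of_int[of "int c"] by simp

lemma zring_0 [simp]: "0 \<in> zring" and zring_1 [simp]: "1 \<in> zring"
  using zring_of_nat[of 0] zring_of_nat[of 1] by simp_all

lemma zring_add [intro]: "x \<in> zring \<Longrightarrow> y \<in> zring \<Longrightarrow> x + y \<in> zring"
  by (metis ipoly_add ipoly_in_zring zringE)

lemma zring_mult [intro]: "x \<in> zring \<Longrightarrow> y \<in> zring \<Longrightarrow> x * y \<in> zring"
  by (metis ipoly_mult ipoly_in_zring zringE)

lemma zring_uminus [intro]: "x \<in> zring \<Longrightarrow> - x \<in> zring"
  by (metis ipoly_uminus ipoly_in_zring zringE)

lemma zring_diff [intro]: "x \<in> zring \<Longrightarrow> y \<in> zring \<Longrightarrow> x - y \<in> zring"
  by (metis ipoly_diff ipoly_in_zring zringE)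

lemma zring_power [intro]: "x \<in> zring \<Longrightarrow> x ^ n \<in> zring"
  by (metis ipoly_power ipoly_in_zring zringE)

lemma zring_sum [intro]: "(\<And>i. i \<in> A \<Longrightarrow> f i \<in> zring) \<Longrightarrow> sum f A \<in> zring"
  by (induction A rule: infinite_finite_induct) auto

lemma zring_zeta_power [simp]: "\<zeta> ^ k \<in> zring"
  using ipoly_in_zring[of "monom 1 k"] by simp

lemma zring_zeta [simp]: "\<zeta> \<in> zring"
  using zring_zeta_power[of 1] by simp

lemma zring_cnj: "x \<in> zring \<Longrightarrow> cnj x \<in> zring"
proof -
  assume "x \<in> zring"
  then obtain P where "x = ipoly P \<zeta>" by (rule zringE)
  then have "cnj x = ipoly (pcompose P (monom 1 (m - 1))) \<zeta>"
    by (simp add: cnj_zeta flip: ipoly_cnj)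
  then show ?thesis by (simp only: ipoly_in_zring)
qed

text \<open>Divisibility has to be relative to \<open>zring\<close>, because \<open>dvd\<close> on
  the field of complex numbers carries no information.\<close>

definition zdvd :: "complex \<Rightarrow> complex \<Rightarrow> bool" where
  "zdvd a b \<longleftrightarrow> (\<exists>y\<in>zring. b = a * y)"

lemma zdvdI: "y \<in> zring \<Longrightarrow> b = a * y \<Longrightarrow> zdvd a b"
  by (auto simp: zdvd_def)

lemma zdvd_0 [simp]: "zdvd a 0"
  by (rule zdvdI[of 0]) auto

lemma zdvd_mult_self: "y \<in> zring \<Longrightarrow> zdvd a (a * y)"
  by (rule zdvdI) auto

lemma zdvd_trans: "zdvd a b \<Longrightarrow> zdvd b c \<Longrightarrow> zdvd a c"
  unfolding zdvd_def by (auto simp: mult.assoc)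

lemma zdvd_add: "zdvd a x \<Longrightarrow> zdvd a y \<Longrightarrow> zdvd a (x + y)"
  unfolding zdvd_def by (auto simp flip: distrib_left)

lemma zdvd_diff: "zdvd a x \<Longrightarrow> zdvd a y \<Longrightarrow> zdvd a (x - y)"
  unfolding zdvd_def by (auto simp flip: right_diff_distrib)

lemma zdvd_uminus: "zdvd a x \<Longrightarrow> zdvd a (- x)"
  using zdvd_diff[of a 0 x] by simp

lemma zdvd_mult: "zdvd a x \<Longrightarrow> y \<in> zring \<Longrightarrow> zdvd a (x * y)"
  unfolding zdvd_def by (auto simp: mult.assoc)

lemma zdvd_sum: "(\<And>i. i \<in> A \<Longrightarrow> zdvd a (f i)) \<Longrightarrow> zdvd a (sum f A)"
  by (induction A rule: infinite_finite_induct) (auto intro: zdvd_add)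

lemma zdvd_prod:
  assumes "finite A" "\<And>i. i \<in> A \<Longrightarrow> zdvd a (f i)"
  shows "zdvd (a ^ card A) (prod f A)"
  using assms
proof (induction A rule: finite_induct)
  case empty
  show ?case by (rule zdvdI[of 1]) auto
next
  case (insert i A)
  then obtain x y where "x \<in> zring" "f i = a * x" "y \<in> zring" "prod f A = a ^ card A * y"
    unfolding zdvd_def by (metis insertI1 insertI2)
  then show ?case using insert by (intro zdvdI[of "x * y"]) auto
qed

lemma zdvd_power_diff:
  assumes "a dvd b"
  shows "zdvd (\<zeta> ^ a - 1) (\<zeta> ^ b - 1)"
proof -
  obtain k where "b = a * k" using assms by (rule dvdE)
  then have "\<zeta> ^ b - 1 = (\<zeta> ^ a - 1) * (\<Sum>i<k. \<zeta> ^ (a * i))"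
    using power_diff_1_eq[of "\<zeta> ^ a" k] by (simp add: power_mult)
  then show ?thesis by (rule zdvdI[rotated]) auto
qed

text \<open>For \<open>\<eta> = \<zeta>^a\<close> the powers \<open>\<eta>^i\<close> with
  \<open>i < l\<close> sum to 0, so \<open>l\<close> is minus the sum of the
  \<open>\<eta>^i - 1\<close>, all multiples of \<open>\<eta> - 1\<close>.\<close>

lemma zdvd_order:
  assumes "(\<zeta> ^ a) ^ l = 1" "\<zeta> ^ a \<noteq> 1"
  shows "zdvd (\<zeta> ^ a - 1) (of_nat l)"
proof -
  have "(\<zeta> ^ a - 1) * (\<Sum>i<l. (\<zeta> ^ a) ^ i) = 0"
    using assms(1) power_diff_1_eq[of "\<zeta> ^ a" l] by simp
  then have "(\<Sum>i<l. (\<zeta> ^ a) ^ i) = 0" using assms(2) by simp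
  then have "of_nat l = - (\<Sum>i<l. \<zeta> ^ (a * i) - 1)"
    by (simp add: sum_subtractf power_mult)
  moreover have "zdvd (\<zeta> ^ a - 1) (\<Sum>i<l. \<zeta> ^ (a * i) - 1)"
    by (intro zdvd_sum zdvd_power_diff) auto
  ultimately show ?thesis by (simp add: zdvd_uminus)
qed

text \<open>Bezout's identity \<open>p u + a v = 1\<close> writes \<open>x\<close> as a sum of
  multiples of \<open>t\<close>.\<close>

lemma zdvd_cancel_coprime:
  assumes "prime p" "\<not> int p dvd a" "zdvd t (of_nat p)" "zdvd t (of_int a * x)" "x \<in> zring"
  shows "zdvd t x"
proof -
  have "coprime (int p) a" using assms(1,2) by (simp add: prime_imp_coprime)
  then obtain u v where "int p * u + a * v = 1"
    using bezout_int[of "int p" a] by (metis coprime_iff_gcd_eq_1 mult.commute)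
  then have "of_int (int p * u + a * v) = (1::complex)" by simp
  then have "of_nat p * of_int u + of_int a * of_int v = (1::complex)" by simp
  then have "x = of_nat p * (of_int u * x) + of_int a * x * of_int v"
    by (metis (no_types, lifting) distrib_right mult.assoc mult.commute mult_1)
  moreover have "zdvd t (of_nat p * (of_int u * x))"
    using assms(3,5) by (intro zdvd_mult) auto
  moreover have "zdvd t (of_int a * x * of_int v)"
    using assms(4) by (rule zdvd_mult) simp
  ultimately show ?thesis using zdvd_add by metis
qed

text \<open>Both sides are monic of degree \<open>totient m\<close> and vanish at all conjugates of
  \<open>\<zeta>\<close>, so a nonzero difference would have more roots than its degree.\<close>

lemma ipoly_monic_eq_prod:
  assumes "lead_coeff P = 1" "degree P = totient m" "ipoly P \<zeta> = 0"
  shows "ipoly P z = (\<Prod>k\<in>totatives m. z - \<zeta> ^ k)"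
proof -
  define Q :: "complex poly" where "Q = (\<Prod>k\<in>totatives m. [:- (\<zeta> ^ k), 1:])"
  have Q: "poly Q x = (\<Prod>k\<in>totatives m. x - \<zeta> ^ k)" for x
    by (simp add: Q_def poly_prod)
  have degQ: "degree Q = totient m"
    unfolding Q_def by (subst degree_prod_eq_sum_degree) (auto simp: totient_def)
  have lead: "lead_coeff Q = 1" unfolding Q_def lead_coeff_prod by simp
  define p where "p = map_poly of_int P - Q"
  have "p = 0"
  proof (rule ccontr)
    assume "p \<noteq> 0"
    then have "card ((\<lambda>k. \<zeta> ^ k) ` totatives m) \<le> degree p"
      using assms(3) conjugate_root[of _ P]
      by (intro card_complex_roots_le) (force simp: p_def ipoly_def Q in_totatives_iff)+
    moreover have "degree p < totient m"
    proof -
      have "degree p \<le> totient m" unfolding p_def by (rule degree_diff_le) (auto simp: degQ assms)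
      moreover have "coeff p (totient m) = 0"
        using lead assms by (simp add: p_def coeff_map_poly degQ)
      ultimately show ?thesis
        using \<open>p \<noteq> 0\<close> by (metis le_neq_implies_less leading_coeff_0_iff)
    qed
    ultimately show False by (simp add: card_conjugates)
  qed
  then have "ipoly P z = poly Q z" by (simp add: p_def ipoly_def)
  then show ?thesis by (simp only: Q)
qed

end

section \<open>The primes over \<open>p\<close>\<close>

locale split_root = primitive_root +
  fixes p r m' :: nat
  assumes p: "prime p" and m_eq: "m = p ^ r * m'" and p_m': "\<not> p dvd m'"
begin

lemma m'_pos: "m' > 0"
  using m_pos m_eq by auto

lemma p_gt_1: "p > 1"
  using p prime_gt_1_nat by blast

text \<open>Every prime ideal over \<open>p\<close> divides \<open>tau\<close> exactly once.\<close>

definition tau :: complex where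
  "tau = (if r = 0 then of_nat p else \<zeta> ^ m' - 1)"

lemma tau_eq_p: "r = 0 \<Longrightarrow> tau = of_nat p"
  and tau_eq: "r > 0 \<Longrightarrow> tau = \<zeta> ^ m' - 1"
  unfolding tau_def by auto

lemma tau_in_zring [simp]: "tau \<in> zring"
  by (auto simp: tau_def)

lemma tau_nonzero [simp]: "tau \<noteq> 0"
proof (cases "r = 0")
  case False
  have "m' * 1 < m' * p ^ r" using m'_pos p_gt_1 False by (intro mult_strict_left_mono one_less_power) auto
  then have "m' < m" by (simp add: m_eq mult.commute)
  then have "\<not> m dvd m'" using m'_pos by (meson nat_dvd_not_less)
  then show ?thesis using False by (simp add: tau_eq zeta_power_eq_1_iff)
qed (use p_gt_1 tau_eq_p in simp)

text \<open>\<open>\<eta> = \<zeta>^m'\<close> has order \<open>p^r\<close>, and the cyclotomic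
  polynomial of that order takes the value \<open>p\<close> at 1. So \<open>p\<close> is the product
  of the \<open>1 - \<eta>^k\<close>, each divisible by \<open>tau = \<eta> - 1\<close>.\<close>

lemma tau_power_zdvd_p:
  assumes "r > 0"
  shows "zdvd (tau ^ totient (p ^ r)) (of_nat p)"
proof -
  define q where "q = p ^ (r - 1)"
  define \<eta> where "\<eta> = \<zeta> ^ m'"
  have pr: "p ^ r = q * p" using assms by (metis One_nat_def Suc_pred power_Suc2 q_def)
  have q: "q > 0" using p_gt_1 by (simp add: q_def)
  have \<eta>_iff: "\<eta> ^ k = 1 \<longleftrightarrow> p ^ r dvd k" for k
    using m'_pos zeta_power_eq_1_iff[of "m' * k"]
    by (simp add: \<eta>_def m_eq mult.commute flip: power_mult)
  interpret e: primitive_root "p ^ r" \<eta>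
  proof
    show "primitive_root_of_unity (p ^ r) \<eta>"
      using p_gt_1 by (auto simp: primitive_root_of_unity_def \<eta>_iff dest: dvd_imp_le)
  qed
  have tot: "totient (p ^ r) = (p - 1) * q"
    using p assms by (simp add: totient_prime_power q_def mult.commute)
  \<comment> \<open>This is the \<open>p^r\<close>-th cyclotomic polynomial; with
    \<open>q = p^(r - 1)\<close> it has degree \<open>(p - 1) q\<close>.\<close>
  define \<Phi> :: "int poly" where "\<Phi> = (\<Sum>i<p. monom 1 (i * q))"
  have coeff: "coeff \<Phi> ((p - 1) * q) = 1"
  proof -
    have "coeff \<Phi> ((p - 1) * q) = (\<Sum>i<p. if i = p - 1 then 1 else 0)"
      using q by (auto simp: \<Phi>_def coeff_sum intro!: sum.cong)
    also have "\<dots> = 1" using p_gt_1 by simp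
    finally show ?thesis .
  qed
  have "degree \<Phi> \<le> (p - 1) * q"
    unfolding \<Phi>_def by (intro degree_sum_le) (auto intro!: order_trans[OF degree_monom_le])
  moreover have "(p - 1) * q \<le> degree \<Phi>" using coeff by (intro le_degree) simp
  ultimately have deg: "degree \<Phi> = (p - 1) * q" by simp
  have "(\<eta> ^ q - 1) * (\<Sum>i<p. (\<eta> ^ q) ^ i) = (\<eta> ^ q) ^ p - 1"
    by (rule power_diff_1_eq[symmetric])
  also have "(\<eta> ^ q) ^ p = 1" unfolding power_mult[symmetric] \<eta>_iff pr by simp
  finally have "\<eta> ^ q = 1 \<or> (\<Sum>i<p. (\<eta> ^ q) ^ i) = 0" by auto
  moreover have "\<eta> ^ q \<noteq> 1"
    unfolding \<eta>_iff pr using q p_gt_1 by (simp add: nat_dvd_not_less)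
  moreover have "ipoly \<Phi> \<eta> = (\<Sum>i<p. (\<eta> ^ q) ^ i)"
    by (simp add: \<Phi>_def mult.commute[of q] flip: power_mult)
  ultimately have "ipoly \<Phi> \<eta> = 0" by simp
  then have "ipoly \<Phi> 1 = (\<Prod>k\<in>totatives (p ^ r). 1 - \<eta> ^ k)"
    using deg coeff tot by (intro e.ipoly_monic_eq_prod) auto
  then have "of_nat p = (\<Prod>k\<in>totatives (p ^ r). 1 - \<eta> ^ k)" by (simp add: \<Phi>_def)
  moreover have "zdvd (tau ^ card (totatives (p ^ r))) (\<Prod>k\<in>totatives (p ^ r). 1 - \<eta> ^ k)"
  proof (rule zdvd_prod)
    fix k
    have "zdvd tau (\<zeta> ^ (m' * k) - 1)" using zdvd_power_diff[of m' "m' * k"] assms by (simp add: tau_eq)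
    then have "zdvd tau (- (\<zeta> ^ (m' * k) - 1))" by (rule zdvd_uminus)
    then show "zdvd tau (1 - \<eta> ^ k)" by (simp add: \<eta>_def power_mult)
  qed simp
  ultimately show ?thesis by (simp add: totient_def)
qed

lemma tau_zdvd_p: "zdvd tau (of_nat p)"
proof (cases "r = 0")
  case True
  then show ?thesis unfolding tau_eq_p[OF True] by (intro zdvdI[of 1]) auto
next
  case False
  then obtain y where y: "y \<in> zring" "of_nat p = tau ^ totient (p ^ r) * y"
    using tau_power_zdvd_p by (auto simp: zdvd_def)
  have "totient (p ^ r) > 0" using p_gt_1 by simp
  then have "tau ^ totient (p ^ r) = tau * tau ^ (totient (p ^ r) - 1)"
    by (metis mult.commute power_minus_mult)
  then have "of_nat p = tau * (tau ^ (totient (p ^ r) - 1) * y)" using y(2) by (simp only: mult.assoc)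
  moreover have "tau ^ (totient (p ^ r) - 1) * y \<in> zring"
    using y(1) by (intro zring_mult zring_power tau_in_zring)
  ultimately show ?thesis by (rule zdvdI[rotated])
qed

text \<open>By Frobenius \<open>(\<zeta>^m' - 1)^(p^r)\<close> is congruent to
  \<open>\<zeta>^m - 1 = 0\<close> modulo \<open>p\<close>. Powers of \<open>tau\<close> can
  therefore clear a denominator \<open>p\<close>.\<close>

lemma p_zdvd_tau_power: "zdvd (of_nat p) (tau ^ (p ^ r))"
proof (cases "r = 0")
  case True
  then show ?thesis unfolding tau_eq_p[OF True] by (intro zdvdI[of 1]) auto
next
  case False
  obtain A where "\<forall>z. ipoly (monom 1 m' - 1) z ^ (p ^ r)
      = ipoly (monom 1 m' - 1) (z ^ (p ^ r)) + of_nat p * ipoly A z"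
    using frobenius_ipoly[OF p] by blast
  from spec[OF this, of \<zeta>] have "(\<zeta> ^ m' - 1) ^ (p ^ r) = of_nat p * ipoly A \<zeta>"
    by (simp flip: power_mult m_eq)
  then show ?thesis using False by (intro zdvdI[of "ipoly A \<zeta>"]) (auto simp: tau_eq)
qed

text \<open>The ring \<open>\<int>[\<zeta>]/(tau)\<close> is reduced because a power of the Frobenius map is
  the identity on it.\<close>

lemma tau_reduced:
  assumes "\<kappa> \<in> zring" "zdvd tau (\<kappa> ^ j)"
  shows "zdvd tau \<kappa>"
proof -
  obtain K where K: "\<kappa> = ipoly K \<zeta>" using assms(1) by (rule zringE)
  have "coprime p m'" using p p_m' by (simp add: prime_imp_coprime)
  then obtain s where s: "s > 0" "[p ^ s = 1] (mod m')" using m'_pos by (rule ex_power_cong_1)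
  \<comment> \<open>This power of \<open>p\<close> is 1 modulo \<open>m'\<close> and at least
    \<open>j\<close>. So \<open>tau\<close> divides \<open>\<kappa>^q\<close>, which modulo
    \<open>tau\<close> is \<open>K(\<zeta>^q)\<close> and thus \<open>\<kappa>\<close>.\<close>
  define q where "q = p ^ (s * j)"
  have "[(p ^ s) ^ j = 1 ^ j] (mod m')" using s(2) by (rule cong_pow)
  then have "[q = 1] (mod m')" by (simp add: q_def power_mult)
  then have dvd: "m' dvd q - 1"
    using p_gt_1 by (metis cong_altdef_nat less_or_eq_imp_le nat_less_le one_le_power q_def)
  have "j \<le> s * j" using s(1) by simp
  also have "\<dots> < 2 ^ (s * j)" by (rule less_exp)
  also have "\<dots> \<le> q" unfolding q_def using p_gt_1 by (intro power_mono) auto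
  finally have jq: "j \<le> q" by simp
  have "q \<ge> 1" using p_gt_1 by (simp add: q_def)
  obtain A where A: "\<forall>z. ipoly K z ^ q = ipoly K (z ^ q) + of_nat p * ipoly A z"
    unfolding q_def using frobenius_ipoly[OF p] by blast
  obtain S where S: "\<forall>z. ipoly K (ipoly (monom 1 q) z) - ipoly K (ipoly (monom 1 1) z)
    = (ipoly (monom 1 q) z - ipoly (monom 1 1) z) * ipoly S z"
    using ipoly_diff_dvd by blast
  have "zdvd tau (\<kappa> ^ j * \<kappa> ^ (q - j))" using assms by (intro zdvd_mult) auto
  then have "zdvd tau (\<kappa> ^ q)" using jq by (simp flip: power_add)
  moreover have "zdvd tau (of_nat p * ipoly A \<zeta>)" using tau_zdvd_p by (rule zdvd_mult) simp
  moreover have "zdvd tau ((\<zeta> ^ q - \<zeta>) * ipoly S \<zeta>)"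
  proof (rule zdvd_mult)
    have "\<zeta> ^ q - \<zeta> = (\<zeta> ^ (q - 1) - 1) * \<zeta>"
      using \<open>q \<ge> 1\<close> by (simp add: algebra_simps power_eq_if)
    moreover have "zdvd tau (\<zeta> ^ (q - 1) - 1)"
    proof (cases "r = 0")
      case True
      then have "\<zeta> ^ (q - 1) = 1" using dvd m_eq by (simp add: zeta_power_eq_1_iff)
      then show ?thesis by simp
    next
      case False
      then show ?thesis using zdvd_power_diff[OF dvd] by (simp add: tau_eq)
    qed
    moreover have "\<zeta> \<in> zring" using zring_zeta_power[of 1] by simp
    ultimately show "zdvd tau (\<zeta> ^ q - \<zeta>)" by (simp add: zdvd_mult)
  qed simp
  ultimately have "zdvd tau (\<kappa> ^ q - of_nat p * ipoly A \<zeta> - (\<zeta> ^ q - \<zeta>) * ipoly S \<zeta>)"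
    by (intro zdvd_diff)
  moreover have "\<kappa> = \<kappa> ^ q - of_nat p * ipoly A \<zeta> - (\<zeta> ^ q - \<zeta>) * ipoly S \<zeta>"
    using spec[OF A, of \<zeta>] spec[OF S, of \<zeta>] by (simp add: K algebra_simps)
  ultimately show ?thesis by simp
qed

lemma tau_zdvd_cancel:
  assumes "\<not> int p dvd a" "zdvd tau (of_int a * \<kappa> ^ j)" "\<kappa> \<in> zring"
  shows "zdvd tau \<kappa>"
proof -
  have "zdvd tau (\<kappa> ^ j)"
    by (rule zdvd_cancel_coprime[OF p assms(1) tau_zdvd_p assms(2)]) (use assms(3) in auto)
  with assms(3) show ?thesis by (rule tau_reduced)
qed

text \<open>Up to the unit \<open>\<zeta>^i\<close> the difference is \<open>\<zeta>^s - 1\<close>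
  with \<open>s = j - i\<close>. It divides \<open>\<eta> - 1\<close> for a root of unity
  \<open>\<eta>\<close> of prime order \<open>l\<close> with \<open>l\<close> dividing
  \<open>m'\<close>, and this divides \<open>l\<close>. So powers with distinct exponents below
  \<open>m'\<close> stay distinct modulo every prime over \<open>p\<close>.\<close>

lemma root_difference_zdvd:
  assumes "i < j" "j < m'"
  obtains l where "zdvd (\<zeta> ^ j - \<zeta> ^ i) (of_int l)" "\<not> int p dvd l"
proof -
  define s where "s = j - i"
  define g where "g = gcd m' s"
  have s: "0 < s" "s < m'" using assms by (auto simp: s_def)
  define a b where "a = m' div g" and "b = s div g"
  have ab: "m' = g * a" "s = g * b" "coprime a b"
    using m'_pos unfolding a_def b_def g_def by (simp_all add: div_gcd_coprime)
  have "g > 0" using m'_pos by (simp add: g_def)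
  have "g * 0 < g * b" "g * b < g * a" using s ab by auto
  then have "a > 1" using \<open>g > 0\<close> by simp
  then obtain l where l: "prime l" "l dvd a" using prime_factor_nat[of a] by auto
  then obtain c where c: "a = l * c" by (auto elim: dvdE)
  have "l \<noteq> p" using l ab(1) p_m' by auto
  then have "\<not> p dvd l" using l(1) p primes_dvd_imp_eq by blast
  \<comment> \<open>\<open>k = m / (g l)\<close>, which gives \<open>\<zeta>^(s k)\<close> the exact
    order \<open>l\<close>.\<close>
  define k where "k = p ^ r * c"
  have m: "m = g * (l * k)" by (simp add: m_eq ab(1) c k_def mult_ac)
  have "(\<zeta> ^ (s * k)) ^ l = 1"
    unfolding power_mult[symmetric] zeta_power_eq_1_iff by (simp add: m ab(2) mult_ac)
  moreover have "\<zeta> ^ (s * k) \<noteq> 1"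
  proof
    assume "\<zeta> ^ (s * k) = 1"
    then have "g * (l * k) dvd g * (b * k)" unfolding zeta_power_eq_1_iff by (simp add: m ab(2) mult_ac)
    moreover have "k > 0" "g > 0" using m_pos m by auto
    ultimately have "l dvd b" by simp
    then have "is_unit l" using l(2) ab(3) by (meson coprime_common_divisor)
    then show False using l(1) by simp
  qed
  ultimately have "zdvd (\<zeta> ^ (s * k) - 1) (of_nat l)" by (rule zdvd_order)
  moreover have "zdvd (\<zeta> ^ s - 1) (\<zeta> ^ (s * k) - 1)" by (rule zdvd_power_diff) simp
  ultimately have "zdvd (\<zeta> ^ s - 1) (of_nat l)" using zdvd_trans by blast
  then obtain y where y: "y \<in> zring" "of_nat l = (\<zeta> ^ s - 1) * y" by (auto simp: zdvd_def)
  have "\<exists>w\<in>zring. \<zeta> ^ i * w = 1"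
  proof
    have "i + (m - 1) * i = m * i" using m_pos by (cases m) auto
    then show "\<zeta> ^ i * \<zeta> ^ ((m - 1) * i) = 1"
      unfolding power_add[symmetric] zeta_power_eq_1_iff by simp
  qed simp
  then obtain w where w: "w \<in> zring" "\<zeta> ^ i * w = 1" by blast
  have "\<zeta> ^ j = \<zeta> ^ i * \<zeta> ^ s" using assms by (simp add: s_def flip: power_add)
  then have "(\<zeta> ^ j - \<zeta> ^ i) * (w * y) = (\<zeta> ^ i * w) * ((\<zeta> ^ s - 1) * y)"
    by (simp only: left_diff_distrib right_diff_distrib mult_1 mult_1_right mult_ac)
  also have "\<dots> = of_nat l" by (simp only: w(2) y(2) mult_1)
  finally have "of_nat l = (\<zeta> ^ j - \<zeta> ^ i) * (w * y)" ..
  then have "zdvd (\<zeta> ^ j - \<zeta> ^ i) (of_int (int l))" using w y by (intro zdvdI[of "w * y"]) auto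
  then show thesis using \<open>\<not> p dvd l\<close> by (intro that[of "int l"]) auto
qed

end

text \<open>Modulo \<open>p\<close> and \<open>C\<close> the powers \<open>1, h, ..., h^D\<close>
  lie in a space of dimension at most \<open>D\<close> over the field with \<open>p\<close>
  elements, so they are dependent. The lowest term of a dependency has the index \<open>i\<close>;
  in this sense \<open>C\<close> has order at most \<open>D\<close> in \<open>h\<close>.\<close>

lemma ex_low_order_combination:
  fixes C h :: "int poly"
  assumes p: "prime p" and C: "\<not> of_nat p dvd C" "degree C \<le> D"
  obtains i a A B where "i \<le> D" "\<not> int p dvd a"
    "of_nat p dvd A * C - h ^ i * ([:a:] + h * B)"
proof -
  let ?p = "of_nat p :: int poly"
  have dvd_iff: "?p dvd P \<longleftrightarrow> (\<forall>n. int p dvd coeff P n)" for P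
    by (simp add: of_nat_poly const_poly_dvd_iff)
  have p1: "p > 1" using p prime_gt_1_nat by blast
  define S where "S = {i. \<not> int p dvd coeff C i}"
  have S_le: "i \<le> degree C" if "i \<in> S" for i
    using that by (intro le_degree) (auto simp: S_def)
  then have "finite S" by (meson finite_nat_set_iff_bounded_le)
  have "S \<noteq> {}" using C(1) by (auto simp: dvd_iff S_def)
  define d where "d = Max S"
  have d: "d \<in> S" "\<And>i. i \<in> S \<Longrightarrow> i \<le> d"
    using \<open>finite S\<close> \<open>S \<noteq> {}\<close> by (auto simp: d_def)
  have "d \<le> D" using S_le[OF d(1)] C(2) by simp
  have "coprime (coeff C d) (int p)"
    using d(1) p by (simp add: S_def prime_imp_coprime coprime_commute)
  then obtain v where v: "[coeff C d * v = 1] (mod int p)"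
    using cong_solve_coprime_int by blast
  \<comment> \<open>\<open>g\<close> is the monic polynomial proportional to \<open>C\<close> modulo
    \<open>p\<close>, and \<open>d\<close> is the degree of \<open>C\<close> modulo
    \<open>p\<close>.\<close>
  define g where "g = monom 1 d + (\<Sum>i<d. monom (v * coeff C i) i)"
  have coeff_g: "coeff g i = (if i = d then 1 else if i < d then v * coeff C i else 0)" for i
    by (auto simp: g_def coeff_sum)
  have "degree g = d"
    by (intro antisym degree_le le_degree) (auto simp: coeff_g)
  then have monic: "lead_coeff g = 1" by (simp add: coeff_g)
  have gC: "?p dvd smult v C - g"
    unfolding dvd_iff
  proof
    fix i
    show "int p dvd coeff (smult v C - g) i"
    proof (cases i d rule: linorder_cases)
      case equal
      then show ?thesis using v by (simp add: coeff_g cong_iff_dvd_diff mult.commute)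
    next
      case greater
      then have "i \<notin> S" using d(2) by force
      then show ?thesis using greater by (simp add: coeff_g S_def)
    qed (simp add: coeff_g)
  qed
  have "\<forall>i. \<exists>q r. h ^ i = g * q + r \<and> (r = 0 \<or> degree r < d)"
    using monic_division[OF monic] \<open>degree g = d\<close> by metis
  then obtain q r where qr: "\<And>i. h ^ i = g * q i + r i" "\<And>i. r i = 0 \<or> degree (r i) < d"
    by metis
  have r0: "coeff (r i) k = 0" if "k \<ge> d" for i k
    using qr(2)[of i] that by (auto intro: coeff_eq_0)
  define comb where "comb a = (\<Sum>i\<le>D. smult (int (a i)) (r i))" for a :: "nat \<Rightarrow> nat"
  define F where "F a = (\<lambda>k\<in>{..<d}. nat (coeff (comb a) k mod int p))" for a
  let ?A = "PiE {..D} (\<lambda>_. {..<p})"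
  \<comment> \<open>Linear dependence by counting: \<open>p^(D+1)\<close> coefficient vectors, but
    only \<open>p^d\<close> remainders modulo \<open>p\<close>, and \<open>d <= D\<close>.\<close>
  have "\<not> inj_on F ?A"
  proof
    assume "inj_on F ?A"
    moreover have "F ` ?A \<subseteq> PiE {..<d} (\<lambda>_. {..<p})"
      using p1 by (auto simp: F_def nat_less_iff split: if_splits)
    ultimately have "card ?A \<le> card (PiE {..<d} (\<lambda>_. {..<p}))"
      by (intro card_inj_on_le) (auto intro: finite_PiE)
    then have "p ^ Suc D \<le> p ^ d" by (simp add: card_PiE)
    then have "Suc D \<le> d" using p1 by (simp only: power_increasing_iff)
    then show False using \<open>d \<le> D\<close> by simp
  qed
  then obtain a b where ab: "a \<in> ?A" "b \<in> ?A" "F a = F b" "a \<noteq> b"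
    by (auto simp: inj_on_def)
  define c where "c i = int (a i) - int (b i)" for i
  have comb_diff: "comb a - comb b = (\<Sum>i\<le>D. smult (c i) (r i))"
    by (simp add: comb_def c_def smult_diff_left sum_subtractf)
  have p_comb: "?p dvd (\<Sum>i\<le>D. smult (c i) (r i))"
    unfolding comb_diff[symmetric] dvd_iff
  proof
    fix k
    show "int p dvd coeff (comb a - comb b) k"
    proof (cases "k < d")
      case True
      then have "nat (coeff (comb a) k mod int p) = nat (coeff (comb b) k mod int p)"
        using fun_cong[OF ab(3), of k] by (simp add: F_def)
      then have "coeff (comb a) k mod int p = coeff (comb b) k mod int p"
        using p1 by (simp add: eq_nat_nat_iff)
      then show ?thesis by (simp add: mod_eq_dvd_iff)
    next
      case False
      then show ?thesis by (simp add: comb_diff coeff_sum r0)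
    qed
  qed
  obtain i1 where i1: "i1 \<le> D" "a i1 \<noteq> b i1"
    using ab by (metis PiE_ext atMost_iff)
  have "\<not> int p dvd c i1"
  proof
    assume "int p dvd c i1"
    moreover have "\<bar>c i1\<bar> < int p" using PiE_mem[OF ab(1), of i1] PiE_mem[OF ab(2), of i1] i1(1) by (simp add: c_def)
    ultimately have "c i1 = 0" by (metis dvd_imp_le_int abs_of_nat leD)
    then show False using i1(2) by (simp add: c_def)
  qed
  \<comment> \<open>The terms below the first coefficient prime to \<open>p\<close> vanish modulo
    \<open>p\<close>, so \<open>h^i0\<close> factors out of what remains.\<close>
  define i0 where "i0 = (LEAST i. \<not> int p dvd c i)"
  have i0: "\<not> int p dvd c i0" "\<And>i. i < i0 \<Longrightarrow> int p dvd c i"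
    unfolding i0_def using LeastI[of "\<lambda>i. \<not> int p dvd c i", OF \<open>\<not> int p dvd c i1\<close>]
    by (auto dest: not_less_Least)
  have "i0 \<le> D"
    using i1(1) Least_le[of "\<lambda>i. \<not> int p dvd c i", OF \<open>\<not> int p dvd c i1\<close>] by (simp add: i0_def)
  define B where "B = (\<Sum>i\<in>{i0<..D}. smult (c i) (h ^ (i - Suc i0)))"
  have "(\<Sum>i\<le>D. smult (c i) (h ^ i))
      = (\<Sum>i<i0. smult (c i) (h ^ i)) + (smult (c i0) (h ^ i0) + (\<Sum>i\<in>{i0<..D}. smult (c i) (h ^ i)))"
  proof -
    have "{..D} = {..<i0} \<union> insert i0 {i0<..D}" using \<open>i0 \<le> D\<close> by auto
    then show ?thesis by (simp add: sum.union_disjoint[of "{..<i0}"] disjoint_iff)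
  qed
  also have "(\<Sum>i\<in>{i0<..D}. smult (c i) (h ^ i)) = h ^ i0 * (h * B)"
  proof -
    have "h ^ i = h ^ i0 * (h * h ^ (i - Suc i0))" if "i \<in> {i0<..D}" for i
      using that by (simp flip: power_add power_Suc)
    then show ?thesis by (simp add: B_def sum_distrib_left)
  qed
  finally have sum_h: "(\<Sum>i\<le>D. smult (c i) (h ^ i))
    = (\<Sum>i<i0. smult (c i) (h ^ i)) + h ^ i0 * ([:c i0:] + h * B)"
    by (simp add: algebra_simps)
  define Q where "Q = (\<Sum>i\<le>D. smult (c i) (q i))"
  have sum_g: "(\<Sum>i\<le>D. smult (c i) (h ^ i)) = g * Q + (\<Sum>i\<le>D. smult (c i) (r i))"
    unfolding qr(1) Q_def by (simp add: smult_add_right sum.distrib sum_distrib_left)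
  have "?p dvd (\<Sum>i<i0. smult (c i) (h ^ i))"
    unfolding dvd_iff using i0(2) by (auto simp: coeff_sum intro!: dvd_sum)
  then have "?p dvd Q * (smult v C - g) - (\<Sum>i\<le>D. smult (c i) (r i)) + (\<Sum>i<i0. smult (c i) (h ^ i))"
    using dvd_add[OF dvd_diff[OF dvd_mult[OF gC] p_comb]] by blast
  also have "\<dots> = smult v Q * C - h ^ i0 * ([:c i0:] + h * B)"
  proof -
    have "g * Q + (\<Sum>i\<le>D. smult (c i) (r i))
      = (\<Sum>i<i0. smult (c i) (h ^ i)) + h ^ i0 * ([:c i0:] + h * B)"
      using sum_g sum_h by simp
    then show ?thesis by (simp add: right_diff_distrib mult.commute algebra_simps)
  qed
  finally show thesis using \<open>i0 \<le> D\<close> i0(1) by (intro that)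
qed

section \<open>Elements with \<open>p\<close> in the denominator\<close>

text \<open>\<open>\<gamma>\<close> will be \<open>b' \<beta>\<close>, where \<open>p b'\<close> is
  the least denominator of \<open>\<beta>\<close>, and also the complex conjugate of this
  number.\<close>

locale nonintegral = split_root +
  fixes \<gamma> :: complex
  assumes \<gamma>_notin: "\<gamma> \<notin> zring" and p\<gamma>_in: "of_nat p * \<gamma> \<in> zring"
begin

text \<open>Take the least power of \<open>tau\<close> that makes \<open>\<gamma>\<close> integral.
  It is a positive power because \<open>\<gamma>\<close> is not in \<open>zring\<close>, and its
  minimality keeps \<open>tau\<close> from dividing the product.\<close>

lemma ex_uniformised:
  obtains t where "t > 0" "tau ^ t * \<gamma> \<in> zring" "\<not> zdvd tau (tau ^ t * \<gamma>)"
proof -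
  obtain y where y: "y \<in> zring" "tau ^ (p ^ r) = of_nat p * y"
    using p_zdvd_tau_power by (auto simp: zdvd_def)
  have "tau ^ (p ^ r) * \<gamma> = y * (of_nat p * \<gamma>)" using y by simp
  then have ex: "tau ^ (p ^ r) * \<gamma> \<in> zring" by (simp only: zring_mult[OF y(1) p\<gamma>_in])
  define t where "t = (LEAST t. tau ^ t * \<gamma> \<in> zring)"
  have t: "tau ^ t * \<gamma> \<in> zring" and least: "\<And>s. s < t \<Longrightarrow> tau ^ s * \<gamma> \<notin> zring"
    unfolding t_def using LeastI[of "\<lambda>t. tau ^ t * \<gamma> \<in> zring", OF ex] by (auto dest: not_less_Least)
  have "t > 0" using t \<gamma>_notin by (cases t) auto
  moreover have "\<not> zdvd tau (tau ^ t * \<gamma>)"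
  proof
    assume "zdvd tau (tau ^ t * \<gamma>)"
    then obtain z where z: "z \<in> zring" "tau ^ t * \<gamma> = tau * z" by (auto simp: zdvd_def)
    have "tau * (tau ^ (t - 1) * \<gamma>) = tau * z"
      using z(2) \<open>t > 0\<close> by (simp add: power_eq_if)
    then have "tau ^ (t - 1) * \<gamma> \<in> zring" using z(1) by simp
    then show False using least[of "t - 1"] \<open>t > 0\<close> by simp
  qed
  ultimately show thesis using t that by blast
qed

text \<open>With \<open>\<kappa> = tau^t \<gamma>\<close> integral, the relation multiplied by
  \<open>tau^(t J)\<close> has a factor \<open>tau\<close> in every term but the top one. So
  \<open>tau\<close> divides \<open>l \<kappa>^J\<close>, and then \<open>\<kappa>\<close>, since
  the ring modulo \<open>tau\<close> is reduced.\<close>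

lemma no_relation:
  assumes \<delta>: "\<And>j. j \<le> J \<Longrightarrow> \<delta> j \<in> zring" and rel: "(\<Sum>j\<le>J. \<delta> j * \<gamma> ^ j) = 0"
    and l: "zdvd (\<delta> J) (of_int l)" "\<not> int p dvd l"
  shows False
proof -
  obtain t where t: "t > 0" "tau ^ t * \<gamma> \<in> zring" "\<not> zdvd tau (tau ^ t * \<gamma>)"
    by (rule ex_uniformised)
  define \<kappa> where "\<kappa> = tau ^ t * \<gamma>"
  have \<kappa>: "\<kappa> \<in> zring" using t by (simp add: \<kappa>_def)
  have eq: "tau ^ (t * J) * (\<delta> j * \<gamma> ^ j) = \<delta> j * tau ^ (t * (J - j)) * \<kappa> ^ j" if "j \<le> J" for j
  proof -
    have "t * J = t * (J - j) + t * j" using that by (simp flip: distrib_left)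
    then have "tau ^ (t * J) = tau ^ (t * (J - j)) * (tau ^ t) ^ j"
      by (simp only: power_add power_mult)
    then show ?thesis by (simp add: \<kappa>_def power_mult_distrib)
  qed
  have "(\<Sum>j\<le>J. \<delta> j * tau ^ (t * (J - j)) * \<kappa> ^ j) = tau ^ (t * J) * (\<Sum>j\<le>J. \<delta> j * \<gamma> ^ j)"
    unfolding sum_distrib_left by (rule sum.cong) (use eq in \<open>metis atMost_iff\<close>)+
  then have "(\<Sum>j\<le>J. \<delta> j * tau ^ (t * (J - j)) * \<kappa> ^ j) = 0" using rel by simp
  moreover have "{..J} = insert J {..<J}" by auto
  ultimately have "\<delta> J * \<kappa> ^ J = - (\<Sum>j<J. \<delta> j * tau ^ (t * (J - j)) * \<kappa> ^ j)"
    by (simp add: eq_neg_iff_add_eq_0)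
  moreover have "zdvd tau (\<Sum>j<J. \<delta> j * tau ^ (t * (J - j)) * \<kappa> ^ j)"
  proof (rule zdvd_sum)
    fix j assume j: "j \<in> {..<J}"
    then have "t * (J - j) > 0" using t(1) by simp
    then have "\<delta> j * tau ^ (t * (J - j)) * \<kappa> ^ j = tau * (tau ^ (t * (J - j) - 1) * \<delta> j * \<kappa> ^ j)"
      by (simp add: power_eq_if[of tau "t * (J - j)"])
    moreover have "tau ^ (t * (J - j) - 1) * \<delta> j * \<kappa> ^ j \<in> zring"
      using j \<delta> \<kappa> by (intro zring_mult zring_power) auto
    ultimately show "zdvd tau (\<delta> j * tau ^ (t * (J - j)) * \<kappa> ^ j)" by (rule zdvdI[rotated])
  qed
  ultimately have "zdvd tau (\<delta> J * \<kappa> ^ J)" by (simp add: zdvd_uminus)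
  moreover obtain y where y: "y \<in> zring" "of_int l = \<delta> J * y" using l(1) by (auto simp: zdvd_def)
  ultimately have "zdvd tau (\<delta> J * \<kappa> ^ J * y)" using zdvd_mult by blast
  moreover have "\<delta> J * \<kappa> ^ J * y = of_int l * \<kappa> ^ J" by (simp add: y(2))
  ultimately have "zdvd tau \<kappa>" using l(2) \<kappa> tau_zdvd_cancel by simp
  then show False using t by (simp add: \<kappa>_def)
qed

text \<open>Modulo \<open>p\<close> some multiple of \<open>C(\<zeta>)\<close> is
  \<open>tau^i (a + tau B)\<close> with \<open>i <= D\<close>, and \<open>p\<close> itself is
  divisible by \<open>tau^(i+1)\<close>. But \<open>\<gamma>^n\<close> has denominator
  \<open>tau^(t n)\<close> with \<open>t n > i\<close>, so integrality of the product would make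
  \<open>tau\<close> divide \<open>a \<kappa>^n\<close>.\<close>

lemma no_bounded_denominator:
  assumes C: "\<not> of_nat p dvd C" "degree C \<le> D"
    and r: "r > 0" "D < totient (p ^ r)" and n: "D < n" and "ipoly C \<zeta> * \<gamma> ^ n \<in> zring"
  shows False
proof -
  obtain t where t: "t > 0" "tau ^ t * \<gamma> \<in> zring" "\<not> zdvd tau (tau ^ t * \<gamma>)"
    by (rule ex_uniformised)
  define \<kappa> where "\<kappa> = tau ^ t * \<gamma>"
  have \<kappa>: "\<kappa> \<in> zring" using t by (simp add: \<kappa>_def)
  define \<rho> where "\<rho> = ipoly C \<zeta> * \<gamma> ^ n"
  have \<rho>: "\<rho> \<in> zring" using assms by (simp add: \<rho>_def)
  obtain i a A B where iaAB: "i \<le> D" "\<not> int p dvd a"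
    "of_nat p dvd A * C - (monom 1 m' - 1) ^ i * ([:a:] + (monom 1 m' - 1) * B)"
    using ex_low_order_combination[OF p C, of "monom 1 m' - 1"] by blast
  then obtain E where "A * C - (monom 1 m' - 1) ^ i * ([:a:] + (monom 1 m' - 1) * B) = of_nat p * E"
    by (auto elim: dvdE)
  then have "ipoly (A * C - (monom 1 m' - 1) ^ i * ([:a:] + (monom 1 m' - 1) * B)) \<zeta> = ipoly (of_nat p * E) \<zeta>"
    by simp
  then have AC: "ipoly A \<zeta> * ipoly C \<zeta> = tau ^ i * (of_int a + tau * ipoly B \<zeta>) + of_nat p * ipoly E \<zeta>"
    using r(1) by (simp add: tau_eq algebra_simps)
  obtain \<upsilon> where \<upsilon>: "\<upsilon> \<in> zring" "of_nat p = tau ^ totient (p ^ r) * \<upsilon>"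
    using tau_power_zdvd_p[OF r(1)] by (auto simp: zdvd_def)
  define e where "e = totient (p ^ r) - Suc i"
  have "totient (p ^ r) = i + 1 + e" using iaAB(1) r(2) by (simp add: e_def)
  then have p_eq: "of_nat p = tau ^ i * tau * (tau ^ e * \<upsilon>)" using \<upsilon>(2) by (simp add: power_add)
  \<comment> \<open>The error term \<open>p E\<close> is absorbed into the coefficient of
    \<open>tau\<close>.\<close>
  define B' where "B' = ipoly B \<zeta> + tau ^ e * \<upsilon> * ipoly E \<zeta>"
  have B': "B' \<in> zring" unfolding B'_def using \<upsilon>(1) by (intro zring_add zring_mult zring_power) auto
  have AC': "ipoly A \<zeta> * ipoly C \<zeta> = tau ^ i * (of_int a + tau * B')"
    unfolding AC p_eq B'_def by (simp add: algebra_simps)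
  have "n \<le> n * t" using t(1) by simp
  then have it: "i < t * n" using iaAB(1) n by (subst mult.commute) linarith
  have "tau ^ (t * n - i) * (ipoly A \<zeta> * \<rho>) = (tau ^ (t * n - i) * tau ^ i) * \<gamma> ^ n * (of_int a + tau * B')"
    unfolding \<rho>_def mult.assoc[symmetric, of "ipoly A \<zeta>"] AC' by (simp add: algebra_simps)
  also have "tau ^ (t * n - i) * tau ^ i = (tau ^ t) ^ n"
    using it by (simp flip: power_add power_mult)
  also have "(tau ^ t) ^ n * \<gamma> ^ n = \<kappa> ^ n" by (simp add: \<kappa>_def power_mult_distrib)
  finally have eq: "of_int a * \<kappa> ^ n = tau ^ (t * n - i) * (ipoly A \<zeta> * \<rho>) - tau * (B' * \<kappa> ^ n)"
    by (simp add: algebra_simps)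
  have "zdvd tau (tau ^ (t * n - i) * (ipoly A \<zeta> * \<rho>))"
  proof (rule zdvd_mult)
    show "zdvd tau (tau ^ (t * n - i))"
      using it by (intro zdvdI[of "tau ^ (t * n - i - 1)"] zring_power) (auto simp: power_eq_if)
  qed (use \<rho> in auto)
  moreover have "zdvd tau (tau * (B' * \<kappa> ^ n))" using B' \<kappa> by (intro zdvd_mult_self) auto
  ultimately have "zdvd tau (of_int a * \<kappa> ^ n)" unfolding eq by (rule zdvd_diff)
  then have "zdvd tau \<kappa>" using tau_zdvd_cancel[OF iaAB(2)] \<kappa> by blast
  then show False using t by (simp add: \<kappa>_def)
qed

end

lemma exponential_beats_power:
  fixes c A :: real
  assumes "c > 1" "B > 0"
  obtains k :: nat where "k > 0" "A * real k ^ B < c ^ k"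
proof -
  define w where "w = root B (1 / c)"
  have w: "0 \<le> w" "w < 1" "w ^ B = 1 / c"
    using assms by (simp_all add: w_def real_root_lt_1_iff)
  have "(\<lambda>k. of_nat k * w ^ k) \<longlonglongrightarrow> 0" using w by (intro powser_times_n_limit_0) auto
  then have "(\<lambda>k. A * (of_nat k * w ^ k) ^ B) \<longlonglongrightarrow> A * 0 ^ B" by (intro tendsto_intros)
  then have "(\<lambda>k. A * (of_nat k * w ^ k) ^ B) \<longlonglongrightarrow> 0" using assms(2) by (simp add: power_0_left)
  then have "eventually (\<lambda>k. A * (of_nat k * w ^ k) ^ B < 1) sequentially"
    by (rule order_tendstoD) simp
  then have "eventually (\<lambda>k. A * (of_nat k * w ^ k) ^ B < 1 \<and> k > 0) sequentially"
    using eventually_gt_at_top[of "0::nat"] by (rule eventually_conj)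
  then obtain k where k: "A * (of_nat k * w ^ k) ^ B < 1" "k > 0"
    by (auto simp: eventually_sequentially)
  have "(w ^ k) ^ B = (w ^ B) ^ k" by (simp flip: power_mult add: mult.commute)
  also have "\<dots> = 1 / c ^ k" by (simp add: w(3) power_one_over)
  finally have "A * real k ^ B * (1 / c ^ k) < 1" using k(1) by (simp add: power_mult_distrib mult.assoc)
  then have "A * real k ^ B < c ^ k" using assms(1) by (simp add: pos_divide_less_eq)
  then show thesis using k(2) that by blast
qed

context nonintegral
begin

text \<open>The sums \<open>\<Sum>\<^sub>j \<zeta>^(i\<^sub>j) \<beta>^j\<close> with \<open>i\<^sub>j < m'\<close> are pairwise distinct since \<open>\<beta>\<close> is not integral at \<open>p\<close>,
  while \<open>C1 \<beta>^n = - C2\<close> bounds their common denominator.\<close>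

lemma residue_order_bound:
  assumes nz: "ipoly C1 \<zeta> \<noteq> 0" "ipoly F2 \<zeta> \<noteq> 0"
    and \<gamma>: "\<gamma> = of_nat b * (ipoly F1 \<zeta> / ipoly F2 \<zeta>)"
    and H: "H \<ge> 1"
    and bound: "\<And>P k. P \<in> {C1, C2, F1, F2} \<Longrightarrow> norm (ipoly P (\<zeta> ^ k)) \<le> H"
    and eq: "ipoly C1 \<zeta> * ipoly F1 \<zeta> ^ n + ipoly C2 \<zeta> * ipoly F2 \<zeta> ^ n = 0"
    and n: "n > 0"
  shows "real m' ^ n \<le> H ^ (2 * totient m)"
proof (rule ccontr)
  assume contr: "\<not> real m' ^ n \<le> H ^ (2 * totient m)"
  define \<beta> where "\<beta> = ipoly F1 \<zeta> / ipoly F2 \<zeta>"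
  have F1: "ipoly F1 \<zeta> = \<beta> * ipoly F2 \<zeta>" using nz by (simp add: \<beta>_def)
  have "ipoly F2 \<zeta> ^ n * (ipoly C1 \<zeta> * \<beta> ^ n + ipoly C2 \<zeta>) = 0"
    using eq by (simp add: F1 power_mult_distrib algebra_simps)
  then have C2: "- ipoly C2 \<zeta> = ipoly C1 \<zeta> * \<beta> ^ n" using nz by (simp add: neg_eq_iff_add_eq_0 add.commute)
  \<comment> \<open>At \<open>\<zeta>\<close> this is \<open>C1^k F2^n \<beta>^j\<close>. Each full
    \<open>\<beta>^n\<close> is traded for \<open>- C2 / C1\<close>, so fewer than \<open>n\<close>
    factors \<open>F1\<close> remain and the size is \<open>H^(k+n)\<close> at all
    conjugates.\<close>
  define E where "E k j = C1 ^ (k - j div n) * (- C2) ^ (j div n) * F1 ^ (j mod n) * F2 ^ (n - j mod n)" for k j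
  have E_zeta: "ipoly (E k j) \<zeta> = ipoly C1 \<zeta> ^ k * ipoly F2 \<zeta> ^ n * \<beta> ^ j" if "j < k * n" for k j
  proof -
    have "j div n < k" using that n by (simp add: div_less_iff_less_mult)
    then have C1: "ipoly C1 \<zeta> ^ (k - j div n) * ipoly C1 \<zeta> ^ (j div n) = ipoly C1 \<zeta> ^ k"
      by (simp flip: power_add)
    have "j mod n < n" using n by simp
    then have F2: "ipoly F2 \<zeta> ^ (j mod n) * ipoly F2 \<zeta> ^ (n - j mod n) = ipoly F2 \<zeta> ^ n"
      by (simp flip: power_add)
    have \<beta>: "(\<beta> ^ n) ^ (j div n) * \<beta> ^ (j mod n) = \<beta> ^ j" by (simp flip: power_mult power_add)
    have "ipoly (E k j) \<zeta> = (ipoly C1 \<zeta> ^ (k - j div n) * ipoly C1 \<zeta> ^ (j div n))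
        * (ipoly F2 \<zeta> ^ (j mod n) * ipoly F2 \<zeta> ^ (n - j mod n)) * ((\<beta> ^ n) ^ (j div n) * \<beta> ^ (j mod n))"
      by (simp add: E_def C2 F1 power_mult_distrib mult_ac)
    then show ?thesis by (simp only: C1 F2 \<beta>)
  qed
  have E_bound: "norm (ipoly (E k j) (\<zeta> ^ i)) \<le> H ^ (k + n)" if "j < k * n" for k j i
  proof -
    have j: "j div n < k" "j mod n < n" using that n by (simp_all add: div_less_iff_less_mult)
    have "norm (ipoly (E k j) (\<zeta> ^ i)) = norm (ipoly C1 (\<zeta> ^ i)) ^ (k - j div n)
      * norm (ipoly C2 (\<zeta> ^ i)) ^ (j div n) * norm (ipoly F1 (\<zeta> ^ i)) ^ (j mod n)
      * norm (ipoly F2 (\<zeta> ^ i)) ^ (n - j mod n)"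
      by (simp add: E_def norm_mult norm_power)
    also have "\<dots> \<le> H ^ (k - j div n) * H ^ (j div n) * H ^ (j mod n) * H ^ (n - j mod n)"
      using bound H by (intro mult_mono power_mono mult_nonneg_nonneg zero_le_power) auto
    also have "\<dots> = H ^ (k + n)" using j by (simp flip: power_add)
    finally show ?thesis .
  qed
  \<comment> \<open>Up to the common factor these are expansions in base \<open>\<beta>\<close> with
    \<open>k n\<close> digits \<open>\<zeta>^(s j)\<close>, chosen from \<open>m'\<close>
    values.\<close>
  define P where "P k s = (\<Sum>j<k * n. monom 1 (s j) * E k j)" for k and s :: "nat \<Rightarrow> nat"
  let ?I = "\<lambda>k. PiE {..<k * n} (\<lambda>_. {..<m'})"
  have inj: "inj_on (\<lambda>s. ipoly (P k s) \<zeta>) (?I k)" for k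
  proof (rule inj_onI, rule ccontr)
    fix s u assume su: "s \<in> ?I k" "u \<in> ?I k" "ipoly (P k s) \<zeta> = ipoly (P k u) \<zeta>" "s \<noteq> u"
    define N where "N = k * n"
    have "ipoly (P k v) \<zeta> = ipoly C1 \<zeta> ^ k * ipoly F2 \<zeta> ^ n * (\<Sum>j<N. \<zeta> ^ v j * \<beta> ^ j)" for v
      unfolding sum_distrib_left P_def ipoly_sum N_def by (rule sum.cong) (auto simp: E_zeta)
    then have sum: "(\<Sum>j<N. \<zeta> ^ s j * \<beta> ^ j) = (\<Sum>j<N. \<zeta> ^ u j * \<beta> ^ j)"
      using su(3) nz by simp
    \<comment> \<open>The last index at which the digits differ carries the leading coefficient of
      the difference, a difference of roots of unity prime to \<open>p\<close>.\<close>
    define J where "J = Max {j. j < N \<and> s j \<noteq> u j}"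
    have "\<exists>j<N. s j \<noteq> u j" using su(1,2,4) unfolding N_def by (metis PiE_ext lessThan_iff)
    then have "J \<in> {j. j < N \<and> s j \<noteq> u j}" unfolding J_def by (intro Max_in) auto
    then have J: "J < N" "s J \<noteq> u J" by auto
    have above: "s j = u j" if "J < j" "j < N" for j
    proof (rule ccontr)
      assume "s j \<noteq> u j"
      then have "j \<le> J" unfolding J_def using that by (intro Max_ge) auto
      then show False using that by simp
    qed
    have "(\<Sum>j\<le>J. (\<zeta> ^ s j - \<zeta> ^ u j) * \<beta> ^ j) = (\<Sum>j<N. (\<zeta> ^ s j - \<zeta> ^ u j) * \<beta> ^ j)"
      using J(1) above by (intro sum.mono_neutral_left) auto
    also have "\<dots> = 0" using sum by (simp add: left_diff_distrib sum_subtractf)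
    finally have rel: "(\<Sum>j\<le>J. (\<zeta> ^ s j - \<zeta> ^ u j) * \<beta> ^ j) = 0" .
    \<comment> \<open>Powers of \<open>b\<close> turn the relation in \<open>\<beta>\<close> into
      one in \<open>\<gamma> = b \<beta>\<close> and leave the leading coefficient as it is.\<close>
    define \<delta> where "\<delta> j = (\<zeta> ^ s j - \<zeta> ^ u j) * of_nat b ^ (J - j)" for j
    have "(\<Sum>j\<le>J. \<delta> j * \<gamma> ^ j) = of_nat b ^ J * (\<Sum>j\<le>J. (\<zeta> ^ s j - \<zeta> ^ u j) * \<beta> ^ j)"
      unfolding sum_distrib_left
    proof (rule sum.cong)
      fix j assume "j \<in> {..J}"
      then have "of_nat b ^ J = (of_nat b ^ (J - j) * of_nat b ^ j :: complex)"
        by (simp flip: power_add)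
      then show "\<delta> j * \<gamma> ^ j = of_nat b ^ J * ((\<zeta> ^ s j - \<zeta> ^ u j) * \<beta> ^ j)"
        by (simp add: \<delta>_def \<gamma> \<beta>_def[symmetric] power_mult_distrib)
    qed simp
    then have "(\<Sum>j\<le>J. \<delta> j * \<gamma> ^ j) = 0" using rel by simp
    moreover have "\<delta> j \<in> zring" for j
      unfolding \<delta>_def by (intro zring_mult zring_diff zring_power) auto
    moreover obtain l where "zdvd (\<delta> J) (of_int l)" "\<not> int p dvd l"
    proof -
      have lt: "s J < m'" "u J < m'"
        using PiE_mem[OF su(1)] PiE_mem[OF su(2)] J(1) by (auto simp: N_def)
      have \<delta>J: "\<delta> J = \<zeta> ^ s J - \<zeta> ^ u J" by (simp add: \<delta>_def)
      show thesis
      proof (cases "u J < s J")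
        case True
        then show thesis using root_difference_zdvd[OF True lt(1)] that \<delta>J by metis
      next
        case False
        then have "s J < u J" using J(2) by simp
        then obtain l where l: "zdvd (\<zeta> ^ u J - \<zeta> ^ s J) (of_int l)" "\<not> int p dvd l"
          using root_difference_zdvd lt(2) by metis
        then obtain y where "y \<in> zring" "of_int l = (\<zeta> ^ u J - \<zeta> ^ s J) * y" by (auto simp: zdvd_def)
        then have "zdvd (\<delta> J) (of_int l)"
          by (intro zdvdI[of "- y"] zring_uminus) (auto simp: \<delta>J algebra_simps)
        then show thesis using l(2) that by blast
      qed
    qed
    ultimately show False using no_relation by blast
  qed
  have count: "(real m' ^ n) ^ k \<le> (4 * (k * n * H ^ (k + n)) + 2) ^ (2 * totient m)" for k
  proof -
    have "real (card (?I k)) \<le> (4 * (real (k * n) * H ^ (k + n)) + 2) ^ (2 * totient m)"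
    proof (rule card_bounded_family[OF _ inj])
      fix s i
      have "norm (ipoly (P k s) (\<zeta> ^ i)) \<le> (\<Sum>j<k * n. norm (ipoly (monom 1 (s j) * E k j) (\<zeta> ^ i)))"
        unfolding P_def ipoly_sum by (rule norm_sum)
      also have "\<dots> \<le> (\<Sum>j<k * n. H ^ (k + n))"
        using E_bound by (intro sum_mono) (simp add: norm_mult norm_power)
      finally show "norm (ipoly (P k s) (\<zeta> ^ i)) \<le> real (k * n) * H ^ (k + n)" by simp
    qed (use H in \<open>auto intro: finite_PiE\<close>)
    then show ?thesis by (simp add: card_PiE mult.commute flip: power_mult)
  qed
  \<comment> \<open>As \<open>k\<close> grows, the loss that is polynomial in \<open>k\<close>
    cannot make up for \<open>(x / y)^k\<close> if \<open>x > y\<close>; this removes all constants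
    from the count.\<close>
  define x y where "x = real m' ^ n" and "y = H ^ (2 * totient m)"
  have "y \<ge> 1" using H by (simp add: y_def)
  then have "x / y > 1" using contr by (simp add: x_def y_def)
  moreover have "2 * totient m > 0" using m_pos by simp
  ultimately obtain k where k: "k > 0"
      "(6 * n * H ^ n) ^ (2 * totient m) * real k ^ (2 * totient m) < (x / y) ^ k"
    by (rule exponential_beats_power)
  have "1 * 1 \<le> real (k * n) * H ^ (k + n)"
    using k(1) n H by (intro mult_mono) (auto simp: Suc_le_eq simp flip: of_nat_mult)
  then have "(4 * (k * n * H ^ (k + n)) + 2) ^ (2 * totient m) \<le> (6 * (k * n * H ^ (k + n))) ^ (2 * totient m)"
    using H by (intro power_mono) auto
  then have "x ^ k \<le> (6 * (k * n * H ^ (k + n))) ^ (2 * totient m)"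
    using count[of k] unfolding x_def by linarith
  also have "\<dots> = (6 * n * H ^ n) ^ (2 * totient m) * real k ^ (2 * totient m) * y ^ k"
    unfolding y_def by (simp add: power_mult_distrib power_add mult_ac flip: power_mult)
  also have "\<dots> < (x / y) ^ k * y ^ k"
    using k(2) \<open>y \<ge> 1\<close> by (intro mult_strict_right_mono) auto
  also have "\<dots> = x ^ k" using \<open>y \<ge> 1\<close> by (simp add: power_divide)
  finally show False by simp
qed

end

context primitive_root
begin

text \<open>The norm of \<open>y\<close> is a nonzero integer and a multiple of \<open>y\<close>,
  with the product of the other conjugates as cofactor.\<close>

lemma ex_denominator:
  assumes "y \<in> zring" "y \<noteq> 0" "x \<in> zring"
  obtains b :: nat where "b > 0" "of_nat b * (x / y) \<in> zring"
proof -
  obtain P where P: "y = ipoly P \<zeta>" using assms(1) by (rule zringE)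
  obtain N :: int where N: "(\<Prod>k\<in>totatives m. ipoly P (\<zeta> ^ k)) = of_int N" by (rule norm_integer)
  have "N \<noteq> 0"
  proof
    assume "N = 0"
    then have "(\<Prod>k\<in>totatives m. ipoly P (\<zeta> ^ k)) = 0" using N by simp
    then show False using assms(2) by (auto simp: P in_totatives_iff conjugate_root_iff)
  qed
  define Q where "Q = (\<Prod>k\<in>totatives m - {1}. pcompose P (monom 1 k))"
  have "1 \<in> totatives m" using m_pos by simp
  then have "(\<Prod>k\<in>totatives m. ipoly P (\<zeta> ^ k)) = y * ipoly Q \<zeta>"
    by (simp add: prod.remove[of _ 1] Q_def P)
  then have yQ: "y * ipoly Q \<zeta> = of_int N" using N by simp
  have "of_int N * (x / y) = x * ipoly Q \<zeta>"
    using assms(2) yQ[symmetric] by simp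
  then have "of_int N * (x / y) \<in> zring" using assms(3) by auto
  then have "of_int \<bar>N\<bar> * (x / y) \<in> zring"
    using zring_uminus[of "of_int N * (x / y)"] by (cases "N \<ge> 0") simp_all
  then have "of_nat (nat \<bar>N\<bar>) * (x / y) \<in> zring" by (simp only: of_nat_nat abs_ge_zero)
  then show thesis using \<open>N \<noteq> 0\<close> by (intro that[of "nat \<bar>N\<bar>"]) auto
qed

subsection \<open>Elements all of whose conjugates lie on the unit circle\<close>

text \<open>Kronecker's theorem: all powers have conjugates of absolute value 1, so only finitely
  many are distinct and two of them coincide.\<close>

lemma root_of_unity_if_conjugates_norm_1:
  assumes "\<And>k. k \<in> totatives m \<Longrightarrow> norm (ipoly P (\<zeta> ^ k)) = 1"
  obtains N where "N > 0" "ipoly P \<zeta> ^ N = 1"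
proof -
  obtain L :: nat where L: "(4 * 1 + 2) ^ (2 * totient m) < real L" using reals_Archimedean2 by blast
  have "\<not> inj_on (\<lambda>i. ipoly (P ^ i) \<zeta>) {..<L}"
  proof
    assume "inj_on (\<lambda>i. ipoly (P ^ i) \<zeta>) {..<L}"
    then have "real (card {..<L}) \<le> (4 * 1 + 2) ^ (2 * totient m)"
      using assms by (intro card_bounded_family[where P = "\<lambda>i. P ^ i"]) (auto simp: norm_power)
    then show False using L by simp
  qed
  then obtain i j where "ipoly P \<zeta> ^ i = ipoly P \<zeta> ^ j" "i \<noteq> j" by (auto simp: inj_on_def)
  then obtain i j where ij: "ipoly P \<zeta> ^ i = ipoly P \<zeta> ^ j" "i < j" by (metis linorder_neqE_nat)
  have "norm (ipoly P \<zeta>) = 1" using assms[of 1] m_pos by simp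
  then have "ipoly P \<zeta> \<noteq> 0" by auto
  moreover have "ipoly P \<zeta> ^ j = ipoly P \<zeta> ^ i * ipoly P \<zeta> ^ (j - i)"
    using ij(2) by (simp flip: power_add)
  ultimately have "ipoly P \<zeta> ^ (j - i) = 1" using ij(1) by simp
  then show thesis using ij(2) by (intro that[of "j - i"]) auto
qed

text \<open>The group generated by \<open>\<zeta>\<close> and \<open>\<beta>\<close> is finite,
  hence consists of all \<open>M\<close>-th roots of unity, with \<open>m\<close> dividing
  \<open>M\<close>. A primitive one lies in \<int>[\<zeta>], which forces
  \<open>totient M <= totient m\<close>.\<close>

lemma order_of_generated_group:
  assumes N: "N > 0" "ipoly P \<zeta> ^ N = 1"
  obtains M where "M > 0" "M \<le> 2 * m" "\<And>s t. (\<zeta> ^ s * ipoly P \<zeta> ^ t) ^ M = 1"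
proof -
  define \<beta> where "\<beta> = ipoly P \<zeta>"
  have \<beta>N: "\<beta> ^ N = 1" using N by (simp add: \<beta>_def)
  then have "\<beta> \<noteq> 0" using N(1) by (auto simp: power_0_left)
  define G where "G = (\<lambda>(s, t). \<zeta> ^ s * \<beta> ^ t) ` ({..<m} \<times> {..<N})"
  have in_G: "\<zeta> ^ s * \<beta> ^ t \<in> G" for s t
  proof -
    have "\<beta> ^ t = \<beta> ^ (N * (t div N) + t mod N)" by simp
    also have "\<dots> = \<beta> ^ (t mod N)" by (simp only: power_add power_mult \<beta>N) simp
    finally have "\<zeta> ^ s * \<beta> ^ t = \<zeta> ^ (s mod m) * \<beta> ^ (t mod N)" by (simp add: zeta_power_mod)
    then show ?thesis unfolding G_def using m_pos N(1) by (intro image_eqI[of _ _ "(s mod m, t mod N)"]) auto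
  qed
  have G_elem: "\<exists>s t. z = \<zeta> ^ s * \<beta> ^ t" if "z \<in> G" for z using that by (auto simp: G_def)
  have G_mult: "z * w \<in> G" if "z \<in> G" "w \<in> G" for z w
  proof -
    obtain s t s' t' where "z = \<zeta> ^ s * \<beta> ^ t" "w = \<zeta> ^ s' * \<beta> ^ t'" using G_elem \<open>z \<in> G\<close> \<open>w \<in> G\<close> by blast
    then have "z * w = \<zeta> ^ (s + s') * \<beta> ^ (t + t')" by (simp add: power_add)
    then show ?thesis using in_G by simp
  qed
  have nz: "z \<noteq> 0" if "z \<in> G" for z using G_elem[OF that] \<open>\<beta> \<noteq> 0\<close> by auto
  have fin: "finite G" by (simp add: G_def)
  define M where "M = card G"
  have "M > 0" using in_G[of 0 0] fin by (auto simp: M_def card_gt_0_iff)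
  have GM: "z ^ M = 1" if z: "z \<in> G" for z
  proof -
    \<comment> \<open>Multiplication by \<open>z\<close> permutes \<open>G\<close>; comparing the
      products over \<open>G\<close> gives \<open>z^M = 1\<close>.\<close>
    have "inj_on ((*) z) G" using nz[OF z] by (auto simp: inj_on_def)
    moreover have "(*) z ` G \<subseteq> G" using G_mult[OF z] by auto
    ultimately have "bij_betw ((*) z) G G" using fin by (simp add: bij_betw_def endo_inj_surj)
    then have "(\<Prod>w\<in>G. z * w) = (\<Prod>w\<in>G. w)" by (rule prod.reindex_bij_betw)
    moreover have "(\<Prod>w\<in>G. z * w) = z ^ M * (\<Prod>w\<in>G. w)" by (simp add: prod.distrib M_def)
    moreover have "(\<Prod>w\<in>G. w) \<noteq> 0" using nz fin by auto
    ultimately show ?thesis by simp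
  qed
  have "G \<subseteq> {z. z ^ M = 1}" using GM by blast
  then have G_eq: "G = {z. z ^ M = 1}"
    using \<open>M > 0\<close> card_roots_unity_eq[of M]
    by (intro card_subset_eq) (auto simp: M_def intro: finite_roots_unity)
  define \<omega> where "\<omega> = cis (2 * pi / M)"
  have \<omega>_power: "\<omega> ^ k = cis (2 * pi * k / M)" for k
    by (simp add: \<omega>_def DeMoivre mult_ac)
  have bij: "bij_betw (\<lambda>k. \<omega> ^ k) {..<M} {z. z ^ M = 1}"
    unfolding \<omega>_power using bij_betw_roots_unity[OF \<open>M > 0\<close>] by simp
  have "\<omega> ^ M = 1" unfolding \<omega>_power using \<open>M > 0\<close> by simp
  moreover have "\<omega> ^ k \<noteq> 1" if "0 < k" "k < M" for k
  proof
    assume "\<omega> ^ k = 1"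
    then have "\<omega> ^ k = \<omega> ^ 0" by simp
    then have "k = 0" using bij that by (auto simp: bij_betw_def inj_on_def)
    then show False using that by simp
  qed
  ultimately interpret w: primitive_root M \<omega>
    using \<open>M > 0\<close> by unfold_locales (auto simp: primitive_root_of_unity_def)
  have "\<omega> \<in> G" using \<open>\<omega> ^ M = 1\<close> by (simp add: G_eq)
  then obtain s t where "\<omega> = \<zeta> ^ s * \<beta> ^ t" using G_elem by blast
  then obtain W where W: "\<omega> = ipoly W \<zeta>"
    using that[of "monom 1 s * P ^ t"] by (metis \<beta>_def ipoly_monom ipoly_mult ipoly_power mult_1 of_int_1)
  have "\<zeta> \<in> G" using in_G[of 1 0] by simp
  then have "\<zeta> ^ M = 1" by (rule GM)
  then obtain c where c: "M = m * c" by (auto simp: zeta_power_eq_1_iff)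
  have "\<zeta> \<in> (\<lambda>k. \<omega> ^ k) ` {..<M}" using bij \<open>\<zeta> ^ M = 1\<close> by (auto simp: bij_betw_def)
  then obtain j where j: "\<zeta> = \<omega> ^ j" by blast
  have Wk: "ipoly W (\<zeta> ^ k) = \<omega> ^ k" if "coprime k M" for k
  proof -
    have "ipoly (pcompose W (monom 1 j) - monom 1 1) \<omega> = 0" using W j by simp
    then have "ipoly (pcompose W (monom 1 j) - monom 1 1) (\<omega> ^ k) = 0" using that by (rule w.conjugate_root[rotated])
    then show ?thesis by (simp add: j mult.commute flip: power_mult)
  qed
  \<comment> \<open>\<open>\<zeta>^k\<close> determines \<open>\<omega>^k = W(\<zeta>^k)\<close>, so
    distinct totatives of \<open>M\<close> give distinct conjugates of
    \<open>\<zeta>\<close>.\<close>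
  have "inj_on (\<lambda>k. \<zeta> ^ k) (totatives M)"
  proof (rule inj_onI)
    fix k l assume kl: "k \<in> totatives M" "l \<in> totatives M" "\<zeta> ^ k = \<zeta> ^ l"
    then have "\<omega> ^ k = \<omega> ^ l" using Wk[of k] Wk[of l] by (simp add: in_totatives_iff)
    then show "k = l" using kl(1,2) w.inj_on_totatives by (simp add: inj_on_def)
  qed
  moreover have "(\<lambda>k. \<zeta> ^ k) ` totatives M \<subseteq> (\<lambda>k. \<zeta> ^ k) ` totatives m"
  proof (rule image_subsetI)
    fix k assume "k \<in> totatives M"
    then have "coprime k m" by (simp add: in_totatives_iff c)
    then show "\<zeta> ^ k \<in> (\<lambda>k. \<zeta> ^ k) ` totatives m" by (intro minp_roots conjugate_root) auto
  qed
  ultimately have "card (totatives M) \<le> card ((\<lambda>k. \<zeta> ^ k) ` totatives m)"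
    by (intro card_inj_on_le) auto
  then have le: "totient M \<le> totient m" by (simp add: card_conjugates totient_def)
  \<comment> \<open>\<open>totient m * totient c <= totient (m c)\<close>, which exceeds
    \<open>totient m\<close> once \<open>c > 2\<close>.\<close>
  have "c \<le> 2"
  proof (rule ccontr)
    assume "\<not> c \<le> 2"
    then have "totient c > 1" by (intro totient_gt_1) auto
    have "gcd m c > 0" using m_pos by simp
    have "totient m * totient c * gcd m c = totient M * totient (gcd m c)"
      unfolding c by (rule totient_gcd[symmetric])
    also have "\<dots> \<le> totient m * gcd m c" using le totient_le by (rule mult_le_mono)
    finally have "totient m * totient c \<le> totient m * 1" using \<open>gcd m c > 0\<close> by simp
    then show False using \<open>totient c > 1\<close> m_pos by simp
  qed
  then have "M \<le> 2 * m" by (simp add: c mult.commute)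
  then show thesis using GM in_G \<open>M > 0\<close> that unfolding \<beta>_def by blast
qed

text \<open>The \<open>S^2 > 2 m\<close> products \<open>\<zeta>^s \<beta>^t\<close> cannot all be
  distinct, so \<open>\<zeta>^s \<beta>^T = \<zeta>^s'\<close> with \<open>0 < T < S\<close>.
  Substituting \<open>P / Q\<close> for \<open>\<beta>\<close> yields an integer polynomial that
  vanishes at \<open>\<zeta>\<close> and has degree below \<open>totient m\<close>, hence is
  0.\<close>

lemma monomial_ratio:
  assumes norm_1: "\<And>k. k \<in> totatives m \<Longrightarrow> norm (ipoly B (\<zeta> ^ k)) = 1"
    and PQ: "ipoly P \<zeta> = ipoly B \<zeta> * ipoly Q \<zeta>"
    and deg: "degree P \<le> D" "degree Q \<le> D"
    and S: "2 * m < S\<^sup>2" "S \<le> m"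
    and large: "S * (D + 1) < totient m"
  obtains T s s' where "T > 0" "monom 1 s * P ^ T = monom 1 s' * Q ^ T"
proof -
  define \<beta> where "\<beta> = ipoly B \<zeta>"
  have "norm \<beta> = 1" using norm_1[of 1] m_pos by (simp add: \<beta>_def)
  then have "\<beta> \<noteq> 0" by auto
  obtain N where "N > 0" "\<beta> ^ N = 1"
    using root_of_unity_if_conjugates_norm_1[OF norm_1] unfolding \<beta>_def by blast
  then obtain M where M: "M > 0" "M \<le> 2 * m" "\<And>s t. (\<zeta> ^ s * \<beta> ^ t) ^ M = 1"
    unfolding \<beta>_def using order_of_generated_group by blast
  define f where "f = (\<lambda>(s, t). \<zeta> ^ s * \<beta> ^ t)"
  have "\<not> inj_on f ({..<S} \<times> {..<S})"
  proof
    assume "inj_on f ({..<S} \<times> {..<S})"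
    moreover have "f ` ({..<S} \<times> {..<S}) \<subseteq> {z. z ^ M = 1}" using M(3) by (auto simp: f_def)
    ultimately have "card ({..<S} \<times> {..<S}) \<le> card {z::complex. z ^ M = 1}"
      using M(1) by (intro card_inj_on_le) (auto intro: finite_roots_unity)
    then show False using S(1) M by (simp add: card_roots_unity_eq power2_eq_square)
  qed
  then obtain s t s' t' where st: "s < S" "t < S" "s' < S" "t' < S" "(s, t) \<noteq> (s', t')"
      "\<zeta> ^ s * \<beta> ^ t = \<zeta> ^ s' * \<beta> ^ t'"
    by (auto simp: inj_on_def f_def)
  \<comment> \<open>Exponents below \<open>S <= m\<close> are determined by the power of
    \<open>\<zeta>\<close>, so \<open>t = t'\<close> would entail \<open>s = s'\<close>.\<close>
  have "t \<noteq> t'"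
  proof
    assume "t = t'"
    then have "\<zeta> ^ s = \<zeta> ^ s'" using st(6) \<open>\<beta> \<noteq> 0\<close> by simp
    then have "s mod m = s' mod m" by (simp add: zeta_power_eq_iff)
    then show False using st S(2) \<open>t = t'\<close> by simp
  qed
  have "\<exists>s t s' t'. s < S \<and> t < S \<and> s' < S \<and> t' < t \<and> \<zeta> ^ s * \<beta> ^ t = \<zeta> ^ s' * \<beta> ^ t'"
  proof (cases "t' < t")
    case False
    then have "t < t'" using \<open>t \<noteq> t'\<close> by simp
    then show ?thesis using st(1,3,4) st(6)[symmetric] by blast
  qed (use st in blast)
  then obtain s t s' t' where st: "s < S" "t < S" "s' < S" "t' < t" "\<zeta> ^ s * \<beta> ^ t = \<zeta> ^ s' * \<beta> ^ t'"
    by blast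
  define T where "T = t - t'"
  have T: "T > 0" "T < S" using st by (auto simp: T_def)
  have "\<beta> ^ t = \<beta> ^ T * \<beta> ^ t'" using st by (simp add: T_def flip: power_add)
  then have rel: "\<zeta> ^ s * \<beta> ^ T = \<zeta> ^ s'" using st(5) \<open>\<beta> \<noteq> 0\<close> by simp
  define V where "V = monom 1 s * P ^ T - monom 1 s' * Q ^ T"
  have "ipoly V \<zeta> = (\<zeta> ^ s * \<beta> ^ T) * ipoly Q \<zeta> ^ T - \<zeta> ^ s' * ipoly Q \<zeta> ^ T"
    by (simp add: V_def PQ \<beta>_def power_mult_distrib mult_ac)
  then have "ipoly V \<zeta> = 0" by (simp add: rel)
  have deg_le: "degree (monom 1 a * R ^ T) \<le> S * (D + 1)" if "a < S" "degree R \<le> D" for a and R :: "int poly"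
  proof -
    have "degree (monom 1 a * R ^ T) \<le> a + degree R * T"
      by (rule order_trans[OF degree_mult_le]) (intro add_mono degree_power_le degree_monom_le)
    also have "\<dots> \<le> S + D * S" using that T by (intro add_mono mult_le_mono) auto
    finally show ?thesis by (simp add: algebra_simps)
  qed
  have "degree V \<le> S * (D + 1)" unfolding V_def using deg_le st deg by (intro degree_diff_le) auto
  then have "V = 0" using totient_le_degree[OF _ \<open>ipoly V \<zeta> = 0\<close>] large by fastforce
  then show thesis using T(1) that by (simp add: V_def)
qed

end

text \<open>Split off the powers of \<open>x\<close>. Comparing orders at 0 leaves
  \<open>f1^T = g1^T\<close>, so \<open>g1 = k f1\<close> with \<open>k^T = 1\<close>, and such a
  rational polynomial \<open>k\<close> is 1 or -1.\<close>

lemma monomial_ratio_rat: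
  fixes f g :: "rat poly"
  assumes nz: "f \<noteq> 0" "g \<noteq> 0" and T: "T > 0" and eq: "monom 1 s * f ^ T = monom 1 s' * g ^ T"
  obtains b :: int and \<epsilon> :: "rat poly fract" where "\<epsilon> \<in> {1, -1}"
    "to_fract g / to_fract f = \<epsilon> * to_fract [:0, 1:] powi b"
proof -
  let ?X = "[:0, 1:] :: rat poly"
  define i j where "i = order 0 f" and "j = order 0 g"
  obtain f1 where f1: "f = ?X ^ i * f1" "\<not> ?X dvd f1" using order_decomp[OF nz(1), of 0] by (auto simp: i_def)
  obtain g1 where g1: "g = ?X ^ j * g1" "\<not> ?X dvd g1" using order_decomp[OF nz(2), of 0] by (auto simp: j_def)
  have nz1: "f1 \<noteq> 0" "g1 \<noteq> 0" using f1(2) g1(2) by auto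
  have monom: "monom 1 k = ?X ^ k" for k by (simp add: monom_altdef)
  have eq1: "?X ^ (s + i * T) * f1 ^ T = ?X ^ (s' + j * T) * g1 ^ T"
    using eq unfolding monom f1 g1 by (simp add: power_mult_distrib power_add mult_ac flip: power_mult)
  have ord: "order 0 (?X ^ k * h ^ T) = k" if "\<not> ?X dvd h" for k h
  proof -
    have h: "poly h 0 \<noteq> 0" using that by (simp add: poly_eq_0_iff_dvd)
    then have "poly (h ^ T) 0 \<noteq> 0" "h \<noteq> 0" by auto
    then show ?thesis
      using order_power_n_n[of 0 k] by (subst order_mult) (auto simp: order_root order_0I)
  qed
  have e: "s + i * T = s' + j * T" using ord[OF f1(2)] ord[OF g1(2)] eq1 by metis
  then have "f1 ^ T = g1 ^ T" using eq1 by simp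
  then have "f1 ^ T dvd g1 ^ T" by simp
  then have "f1 dvd g1" using T by (simp add: pow_divides_pow_iff)
  then obtain k where k: "g1 = f1 * k" by (rule dvdE)
  have "k ^ T = 1" using \<open>f1 ^ T = g1 ^ T\<close> nz1 by (simp add: k power_mult_distrib)
  have "k \<noteq> 0" using nz1 k by auto
  have "degree (k ^ T) = 0" using \<open>k ^ T = 1\<close> by simp
  then have "degree k = 0" using T \<open>k \<noteq> 0\<close> by (simp add: degree_power_eq)
  then obtain c where c: "k = [:c:]" by (rule degree_eq_zeroE)
  have "c ^ T = 1" using \<open>k ^ T = 1\<close> by (simp add: c poly_const_pow one_pCons)
  then have "\<bar>c\<bar> ^ T = 1 ^ T" by (simp flip: power_abs)
  then have "\<bar>c\<bar> = 1" using T by (intro power_eq_imp_eq_base[of "\<bar>c\<bar>" T 1]) auto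
  then have "c = 1 \<or> c = -1" by linarith
  then have "to_fract k \<in> {1, -1}"
    by (auto simp: c one_pCons[symmetric]) (metis minus_pCons minus_zero one_pCons to_fract_1 to_fract_uminus)
  moreover have "to_fract g / to_fract f = to_fract k * to_fract ?X powi (int j - int i)"
  proof -
    have X0: "to_fract ?X \<noteq> 0" by simp
    have f10: "to_fract f1 \<noteq> 0" using nz1 by simp
    have pw: "to_fract (q ^ a) = to_fract q ^ a" for q :: "rat poly" and a by (induction a) auto
    have "to_fract ?X powi (int j - int i) = to_fract ?X ^ j / to_fract ?X ^ i"
      using X0 by (simp add: power_int_diff)
    then show ?thesis unfolding f1 g1 k to_fract_mult pw using X0 f10 by (simp add: field_simps)
  qed
  ultimately show thesis using that by blast
qed

section \<open>Height bounds\<close>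

text \<open>One common factor \<open>\<mu>\<close> makes the joint coefficient vector integral and
  primitive. Its largest absolute value is then the exponential of the height, and no prime divides
  all entries.\<close>

lemma ex_primitive_integer_polys:
  assumes "c1 \<noteq> (0 :: rat poly)"
  obtains \<mu> C1 C2 where "\<mu> \<noteq> 0" "map_poly of_int C1 = smult \<mu> c1" "map_poly of_int C2 = smult \<mu> c2"
    "\<And>i. real_of_int \<bar>coeff C1 i\<bar> \<le> exp (poly_height [c1, c2])"
    "\<And>i. real_of_int \<bar>coeff C2 i\<bar> \<le> exp (poly_height [c1, c2])"
    "\<And>p. prime p \<Longrightarrow> \<not> (of_nat p dvd C1 \<and> of_nat p dvd C2)"
proof -
  define a where "a = coeffs c1 @ coeffs c2"
  have "lead_coeff c1 \<in> set a" "lead_coeff c1 \<noteq> 0"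
    using assms by (auto simp: a_def coeff_in_coeffs)
  then have nz: "\<exists>x\<in>set a. x \<noteq> 0" by blast
  obtain \<mu> b where b: "\<mu> \<noteq> 0" "primitive_vec b" "map rat_of_int b = map (\<lambda>x. \<mu> * x) a"
    using ex_primitive_multiple[OF nz] by blast
  have height: "poly_height [c1, c2] = ln (real_of_int (Max (abs ` set b)))"
    using vec_height_eq[OF b(2,1,3)] by (simp add: poly_height_def a_def primitive_height_def)
  \<comment> \<open>For coefficients \<open>x\<close> of \<open>c1\<close> and \<open>c2\<close> the
    number \<open>\<mu> * x\<close> is already integral, so the floor only changes the type.\<close>
  define I where "I P = map_poly (\<lambda>x. \<lfloor>\<mu> * x\<rfloor>) P" for P
  have coeff_I: "coeff (I P) i = \<lfloor>\<mu> * coeff P i\<rfloor>" for P i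
    by (simp add: I_def coeff_map_poly)
  have sets: "rat_of_int ` set b = (\<lambda>x. \<mu> * x) ` set a" using b(3) by (metis list.set_map)
  have in_b: "\<lfloor>\<mu> * x\<rfloor> \<in> set b \<and> of_int \<lfloor>\<mu> * x\<rfloor> = \<mu> * x" if "x \<in> set a" for x
  proof -
    have "\<mu> * x \<in> rat_of_int ` set b" using that sets by blast
    then show ?thesis by auto
  qed
  have coeff_cases: "x = 0 \<or> x \<in> set a" if "x = coeff P i" "P \<in> {c1, c2}" for x P i
  proof (cases "x = 0")
    case False
    then have "P \<noteq> 0" "i \<le> degree P" using that(1) by (auto intro: le_degree)
    then have "x \<in> set (coeffs P)" unfolding that(1) by (rule coeff_in_coeffs)
    then show ?thesis using that(2) by (auto simp: a_def)
  qed simp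
  have eq: "map_poly of_int (I P) = smult \<mu> P" if "P \<in> {c1, c2}" for P
  proof (rule poly_eqI)
    fix i
    show "coeff (map_poly of_int (I P)) i = coeff (smult \<mu> P) i"
      using coeff_cases[OF refl that, of i] in_b by (auto simp: coeff_map_poly coeff_I)
  qed
  have "set b \<noteq> {}" using sets nz by auto
  have Max_pos: "Max (abs ` set b) > 0"
  proof -
    obtain x where x: "x \<in> set a" "x \<noteq> 0" using nz by blast
    have "\<lfloor>\<mu> * x\<rfloor> \<noteq> 0"
    proof
      assume "\<lfloor>\<mu> * x\<rfloor> = 0"
      then have "\<mu> * x = 0" using conjunct2[OF in_b[OF x(1)]] by (metis of_int_0)
      then show False using b(1) x(2) by simp
    qed
    then have "0 < \<bar>\<lfloor>\<mu> * x\<rfloor>\<bar>" by simp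
    also have "\<dots> \<le> Max (abs ` set b)" using in_b[OF x(1)] by (intro Max_ge) auto
    finally show ?thesis .
  qed
  have bound: "real_of_int \<bar>coeff (I P) i\<bar> \<le> exp (poly_height [c1, c2])" if "P \<in> {c1, c2}" for P i
  proof -
    have "\<bar>coeff (I P) i\<bar> \<le> Max (abs ` set b)"
      using coeff_cases[OF refl that, of i]
    proof
      assume "coeff P i \<in> set a"
      then show ?thesis unfolding coeff_I using in_b by (intro Max_ge) auto
    qed (use Max_pos in \<open>simp add: coeff_I\<close>)
    then show ?thesis using Max_pos by (simp add: height)
  qed
  have prim: "\<not> (of_nat p dvd I c1 \<and> of_nat p dvd I c2)" if p: "prime p" for p :: nat
  proof
    assume "of_nat p dvd I c1 \<and> of_nat p dvd I c2"
    then have dvd: "int p dvd coeff (I P) i" if "P \<in> {c1, c2}" for P i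
      using that by (auto simp: of_nat_poly const_poly_dvd_iff)
    have "int p dvd y" if "y \<in> set b" for y
    proof -
      have "rat_of_int y \<in> (\<lambda>x. \<mu> * x) ` set a" using that sets by blast
      then obtain x where x: "x \<in> set a" "rat_of_int y = \<mu> * x" by blast
      have y: "y = \<lfloor>\<mu> * x\<rfloor>" unfolding x(2)[symmetric] by simp
      obtain P i where "P \<in> {c1, c2}" "x = coeff P i"
        using x(1) by (auto simp: a_def coeffs_def split: if_splits)
      then show ?thesis using dvd[of P i] by (simp add: coeff_I y)
    qed
    then have "int p dvd Gcd (set b)" by (rule Gcd_greatest)
    then have "is_unit (int p)" using b(2) by (simp add: primitive_vec_def)
    then show False using p by (simp add: prime_nat_iff)
  qed
  show thesis by (rule that[of \<mu> "I c1" "I c2"]) (use b(1) eq bound prim in blast)+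
qed

lemma norm_ipoly_le:
  assumes "\<And>i. real_of_int \<bar>coeff P i\<bar> \<le> B" "degree P \<le> D" "norm z = 1"
  shows "norm (ipoly P z) \<le> (real D + 1) * B"
proof -
  have B: "B \<ge> 0" using assms(1)[of 0] by linarith
  have "ipoly P z = (\<Sum>i\<le>degree P. of_int (coeff P i) * z ^ i)"
    by (simp add: ipoly_def poly_altdef coeff_map_poly)
  also have "norm \<dots> \<le> (\<Sum>i\<le>degree P. norm (of_int (coeff P i) * z ^ i))" by (rule norm_sum)
  also have "\<dots> \<le> (\<Sum>i\<le>degree P. B)"
    using assms(1,3) by (intro sum_mono) (simp add: norm_mult norm_power)
  also have "\<dots> = (real (degree P) + 1) * B" by simp
  also have "\<dots> \<le> (real D + 1) * B" using assms(2) B by (intro mult_right_mono) auto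
  finally show ?thesis .
qed

lemma le_totient_square_real:
  assumes "n > 0"
  shows "real n \<le> 3 * real (totient n) ^ 2"
proof -
  have "real n \<le> real (3 * (totient n)\<^sup>2)"
    using le_totient_square[OF assms] by (simp only: of_nat_le_iff)
  then show ?thesis by simp
qed

lemma prime_power_le_totient:
  assumes "prime p" "r > 0"
  shows "p ^ r \<le> 2 * totient (p ^ r)"
proof -
  have "p \<ge> 2" using assms(1) prime_ge_2_nat by blast
  have "p ^ r = p ^ (r - 1) * p" using assms(2) by (metis power_minus_mult)
  also have "\<dots> \<le> p ^ (r - 1) * (2 * (p - 1))" using \<open>p \<ge> 2\<close> by (intro mult_le_mono) auto
  also have "\<dots> = 2 * totient (p ^ r)" using assms by (simp add: totient_prime_power)
  finally show ?thesis .
qed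

section \<open>The bound for integer polynomials\<close>

text \<open>With \<open>\<beta> = F1(\<zeta>) / F2(\<zeta>)\<close>, the exponent
  \<open>10 D\<close> covers all cases: \<open>H^10\<close> if \<open>|\<beta>|\<close> is not 1 or
  if \<open>\<beta>\<close> is integral, and \<open>H^(4 D + 2)\<close> if it is not
  integral.\<close>

lemma (in primitive_root) order_le:
  fixes C1 C2 F1 F2 :: "int poly"
  assumes nz: "C1 \<noteq> 0" "C2 \<noteq> 0" "F1 \<noteq> 0" "F2 \<noteq> 0"
    and deg: "degree C1 \<le> D" "degree C2 \<le> D" "degree F1 \<le> D" "degree F2 \<le> D"
    and H: "H \<ge> 16" "H \<ge> real D + 1"
    and bound: "\<And>P k. P \<in> {C1, C2, F1, F2} \<Longrightarrow> norm (ipoly P (\<zeta> ^ k)) \<le> H"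
    and prim: "\<And>p. prime p \<Longrightarrow> \<not> (of_nat p dvd C1 \<and> of_nat p dvd C2)"
    and n: "n > 0"
    and U: "C1 * F1 ^ n + C2 * F2 ^ n \<noteq> 0" "ipoly (C1 * F1 ^ n + C2 * F2 ^ n) \<zeta> = 0"
    and not_monomial: "\<not> ((\<exists>T s s'. T > 0 \<and> monom 1 s * C2 ^ T = monom 1 s' * C1 ^ T) \<and>
                       (\<exists>T s s'. T > 0 \<and> monom 1 s * F1 ^ T = monom 1 s' * F2 ^ T))"
  shows "real m \<le> H ^ (10 * D)"
proof (rule ccontr)
  assume contr: "\<not> real m \<le> H ^ (10 * D)"
  have H1: "H \<ge> 1" using H by simp
  have totient_pos: "totient m \<ge> 1" using m_pos by (simp add: Suc_le_eq)
  have deg_PQ: "degree (P * Q ^ n) \<le> D + D * n" if "degree P \<le> D" "degree Q \<le> D" for P Q :: "int poly"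
  proof -
    have "degree (P * Q ^ n) \<le> degree P + degree Q * n"
      using degree_mult_le[of P "Q ^ n"] degree_power_le[of Q n] by linarith
    also have "\<dots> \<le> D + D * n" using that by (intro add_mono mult_le_mono) auto
    finally show ?thesis .
  qed
  have "degree (C1 * F1 ^ n + C2 * F2 ^ n) \<le> D + D * n" by (intro degree_add_le deg_PQ deg)
  then have tot: "totient m \<le> D + D * n" using totient_le_degree[OF U] by linarith
  then have D: "D \<ge> 1" using totient_pos by (cases D) auto
  have H_le: "H ^ a \<le> H ^ (10 * D)" if "a \<le> 10 * D" for a using H1 that by (intro power_increasing)
  \<comment> \<open>\<open>m <= 3 (totient m)^2 <= 243 H^8 <= H^10\<close>, where
    \<open>243 <= 16^2\<close> accounts for the assumption \<open>H >= 16\<close>.\<close>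
  have small: False if "real (totient m) \<le> 9 * H ^ 4"
  proof -
    have "real m \<le> 3 * real (totient m) ^ 2"
      using m_pos by (rule le_totient_square_real)
    also have "\<dots> \<le> 3 * (9 * H ^ 4) ^ 2" using that by (intro mult_left_mono power_mono) auto
    also have "\<dots> = 243 * H ^ 8" by (simp add: power_mult_distrib flip: power_mult)
    also have "\<dots> \<le> H ^ 2 * H ^ 8"
    proof (rule mult_right_mono)
      have "16 ^ 2 \<le> H ^ 2" using H by (intro power_mono) auto
      then show "243 \<le> H ^ 2" by simp
    qed (use H1 in auto)
    also have "\<dots> = H ^ 10" by (simp flip: power_add)
    also have "\<dots> \<le> H ^ (10 * D)" using D by (intro H_le) simp
    finally show False using contr by simp
  qed
  have root_nz: "ipoly P \<zeta> \<noteq> 0" if "P \<noteq> 0" "degree P \<le> D" for P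
  proof
    assume "ipoly P \<zeta> = 0"
    then have "totient m \<le> D" using totient_le_degree that by fastforce
    then have "real (totient m) \<le> H" using H by linarith
    also have "\<dots> \<le> H ^ 4" using power_increasing[of 1 4 H] H1 by simp
    also have "\<dots> \<le> 9 * H ^ 4" using H1 by simp
    finally show False by (rule small)
  qed
  have nz': "ipoly C1 \<zeta> \<noteq> 0" "ipoly C2 \<zeta> \<noteq> 0" "ipoly F1 \<zeta> \<noteq> 0" "ipoly F2 \<zeta> \<noteq> 0"
    using root_nz nz deg by auto
  have eq: "ipoly C1 \<zeta> * ipoly F1 \<zeta> ^ n + ipoly C2 \<zeta> * ipoly F2 \<zeta> ^ n = 0"
    using U(2) by simp
  have norm_eq: "norm (ipoly F1 \<zeta>) = norm (ipoly F2 \<zeta>)"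
  proof (rule ccontr)
    assume ne: "norm (ipoly F1 \<zeta>) \<noteq> norm (ipoly F2 \<zeta>)"
    have "real n \<le> 8 * H\<^sup>2 * ln H" by (rule exponent_bound[OF nz' H1 bound eq ne])
    also have "\<dots> \<le> 8 * H\<^sup>2 * H" using H1 ln_le_minus_one[of H] by (intro mult_left_mono) auto
    finally have n_le: "real n \<le> 8 * H ^ 3" by (simp add: power2_eq_square power3_eq_cube)
    have "1 \<le> H ^ 3" using H1 by simp
    have "real (totient m) \<le> real D * (1 + real n)"
      using tot by (metis (mono_tags, lifting) distrib_left mult.right_neutral of_nat_1 of_nat_add of_nat_le_iff of_nat_mult)
    also have "\<dots> \<le> H * (9 * H ^ 3)"
    proof (rule mult_mono)
      show "1 + real n \<le> 9 * H ^ 3" using n_le \<open>1 \<le> H ^ 3\<close> by linarith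
    qed (use H in auto)
    also have "\<dots> = 9 * H ^ 4" by (simp add: power_numeral_reduce)
    finally show False by (rule small)
  qed
  define \<beta> where "\<beta> = ipoly F1 \<zeta> / ipoly F2 \<zeta>"
  have \<beta>_norm: "norm \<beta> = 1" using norm_eq nz' by (simp add: \<beta>_def norm_divide)
  have C1\<beta>: "ipoly C1 \<zeta> * \<beta> ^ n = - ipoly C2 \<zeta>"
  proof -
    have "ipoly F2 \<zeta> ^ n * (ipoly C1 \<zeta> * \<beta> ^ n + ipoly C2 \<zeta>) = 0"
      using eq nz' by (simp add: \<beta>_def power_divide algebra_simps)
    then show ?thesis using nz' by (simp add: eq_neg_iff_add_eq_0)
  qed
  \<comment> \<open>For \<open>n <= D\<close> the degree bound alone gives
    \<open>totient m <= D (D + 1)\<close>.\<close>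
  have n_gt_D: "n > D"
  proof (rule ccontr)
    assume "\<not> n > D"
    then have "D * n \<le> D * D" by (intro mult_le_mono2) simp
    moreover have "D * (D + 1) = D + D * D" by simp
    ultimately have "totient m \<le> D * (D + 1)" using tot by linarith
    then have "real (totient m) \<le> real D * (real D + 1)"
      by (metis of_nat_1 of_nat_add of_nat_le_iff of_nat_mult)
    also have "\<dots> \<le> H * H" using H by (intro mult_mono) auto
    also have "\<dots> = H ^ 2" by (simp add: power2_eq_square)
    also have "\<dots> \<le> H ^ 4" using H1 by (intro power_increasing) auto
    also have "\<dots> \<le> 9 * H ^ 4" using H1 by simp
    finally show False by (rule small)
  qed
  \<comment> \<open>The least positive denominator of \<open>\<beta>\<close>: it is 1 exactly if
    \<open>\<beta>\<close> is integral, and otherwise any prime factor of it will serve as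
    \<open>p\<close>.\<close>
  define b where "b = (LEAST b::nat. b > 0 \<and> of_nat b * \<beta> \<in> zring)"
  have "\<exists>b::nat. b > 0 \<and> of_nat b * \<beta> \<in> zring"
    using ex_denominator[of "ipoly F2 \<zeta>" "ipoly F1 \<zeta>"] nz' unfolding \<beta>_def by (metis ipoly_in_zring)
  then have b: "b > 0" "of_nat b * \<beta> \<in> zring" unfolding b_def by (metis (mono_tags, lifting) LeastI)+
  have b_least: "of_nat c * \<beta> \<notin> zring" if "0 < c" "c < b" for c
    using that not_less_Least unfolding b_def by blast
  show False
  proof (cases "b = 1")
    case True
    then have "\<beta> \<in> zring" using b by simp
    then obtain B where B: "\<beta> = ipoly B \<zeta>" by (rule zringE)
    have F: "ipoly F1 \<zeta> = ipoly B \<zeta> * ipoly F2 \<zeta>" using nz' by (simp add: \<beta>_def flip: B)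
    have norm_1: "norm (ipoly B (\<zeta> ^ k)) = 1" if "k \<in> totatives m" for k
    proof -
      have "norm (ipoly B \<zeta>) = norm (ipoly 1 \<zeta>)" using \<beta>_norm B by simp
      then have "norm (ipoly B (\<zeta> ^ k)) = norm (ipoly 1 (\<zeta> ^ k))"
        using that by (intro norm_eq_conjugate) (auto simp: in_totatives_iff)
      then show ?thesis by simp
    qed
    have C: "ipoly C2 \<zeta> = ipoly (- (B ^ n)) \<zeta> * ipoly C1 \<zeta>"
      using C1\<beta> by (simp add: B mult.commute)
    \<comment> \<open>\<open>S\<close> lies just above the square root of \<open>2 m\<close>, so
      \<open>S^2 <= 8 m\<close>.\<close>
    define S where "S = (LEAST s. 2 * m < s\<^sup>2)"
    have "2 * m < (Suc (2 * m))\<^sup>2" by (simp add: power2_eq_square)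
    then have S: "2 * m < S\<^sup>2" unfolding S_def by (rule LeastI)
    then obtain k where Sk: "S = Suc k" by (cases S) auto
    then have "\<not> 2 * m < k\<^sup>2" using not_less_Least[of k "\<lambda>s. 2 * m < s\<^sup>2"] by (simp add: S_def)
    then have k: "k\<^sup>2 \<le> 2 * m" by simp
    have "k \<noteq> 0" using S Sk m_pos by (intro notI) simp
    then have "S\<^sup>2 \<le> (2 * k)\<^sup>2" unfolding Sk by (intro power_mono) auto
    also have "\<dots> \<le> 8 * m" using k by (simp add: power_mult_distrib)
    finally have S2: "S\<^sup>2 \<le> 8 * m" .
    have "H ^ 1 \<le> H ^ (10 * D)" using D by (intro H_le) simp
    then have m16: "m \<ge> 16" using contr H by simp
    have "8 * m \<le> m * m" using m16 by (intro mult_le_mono1) simp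
    then have "S\<^sup>2 \<le> m\<^sup>2" using S2 unfolding power2_eq_square[of m] by linarith
    then have "S \<le> m" using power2_nat_le_eq_le by blast
    \<comment> \<open>Otherwise \<open>(totient m)^2 <= 8 m (D + 1)^2\<close>. Inserted into
      \<open>m^4 <= 64 (totient m)^6\<close> this leaves \<open>m <= 32768 (D + 1)^6\<close>, and
      \<open>32768 <= 16^4\<close>.\<close>
    have large: "S * (D + 1) < totient m"
    proof (rule ccontr)
      assume "\<not> S * (D + 1) < totient m"
      then have "(totient m)\<^sup>2 \<le> (S * (D + 1))\<^sup>2" by (intro power_mono) auto
      also have "\<dots> \<le> 8 * m * (D + 1)\<^sup>2" unfolding power_mult_distrib using S2 by (rule mult_le_mono1)
      finally have t2: "(totient m)\<^sup>2 \<le> 8 * m * (D + 1)\<^sup>2" .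
      have "m ^ 3 * m = (m\<^sup>2)\<^sup>2" by (simp add: power_numeral_reduce)
      also have "\<dots> \<le> (8 * totient m ^ 3)\<^sup>2" using totient_lower_bound[OF m_pos] by (intro power_mono) auto
      also have "\<dots> = 64 * ((totient m)\<^sup>2) ^ 3" by (simp add: power_mult_distrib flip: power_mult)
      also have "\<dots> \<le> 64 * (8 * m * (D + 1)\<^sup>2) ^ 3" using t2 by (intro mult_le_mono2 power_mono) auto
      also have "\<dots> = m ^ 3 * (32768 * (D + 1) ^ 6)" by (simp add: power_mult_distrib flip: power_mult)
      finally have "m \<le> 32768 * (D + 1) ^ 6" using m_pos by simp
      then have "real m \<le> real (32768 * (D + 1) ^ 6)" by (simp only: of_nat_le_iff)
      also have "\<dots> = 32768 * (real D + 1) ^ 6" by (simp add: add.commute)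
      also have "\<dots> \<le> H ^ 4 * H ^ 6"
      proof (rule mult_mono)
        have "16 ^ 4 \<le> H ^ 4" using H by (intro power_mono) auto
        then show "32768 \<le> H ^ 4" by simp
      qed (use H in \<open>auto intro: power_mono\<close>)
      also have "\<dots> = H ^ 10" by (simp flip: power_add)
      also have "\<dots> \<le> H ^ (10 * D)" using D by (intro H_le) simp
      finally show False using contr by simp
    qed
    obtain T s s' where "T > 0" "monom 1 s * F1 ^ T = monom 1 s' * F2 ^ T"
      using monomial_ratio[OF norm_1 F deg(3,4) S \<open>S \<le> m\<close> large] by blast
    \<comment> \<open>At \<open>\<zeta>\<close> the ratio \<open>C2 / C1\<close> is
      \<open>- \<beta>^n\<close>, whose conjugates also lie on the unit circle.\<close>
    moreover have "norm (ipoly (- (B ^ n)) (\<zeta> ^ k)) = 1" if "k \<in> totatives m" for k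
      using norm_1[OF that] by (simp add: norm_power)
    then obtain T s s' where "T > 0" "monom 1 s * C2 ^ T = monom 1 s' * C1 ^ T"
      using monomial_ratio[OF _ C deg(2,1) S \<open>S \<le> m\<close> large] by blast
    ultimately show False using not_monomial by blast
  next
    case False
    then obtain p where p: "prime p" "p dvd b" using prime_factor_nat by blast
    define r m' where "r = multiplicity p m" and "m' = m div p ^ r"
    have m_eq: "m = p ^ r * m'" by (simp add: r_def m'_def multiplicity_dvd)
    have p_m': "\<not> p dvd m'"
      unfolding m'_def r_def using m_pos p(1) by (intro multiplicity_decompose) auto
    define b' where "b' = b div p"
    have b': "b = p * b'" using p by (simp add: b'_def)
    have "b' > 0" using b b' by auto
    have "b' < b" using b' \<open>b' > 0\<close> prime_gt_1_nat[OF p(1)] by simp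
    \<comment> \<open>By minimality of \<open>b = p b'\<close>, the number \<open>b' \<beta>\<close>
      is not integral, while its \<open>p\<close>-fold is.\<close>
    define \<gamma> where "\<gamma> = of_nat b' * \<beta>"
    have \<gamma>_notin: "\<gamma> \<notin> zring" unfolding \<gamma>_def using \<open>b' > 0\<close> \<open>b' < b\<close> by (rule b_least)
    have p\<gamma>: "of_nat p * \<gamma> \<in> zring" using b(2) by (simp add: \<gamma>_def b' mult.assoc)
    interpret N: nonintegral m \<zeta> p r m' \<gamma>
      using p(1) m_eq p_m' \<gamma>_notin p\<gamma> by unfold_locales
    \<comment> \<open>A ramification index above \<open>D\<close> would force \<open>p\<close> to
      divide \<open>C1\<close> and, with the roles exchanged, also \<open>C2\<close>.\<close>
    have pr: "p ^ r \<le> 2 * D"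
    proof (cases "r = 0")
      case False
      have "\<not> D < totient (p ^ r)"
      proof
        assume e: "D < totient (p ^ r)"
        have "of_nat p dvd C1"
        proof (rule ccontr)
          assume "\<not> of_nat p dvd C1"
          moreover have "ipoly C1 \<zeta> * \<gamma> ^ n = of_nat b' ^ n * - ipoly C2 \<zeta>"
            unfolding C1\<beta>[symmetric] by (simp add: \<gamma>_def power_mult_distrib)
          then have "ipoly C1 \<zeta> * \<gamma> ^ n \<in> zring"
            by (simp only:) (intro zring_mult zring_power zring_uminus; simp)
          ultimately show False
            using N.no_bounded_denominator[OF _ deg(1) _ e n_gt_D] False by blast
        qed
        then have "\<not> of_nat p dvd C2" using prim[OF p(1)] by blast
        \<comment> \<open>Conjugation inverts \<open>\<beta>\<close>, as
          \<open>|\<beta>| = 1\<close>; so \<open>cnj \<gamma>\<close> is in the same situation with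
          \<open>C1\<close> and \<open>C2\<close> exchanged.\<close>
        have "cnj \<gamma> \<notin> zring" using zring_cnj[of "cnj \<gamma>"] \<gamma>_notin by auto
        moreover have "of_nat p * cnj \<gamma> \<in> zring" using zring_cnj[OF p\<gamma>] by simp
        ultimately interpret N': nonintegral m \<zeta> p r m' "cnj \<gamma>" by unfold_locales
        have "\<beta> * cnj \<beta> = 1" using \<beta>_norm by (simp add: complex_norm_square[symmetric])
        then have "\<beta> ^ n * cnj \<beta> ^ n = 1" by (simp flip: power_mult_distrib)
        moreover have "ipoly C2 \<zeta> = - (ipoly C1 \<zeta> * \<beta> ^ n)" using C1\<beta> by simp
        ultimately have eq': "ipoly C2 \<zeta> * cnj \<beta> ^ n = - ipoly C1 \<zeta>" by (simp add: mult.assoc)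
        have "ipoly C2 \<zeta> * cnj \<gamma> ^ n = of_nat b' ^ n * (ipoly C2 \<zeta> * cnj \<beta> ^ n)"
          by (simp add: \<gamma>_def power_mult_distrib mult_ac)
        also have "\<dots> = of_nat b' ^ n * - ipoly C1 \<zeta>" by (simp only: eq')
        finally have "ipoly C2 \<zeta> * cnj \<gamma> ^ n = of_nat b' ^ n * - ipoly C1 \<zeta>" .
        then have "ipoly C2 \<zeta> * cnj \<gamma> ^ n \<in> zring"
          by (simp only:) (intro zring_mult zring_power zring_uminus; simp)
        then show False
          using N'.no_bounded_denominator[OF \<open>\<not> of_nat p dvd C2\<close> deg(2) _ e n_gt_D] False by blast
      qed
      then show ?thesis using prime_power_le_totient[OF p(1), of r] False by simp
    qed (use D in simp)
    have \<gamma>_eq: "\<gamma> = of_nat b' * (ipoly F1 \<zeta> / ipoly F2 \<zeta>)"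
      by (simp add: \<gamma>_def \<beta>_def)
    have "real m' ^ n \<le> H ^ (2 * totient m)"
      by (rule N.residue_order_bound[OF nz'(1,4) \<gamma>_eq H1 bound eq n])
    \<comment> \<open>Since \<open>totient m <= D + D n <= 2 D n\<close>, the exponent becomes a
      multiple of \<open>n\<close> and the \<open>n\<close>-th root can be taken.\<close>
    also have "\<dots> \<le> H ^ (4 * D * n)"
    proof (rule power_increasing)
      have "D \<le> D * n" using n by simp
      moreover have "4 * D * n = 4 * (D * n)" by simp
      ultimately show "2 * totient m \<le> 4 * D * n" using tot by linarith
    qed (use H1 in simp)
    finally have "real m' ^ n \<le> (H ^ (4 * D)) ^ n" by (simp add: power_mult)
    then have m': "real m' \<le> H ^ (4 * D)" using n H1 by (simp add: power_mono_iff)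
    have "real m = real (p ^ r) * real m'" by (subst m_eq) (simp only: of_nat_mult)
    also have "\<dots> \<le> real (2 * D) * H ^ (4 * D)"
      using m' pr by (intro mult_mono) (simp_all only: of_nat_le_iff of_nat_0_le_iff)
    also have "\<dots> = 2 * real D * H ^ (4 * D)" by simp
    also have "\<dots> \<le> (H * H) * H ^ (4 * D)" using H by (intro mult_right_mono mult_mono) auto
    also have "\<dots> = H ^ (4 * D + 2)" by (simp add: power_add power2_eq_square)
    also have "\<dots> \<le> H ^ (10 * D)" using D by (intro H_le) simp
    finally show False using contr by simp
  qed
qed

section \<open>Transfer to rational polynomials\<close>

lemma map_poly_of_int_add:
  "map_poly rat_of_int (P + Q) = map_poly of_int P + map_poly of_int Q"
  by (simp add: poly_eq_iff coeff_map_poly)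

lemma map_poly_of_int_mult:
  "map_poly rat_of_int (P * Q) = map_poly of_int P * map_poly of_int Q"
  by (simp add: poly_eq_iff coeff_map_poly coeff_mult)

lemma map_poly_of_int_power:
  "map_poly rat_of_int (P ^ n) = map_poly of_int P ^ n"
  by (induction n) (simp_all add: map_poly_of_int_mult)

lemma map_poly_of_int_inj: "map_poly rat_of_int P = map_poly of_int Q \<Longrightarrow> P = Q"
  by (simp add: poly_eq_iff coeff_map_poly)

lemma ipoly_rat: "ipoly P z = poly (map_poly of_rat (map_poly rat_of_int P)) z"
  by (simp add: ipoly_def map_poly_map_poly o_def)

lemma ipoly_eq_0_if_smult:
  assumes "map_poly rat_of_int P = smult \<mu> p" "poly (map_poly of_rat p) z = 0"
  shows "ipoly P z = 0"
proof -
  have "map_poly of_rat (smult \<mu> p) = smult (of_rat \<mu>) (map_poly of_rat p :: complex poly)"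
    by (simp add: poly_eq_iff coeff_map_poly of_rat_mult)
  then show ?thesis using assms by (simp add: ipoly_rat)
qed

theorem theorem1p3:
  fixes c1 c2 f1 f2 :: "rat poly"
    and u :: "nat \<Rightarrow> rat poly"
    and D m :: nat
    and X :: real
    and \<zeta> :: complex
  assumes "c1 \<noteq> 0" and "c2 \<noteq> 0" and "f1 \<noteq> 0" and "f2 \<noteq> 0"
    and u: "\<And>n. n > 0 \<Longrightarrow> u n = c1 * f1 ^ n + c2 * f2 ^ n"
    and "\<not> (\<exists>(a::int) (b::int) (\<delta>::rat poly fract) (\<epsilon>::rat poly fract).
            b \<noteq> 0 \<and> \<delta> \<in> {1, -1} \<and> \<epsilon> \<in> {1, -1} \<and>
            to_fract c2 / to_fract c1 = \<delta> * to_fract [:0, 1:] powi a \<and>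
            to_fract f2 / to_fract f1 = \<epsilon> * to_fract [:0, 1:] powi b)"
    and D: "D = Max {degree c1, degree c2, degree f1, degree f2}"
    and X: "X = Max {3, poly_height [c1, c2], poly_height [f1, f2]}"
    and "m > 0"
    and "primitive_root_of_unity m \<zeta>"
    and "\<exists>n>0. u n \<noteq> 0 \<and> poly (map_poly of_rat (u n)) \<zeta> = 0"
  shows "real m \<le> exp (100 * real D * (X + real D))"
proof -
  interpret primitive_root m \<zeta> using assms(10) by unfold_locales
  obtain n where n: "n > 0" "u n \<noteq> 0" "poly (map_poly of_rat (u n)) \<zeta> = 0" using assms(11) by blast
  obtain \<mu> C1 C2 where C: "\<mu> \<noteq> 0" "map_poly of_int C1 = smult \<mu> c1" "map_poly of_int C2 = smult \<mu> c2"
    "\<And>i. real_of_int \<bar>coeff C1 i\<bar> \<le> exp (poly_height [c1, c2])"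
    "\<And>i. real_of_int \<bar>coeff C2 i\<bar> \<le> exp (poly_height [c1, c2])"
    "\<And>p. prime p \<Longrightarrow> \<not> (of_nat p dvd C1 \<and> of_nat p dvd C2)"
    using ex_primitive_integer_polys[OF assms(1), of c2] by metis
  obtain \<nu> F1 F2 where F: "\<nu> \<noteq> 0" "map_poly of_int F1 = smult \<nu> f1" "map_poly of_int F2 = smult \<nu> f2"
    "\<And>i. real_of_int \<bar>coeff F1 i\<bar> \<le> exp (poly_height [f1, f2])"
    "\<And>i. real_of_int \<bar>coeff F2 i\<bar> \<le> exp (poly_height [f1, f2])"
    using ex_primitive_integer_polys[OF assms(3), of f2] by metis
  have nz: "C1 \<noteq> 0" "C2 \<noteq> 0" "F1 \<noteq> 0" "F2 \<noteq> 0"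
    using C(1-3) F(1-3) assms(1-4) by auto
  have deg_eq: "degree P = degree p" if "map_poly rat_of_int P = smult \<kappa> p" "\<kappa> \<noteq> 0" for P \<kappa> p
    using that degree_map_poly[of rat_of_int P] by simp
  have deg: "degree C1 \<le> D" "degree C2 \<le> D" "degree F1 \<le> D" "degree F2 \<le> D"
    using C(1-3) F(1-3) by (auto simp: deg_eq D)
  have X_ge: "3 \<le> X" "poly_height [c1, c2] \<le> X" "poly_height [f1, f2] \<le> X" by (auto simp: X)
  \<comment> \<open>At most \<open>D + 1\<close> coefficients, each bounded by \<open>e^X\<close>,
    bound the values on the unit circle.\<close>
  define H where "H = (real D + 1) * exp X"
  have bound: "norm (ipoly P (\<zeta> ^ k)) \<le> H" if "P \<in> {C1, C2, F1, F2}" for P k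
    unfolding H_def
  proof (rule norm_ipoly_le)
    have "exp (poly_height [c1, c2]) \<le> exp X" "exp (poly_height [f1, f2]) \<le> exp X" using X_ge by auto
    then show "real_of_int \<bar>coeff P i\<bar> \<le> exp X" for i
      using that order_trans[OF C(4)[of i]] order_trans[OF C(5)[of i]]
        order_trans[OF F(4)[of i]] order_trans[OF F(5)[of i]] by blast
  qed (use that deg in auto)
  define U where "U = C1 * F1 ^ n + C2 * F2 ^ n"
  have U_eq: "map_poly of_int U = smult (\<mu> * \<nu> ^ n) (u n)"
    unfolding U_def u[OF n(1)] map_poly_of_int_add map_poly_of_int_mult map_poly_of_int_power C(2,3) F(2,3)
    by (simp add: smult_power smult_add_right mult.commute)
  have "U \<noteq> 0" using U_eq n(2) C(1) F(1) by auto
  have U_root: "ipoly U \<zeta> = 0" using U_eq n(3) by (rule ipoly_eq_0_if_smult)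
  \<comment> \<open>For \<open>D = 0\<close> the polynomial \<open>U\<close> would be a nonzero
    constant with a root.\<close>
  have D1: "D \<ge> 1"
  proof -
    have "degree (P * Q ^ n) = 0" if "D = 0" "degree P \<le> D" "degree Q \<le> D" for P Q :: "int poly"
      using that degree_mult_le[of P "Q ^ n"] degree_power_le[of Q n] by simp
    then have "degree U = 0" if "D = 0"
      using that deg degree_add_le[of "C1 * F1 ^ n" 0 "C2 * F2 ^ n"] by (simp add: U_def)
    moreover have "totient m \<le> degree U" using \<open>U \<noteq> 0\<close> U_root by (rule totient_le_degree)
    moreover have "totient m > 0" using m_pos by simp
    ultimately show ?thesis by (cases D) auto
  qed
  have H: "H \<ge> 16" "H \<ge> real D + 1"
  proof -
    have "2 ^ 3 \<le> exp (1::real) ^ 3"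
      using exp_ge_add_one_self[of "1::real"] by (intro power_mono) auto
    then have "8 \<le> exp (3::real)" by (simp flip: exp_of_nat_mult)
    also have "exp 3 \<le> exp X" using X_ge by simp
    finally have "(1 + 1) * 8 \<le> H" unfolding H_def using D1 by (intro mult_mono) auto
    then show "H \<ge> 16" by simp
    have "(real D + 1) * 1 \<le> H" unfolding H_def using X_ge by (intro mult_left_mono) auto
    then show "H \<ge> real D + 1" by simp
  qed
  \<comment> \<open>\<open>D + 1 <= e^D\<close> gives \<open>H <= e^(X + D)\<close>.\<close>
  have final: "H ^ (10 * D) \<le> exp (100 * real D * (X + real D))"
  proof -
    have "real D + 1 \<le> exp (real D)" using exp_ge_add_one_self[of "real D"] by (simp add: add.commute)
    then have "H \<le> exp (real D) * exp X" unfolding H_def by (intro mult_right_mono) auto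
    also have "\<dots> = exp (X + real D)" by (simp add: exp_add)
    finally have "H ^ (10 * D) \<le> exp (X + real D) ^ (10 * D)" using H by (intro power_mono) auto
    also have "\<dots> = exp (10 * (real D * (X + real D)))" by (simp flip: exp_of_nat_mult add: mult.assoc)
    also have "\<dots> \<le> exp (100 * (real D * (X + real D)))" using X_ge by simp
    finally show ?thesis by (simp add: mult.assoc)
  qed
  have "real m \<le> H ^ (10 * D)"
  proof (cases "(\<exists>T s s'. T > 0 \<and> monom 1 s * C2 ^ T = monom 1 s' * C1 ^ T) \<and>
      (\<exists>T s s'. T > 0 \<and> monom 1 s * F1 ^ T = monom 1 s' * F2 ^ T)")
    case False
    show ?thesis
      using order_le[OF nz deg H bound C(6) n(1)] \<open>U \<noteq> 0\<close> U_root False unfolding U_def by blast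
  next
    case True
    have ratio: "monom 1 s * p ^ T = monom 1 s' * q ^ T"
      if "monom 1 s * P ^ T = monom 1 s' * Q ^ T"
        "map_poly of_int P = smult \<kappa> p" "map_poly of_int Q = smult \<kappa> q" "\<kappa> \<noteq> 0"
      for P Q :: "int poly" and p q :: "rat poly" and \<kappa> s s' T
    proof -
      have "map_poly rat_of_int (monom 1 s * P ^ T) = map_poly of_int (monom 1 s' * Q ^ T)"
        using that(1) by simp
      then have "smult (\<kappa> ^ T) (monom 1 s * p ^ T) = smult (\<kappa> ^ T) (monom 1 s' * q ^ T)"
        by (simp add: map_poly_of_int_mult map_poly_of_int_power that(2,3) map_poly_monom smult_power)
      then show ?thesis using that(4) by (metis smult_cancel power_not_zero)
    qed
    obtain T s s' where T: "T > 0" "monom 1 s * F1 ^ T = monom 1 s' * F2 ^ T" using True by blast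
    obtain b \<epsilon> where b: "\<epsilon> \<in> {1, -1}" "to_fract f2 / to_fract f1 = \<epsilon> * to_fract [:0, 1:] powi b"
      using monomial_ratio_rat[OF assms(3,4) T(1) ratio[OF T(2) F(2,3,1)]] by blast
    obtain T s s' where T: "T > 0" "monom 1 s * C2 ^ T = monom 1 s' * C1 ^ T" using True by blast
    obtain a \<delta> where a: "\<delta> \<in> {1, -1}" "to_fract c2 / to_fract c1 = \<delta> * to_fract [:0, 1:] powi a"
      using monomial_ratio_rat[OF assms(1,2) T(1) ratio[OF T(2) C(3,2,1), symmetric]] by blast
    \<comment> \<open>When both ratios are monomial up to sign, the hypothesis leaves only
      \<open>b = 0\<close>, that is \<open>f2 = f1\<close> or \<open>f2 = - f1\<close>. Then
      \<open>U\<close> is \<open>F1^n\<close> times a polynomial of degree at most \<open>D\<close>,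
      and \<open>\<zeta>\<close> is a root of one of the two factors.\<close>
    have "b = 0" using assms(6) a b by blast
    then have "to_fract f2 = \<epsilon> * to_fract f1" using b assms(3) by (simp add: field_simps)
    then have "f2 = f1 \<or> f2 = - f1" using b(1) by (auto simp flip: to_fract_uminus)
    then have "map_poly rat_of_int F2 = map_poly of_int F1 \<or> map_poly rat_of_int F2 = map_poly of_int (- F1)"
      unfolding F by (auto simp: poly_eq_iff coeff_map_poly F(2)[unfolded poly_eq_iff, simplified coeff_map_poly])
    then have "F2 = F1 \<or> F2 = - F1" using map_poly_of_int_inj by blast
    then obtain e :: int where "e = 1 \<or> e = -1" and F2: "F2 = smult e F1" by fastforce
    define V where "V = C1 + smult (e ^ n) C2"
    have UV: "U = V * F1 ^ n" by (simp add: U_def V_def F2 smult_power algebra_simps)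
    then have "V \<noteq> 0" using \<open>U \<noteq> 0\<close> by auto
    have "ipoly V \<zeta> = 0 \<or> ipoly F1 \<zeta> = 0" using U_root by (auto simp: UV)
    moreover have "degree V \<le> D" unfolding V_def using deg by (intro degree_add_le) auto
    ultimately have "totient m \<le> D"
      using totient_le_degree[OF \<open>V \<noteq> 0\<close>] totient_le_degree[OF nz(3)] deg(3) by linarith
    then have "real (totient m) \<le> H" using H by linarith
    have "real m \<le> 3 * real (totient m) ^ 2"
      using m_pos by (rule le_totient_square_real)
    also have "\<dots> \<le> H * H ^ 2" using H \<open>real (totient m) \<le> H\<close> by (intro mult_mono power_mono) auto
    also have "\<dots> = H ^ 3" by (simp add: power_numeral_reduce)
    also have "\<dots> \<le> H ^ (10 * D)" using H D1 by (intro power_increasing) auto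
    finally show ?thesis .
  qed
  with final show ?thesis by linarith
qed

end
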